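(* Let $\mathfrak g/\mathfrak p_S$ be irreducible, $S=\pi\setminus\{\alpha_s\}$, and let $w_1,w_2\in W^S$ be elements of equal length $l(w_1)=l(w_2)$. 1) One has $w_1.0-w_2.0\in Q_S$. 2) If $w_1\ne w_2$ then $w_1.0-w_2.0\notin Q_S^+$. Moreover, if $w,w'\in W^S$ and $l(w)=l(w')+1$, then the coefficient of the simple root $\alpha_s$ in $w'.0-w.0\in Q$ is $1$.
   Context: $\mathfrak g$ is a finite-dimensional complex simple Lie algebra with Cartan subalgebra $\mathfrak h$, root system $R$, simple roots $\pi$, positive/negative roots $R^\pm$, root lattice $Q=\mathbb ZR$, $Q^+=\mathbb N_0R^+$ (with $\mathbb N_0$ the nonnegative integers), Weyl group $W$ with length function $l$, half sum of positive roots $\rho$. For $S\subset\pi$: $Q_S=\mathbb ZS$, $Q_S^+=Q_S\cap Q^+$, $R_S^\pm=Q_S\cap R^\pm$, $\mathfrak p_S=\mathfrak h\oplus\bigoplus_{\alpha\in R^+\cup R_S^-}\mathfrak g_\alpha$, $W^S=\{w\in W\mid R_S^+\subset wR^+\}$. The shifted action is $w.\mu=w(\mu+\rho)-\rho$. $\mathfrak g/\mathfrak p_S$ is irreducible if the adjoint representation of $\mathfrak p_S$ on $\mathfrak g/\mathfrak p_S$ is irreducible; equivalently $S=\pi\setminus\{\alpha_s\}$ where $\alpha_s$ occurs in every positive root with coefficient at most one. *)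

theory Defs
  imports Complex_Main "HOL-Library.Function_Algebras" "HOL-Computational_Algebra.Group_Closure"
    "HOL-Algebra.Generated_Groups" "HOL-Algebra.Bij"
begin

section \<open>Complex Lie algebras\<close>

class complex_lie_algebra = ab_group_add +
  fixes scaleC :: "complex \<Rightarrow> 'a \<Rightarrow> 'a"  (infixr \<open>*\<^sub>C\<close> 75)
    and bracket :: "'a \<Rightarrow> 'a \<Rightarrow> 'a"
  assumes scaleC_add_right: "a *\<^sub>C (x + y) = a *\<^sub>C x + a *\<^sub>C y"
    and scaleC_add_left: "(a + b) *\<^sub>C x = a *\<^sub>C x + b *\<^sub>C x"
    and scaleC_scaleC: "a *\<^sub>C b *\<^sub>C x = (a * b) *\<^sub>C x"
    and scaleC_one: "1 *\<^sub>C x = x"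
    and bracket_add_left: "bracket (x + y) z = bracket x z + bracket y z"
    and bracket_add_right: "bracket x (y + z) = bracket x y + bracket x z"
    and bracket_scaleC_left: "bracket (a *\<^sub>C x) y = a *\<^sub>C bracket x y"
    and bracket_scaleC_right: "bracket x (a *\<^sub>C y) = a *\<^sub>C bracket x y"
    and bracket_self: "bracket x x = 0"
    and jacobi: "bracket x (bracket y z) + bracket y (bracket z x) + bracket z (bracket x y) = 0"

global_interpretation lie: vector_space "scaleC :: complex \<Rightarrow> 'a \<Rightarrow> 'a::complex_lie_algebra"
  defines lie_span = lie.span and lie_subspace = lie.subspace
  by standard (simp_all add: scaleC_add_right scaleC_add_left scaleC_scaleC scaleC_one)

definition lie_ideal :: "'g::complex_lie_algebra set \<Rightarrow> bool" where
  "lie_ideal I \<longleftrightarrow> lie_subspace I \<and> (\<forall>x. \<forall>y\<in>I. bracket x y \<in> I)"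

definition finite_dimensional_lie_algebra :: "'g::complex_lie_algebra itself \<Rightarrow> bool" where
  "finite_dimensional_lie_algebra _ \<longleftrightarrow> (\<exists>B :: 'g set. finite B \<and> lie_span B = UNIV)"

definition simple_lie_algebra :: "'g::complex_lie_algebra itself \<Rightarrow> bool" where
  "simple_lie_algebra _ \<longleftrightarrow>
     (\<exists>x y :: 'g. bracket x y \<noteq> 0) \<and> (\<forall>I :: 'g set. lie_ideal I \<longrightarrow> I = {0} \<or> I = UNIV)"

definition lie_subalgebra :: "'g::complex_lie_algebra set \<Rightarrow> bool" where
  "lie_subalgebra H \<longleftrightarrow> lie_subspace H \<and> (\<forall>x\<in>H. \<forall>y\<in>H. bracket x y \<in> H)"

primrec lower_central_series :: "'g::complex_lie_algebra set \<Rightarrow> nat \<Rightarrow> 'g set" where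
  "lower_central_series H 0 = H"
| "lower_central_series H (Suc n) = lie_span {bracket x y | x y. x \<in> H \<and> y \<in> lower_central_series H n}"

definition cartan_subalgebra :: "'g::complex_lie_algebra set \<Rightarrow> bool" where
  "cartan_subalgebra H \<longleftrightarrow>
     lie_subalgebra H \<and>
     (\<exists>n. lower_central_series H n = {0}) \<and>
     {x. \<forall>y\<in>H. bracket x y \<in> H} = H"


section \<open>Roots\<close>

text \<open>
  An element of the dual space of a subspace \<open>H\<close> is represented by a function that is linear
  on \<open>H\<close> and vanishes outside \<open>H\<close> (so that two such functions are equal iff they agree on \<open>H\<close>).
  Addition is pointwise.
\<close>

definition dual :: "'g::complex_lie_algebra set \<Rightarrow> ('g \<Rightarrow> complex) set" where
  "dual H = {f. (\<forall>x\<in>H. \<forall>y\<in>H. f (x + y) = f x + f y) \<and> (\<forall>a. \<forall>x\<in>H. f (a *\<^sub>C x) = a * f x) \<and>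
                (\<forall>x. x \<notin> H \<longrightarrow> f x = 0)}"

global_interpretation fn: vector_space "\<lambda>(a::complex) (f :: 'a \<Rightarrow> complex) x. a * f x"
  defines fn_span = fn.span and fn_dependent = fn.dependent and coefficient = fn.representation
  by standard (simp_all add: fun_eq_iff algebra_simps)

definition root_space :: "'g::complex_lie_algebra set \<Rightarrow> ('g \<Rightarrow> complex) \<Rightarrow> 'g set" where
  "root_space H \<alpha> = {x. \<forall>h\<in>H. bracket h x = \<alpha> h *\<^sub>C x}"

definition roots :: "'g::complex_lie_algebra set \<Rightarrow> ('g \<Rightarrow> complex) set" where
  "roots H = {\<alpha> \<in> dual H. \<alpha> \<noteq> 0 \<and> root_space H \<alpha> \<noteq> {0}}"

text \<open>Nonnegative integer combinations, written as finite sums with repetitions allowed. Integer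
  combinations are given by \<^const>\<open>group_closure\<close>.\<close>

definition nat_span :: "'a::comm_monoid_add set \<Rightarrow> 'a set" where
  "nat_span A = {sum_list xs | xs. set xs \<subseteq> A}"

definition simple_roots :: "'g::complex_lie_algebra set \<Rightarrow> ('g \<Rightarrow> complex) set \<Rightarrow> bool" where
  "simple_roots H \<pi> \<longleftrightarrow>
     \<pi> \<subseteq> roots H \<and> \<not> fn_dependent \<pi> \<and> fn_span \<pi> = dual H \<and>
     (\<forall>\<alpha>\<in>roots H. \<alpha> \<in> nat_span \<pi> \<or> - \<alpha> \<in> nat_span \<pi>)"

definition pos_roots :: "'g::complex_lie_algebra set \<Rightarrow> ('g \<Rightarrow> complex) set \<Rightarrow> ('g \<Rightarrow> complex) set" where
  "pos_roots H \<pi> = {\<alpha> \<in> roots H. \<alpha> \<in> nat_span \<pi>}"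

definition neg_roots :: "'g::complex_lie_algebra set \<Rightarrow> ('g \<Rightarrow> complex) set \<Rightarrow> ('g \<Rightarrow> complex) set" where
  "neg_roots H \<pi> = {\<alpha> \<in> roots H. - \<alpha> \<in> nat_span \<pi>}"

definition root_lattice :: "'g::complex_lie_algebra set \<Rightarrow> ('g \<Rightarrow> complex) set" where
  "root_lattice H = group_closure (roots H)"

definition pos_lattice :: "'g::complex_lie_algebra set \<Rightarrow> ('g \<Rightarrow> complex) set \<Rightarrow> ('g \<Rightarrow> complex) set" where
  "pos_lattice H \<pi> = nat_span (pos_roots H \<pi>)"

definition half_sum :: "'g::complex_lie_algebra set \<Rightarrow> ('g \<Rightarrow> complex) set \<Rightarrow> 'g \<Rightarrow> complex" where
  "half_sum H \<pi> = (\<lambda>x. (\<Sum>\<alpha>\<in>pos_roots H \<pi>. \<alpha> x) / 2)"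


section \<open>The Weyl group\<close>

text \<open>The coroot is the unique element \<open>t\<close> of \<open>[\<gg>\<^sub>\<alpha>, \<gg>\<^sub>-\<^sub>\<alpha>]\<close> with \<open>\<alpha> t = 2\<close>; the reflection in
  \<open>\<alpha>\<close> is then \<open>\<lambda> \<mapsto> \<lambda> - 2 (\<lambda>,\<alpha>)/(\<alpha>,\<alpha>) \<alpha>\<close> for the form induced by the Killing form.\<close>

definition coroot :: "'g::complex_lie_algebra set \<Rightarrow> ('g \<Rightarrow> complex) \<Rightarrow> 'g" where
  "coroot H \<alpha> =
     (THE t. t \<in> lie_span {bracket x y | x y. x \<in> root_space H \<alpha> \<and> y \<in> root_space H (- \<alpha>)} \<and> \<alpha> t = 2)"

definition reflection ::
    "'g::complex_lie_algebra set \<Rightarrow> ('g \<Rightarrow> complex) \<Rightarrow> ('g \<Rightarrow> complex) \<Rightarrow> 'g \<Rightarrow> complex" where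
  "reflection H \<alpha> = (\<lambda>\<mu> \<in> dual H. \<lambda>x. \<mu> x - \<mu> (coroot H \<alpha>) * \<alpha> x)"

definition weyl_group ::
    "'g::complex_lie_algebra set \<Rightarrow> (('g \<Rightarrow> complex) \<Rightarrow> 'g \<Rightarrow> complex) set" where
  "weyl_group H = generate (BijGroup (dual H)) (reflection H ` roots H)"

definition weyl_length ::
    "'g::complex_lie_algebra set \<Rightarrow> ('g \<Rightarrow> complex) set \<Rightarrow> (('g \<Rightarrow> complex) \<Rightarrow> 'g \<Rightarrow> complex) \<Rightarrow> nat" where
  "weyl_length H \<pi> w =
     (LEAST n. \<exists>\<alpha>s. length \<alpha>s = n \<and> set \<alpha>s \<subseteq> \<pi> \<and>
        w = foldr (\<lambda>\<alpha> v. reflection H \<alpha> \<otimes>\<^bsub>BijGroup (dual H)\<^esub> v) \<alpha>s \<one>\<^bsub>BijGroup (dual H)\<^esub>)"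

definition shifted_action ::
    "'g::complex_lie_algebra set \<Rightarrow> ('g \<Rightarrow> complex) set \<Rightarrow>
     (('g \<Rightarrow> complex) \<Rightarrow> 'g \<Rightarrow> complex) \<Rightarrow> ('g \<Rightarrow> complex) \<Rightarrow> 'g \<Rightarrow> complex" where
  "shifted_action H \<pi> w \<mu> = w (\<mu> + half_sum H \<pi>) - half_sum H \<pi>"


section \<open>Standard parabolic subalgebras\<close>

text \<open>In the following, \<open>S\<close> is a subset of the set \<open>\<pi>\<close> of simple roots.\<close>

definition levi_lattice :: "('g::complex_lie_algebra \<Rightarrow> complex) set \<Rightarrow> ('g \<Rightarrow> complex) set" where
  "levi_lattice S = group_closure S"

definition pos_levi_lattice ::
    "'g::complex_lie_algebra set \<Rightarrow> ('g \<Rightarrow> complex) set \<Rightarrow> ('g \<Rightarrow> complex) set \<Rightarrow> ('g \<Rightarrow> complex) set" where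
  "pos_levi_lattice H \<pi> S = levi_lattice S \<inter> pos_lattice H \<pi>"

definition pos_levi_roots ::
    "'g::complex_lie_algebra set \<Rightarrow> ('g \<Rightarrow> complex) set \<Rightarrow> ('g \<Rightarrow> complex) set \<Rightarrow> ('g \<Rightarrow> complex) set" where
  "pos_levi_roots H \<pi> S = levi_lattice S \<inter> pos_roots H \<pi>"

definition neg_levi_roots ::
    "'g::complex_lie_algebra set \<Rightarrow> ('g \<Rightarrow> complex) set \<Rightarrow> ('g \<Rightarrow> complex) set \<Rightarrow> ('g \<Rightarrow> complex) set" where
  "neg_levi_roots H \<pi> S = levi_lattice S \<inter> neg_roots H \<pi>"

definition parabolic ::
    "'g::complex_lie_algebra set \<Rightarrow> ('g \<Rightarrow> complex) set \<Rightarrow> ('g \<Rightarrow> complex) set \<Rightarrow> 'g set" where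
  "parabolic H \<pi> S =
     lie_span (H \<union> (\<Union>\<alpha> \<in> pos_roots H \<pi> \<union> neg_levi_roots H \<pi> S. root_space H \<alpha>))"

definition min_coset_reps ::
    "'g::complex_lie_algebra set \<Rightarrow> ('g \<Rightarrow> complex) set \<Rightarrow> ('g \<Rightarrow> complex) set \<Rightarrow>
     (('g \<Rightarrow> complex) \<Rightarrow> 'g \<Rightarrow> complex) set" where
  "min_coset_reps H \<pi> S = {w \<in> weyl_group H. pos_levi_roots H \<pi> S \<subseteq> w ` pos_roots H \<pi>}"

definition quotient_class :: "'g::complex_lie_algebra set \<Rightarrow> 'g \<Rightarrow> 'g set" where
  "quotient_class P x = (\<lambda>p. x + p) ` P"

text \<open>The quotient space \<open>\<gg>/P\<close> is the set \<open>range (quotient_class P)\<close> of cosets, on which a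
  subalgebra \<open>P\<close> acts by \<open>y \<cdot> (x + P) = [y, x] + P\<close>.\<close>

definition quotient_subrep :: "'g::complex_lie_algebra set \<Rightarrow> 'g set set \<Rightarrow> bool" where
  "quotient_subrep P N \<longleftrightarrow>
     N \<subseteq> range (quotient_class P) \<and>
     quotient_class P 0 \<in> N \<and>
     (\<forall>x y. quotient_class P x \<in> N \<and> quotient_class P y \<in> N \<longrightarrow> quotient_class P (x + y) \<in> N) \<and>
     (\<forall>a x. quotient_class P x \<in> N \<longrightarrow> quotient_class P (a *\<^sub>C x) \<in> N) \<and>
     (\<forall>y\<in>P. \<forall>x. quotient_class P x \<in> N \<longrightarrow> quotient_class P (bracket y x) \<in> N)"

definition irreducible_quotient :: "'g::complex_lie_algebra set \<Rightarrow> bool" where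
  "irreducible_quotient P \<longleftrightarrow>
     range (quotient_class P) \<noteq> {quotient_class P 0} \<and>
     (\<forall>N. quotient_subrep P N \<longrightarrow> N = {quotient_class P 0} \<or> N = range (quotient_class P))"

end

theory Submission
  imports Defs "HOL-Computational_Algebra.Fundamental_Theorem_Algebra"
begin

text \<open>
  For \<open>w \<in> W\<close> let \<open>\<Phi>\<^sub>w = R\<^sup>+ \<inter> wR\<^sup>-\<close>. Then \<open>w.0 = w\<rho> - \<rho>\<close> is minus the sum of \<open>\<Phi>\<^sub>w\<close>, and \<open>l(w) = |\<Phi>\<^sub>w|\<close>.
  If \<open>w \<in> W\<^sup>S\<close>, then no root of \<open>\<Phi>\<^sub>w\<close> lies in \<open>Q\<^sub>S\<close>, so by irreducibility each of them contains \<open>\<alpha>\<^sub>s\<close> with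
  coefficient \<open>1\<close>, and the coefficient of \<open>\<alpha>\<^sub>s\<close> in \<open>w.0\<close> is \<open>-l(w)\<close>. If \<open>\<gamma> = w\<^sub>1.0 - w\<^sub>2.0\<close> lies in \<open>Q\<^sub>S\<^sup>+\<close>, then
  \<open>w\<^sub>2\<^sup>-\<^sup>1\<gamma>\<close> is a sum of positive roots, so \<open>(w\<^sub>2\<rho>, \<gamma>) \<ge> 0\<close>, and \<open>|w\<^sub>2\<rho> + \<gamma>| = |w\<^sub>1\<rho>| = |\<rho>| = |w\<^sub>2\<rho>|\<close>
  forces \<open>\<gamma> = 0\<close>, whence \<open>w\<^sub>1 = w\<^sub>2\<close>.

  That \<open>R\<close> is a reduced root system follows from the vanishing of traces of commutators on suitable
  sums of weight spaces. Since the given simple roots span the dual of \<open>H\<close>, the subalgebra \<open>H\<close> is abelian,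
  and the Killing form is nonzero on the element of \<open>H\<close> on which all simple roots are \<open>1\<close>; hence it is nondegenerate.
\<close>

section \<open>Traces and eigenvectors\<close>

text \<open>Semisimplicity of the operators ad h is not known at the outset, so the decomposition
  uses generalized weight spaces \<open>W \<nu>\<close>; genuine eigenspaces return only once the
  root spaces are shown to be lines. The structure theory then rests on one identity: if x and y
  preserve a sum of spaces \<open>U \<nu>\<close> and [x, y] lies in \<open>H\<close> and preserves
  each of them, the trace of ad [x, y] is both 0 and the sum of \<nu>([x, y]) dim
  \<open>U \<nu>\<close>. Three choices of the sum give, in turn, \<alpha>([e, f]) \<noteq> 0, dim
  \<open>W (- \<alpha>)\<close> = 1 with no further multiples, and the root strings. On the Weyl
  group side the obstacle is positivity: functionals are complex-valued, so the invariant form is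
  built from real parts of values at coroots and is only semidefinite. That a norm 0 still forces
  \<gamma> = 0 comes from two facts: root lattice elements are integral at coroots, and the sum of
  all positive coroots pairs with a functional to twice its height, which is positive for a nonempty
  sum of positive roots.\<close>

abbreviation lie_linear :: "('g::complex_lie_algebra \<Rightarrow> 'g) \<Rightarrow> bool" where
  "lie_linear \<equiv> Vector_Spaces.linear scaleC scaleC"

text \<open>The basis is a parameter because traces are taken on various invariant subspaces. The
  value is the trace on the span of \<open>B\<close> when \<open>B\<close> is finite and independent
  and \<open>f\<close> preserves that span.\<close>

definition trace_on :: "'g::complex_lie_algebra set \<Rightarrow> ('g \<Rightarrow> 'g) \<Rightarrow> complex" where
  "trace_on B f = (\<Sum>b\<in>B. lie.representation B (f b) b)"

lemma representation_expand:
  assumes "finite C" "lie.independent B" "C \<subseteq> lie.span B" "v \<in> lie.span C" "lie.independent C"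
  shows "lie.representation B v b = (\<Sum>c\<in>C. lie.representation C v c * lie.representation B c b)"
proof -
  have "lie.representation B v b = lie.representation B (\<Sum>c\<in>C. lie.representation C v c *\<^sub>C c) b"
    using assms by (simp add: lie.sum_representation_eq)
  also have "\<dots> = (\<Sum>c\<in>C. lie.representation B (lie.representation C v c *\<^sub>C c) b)"
    using assms by (subst lie.representation_sum) (auto intro: lie.span_scale)
  also have "\<dots> = (\<Sum>c\<in>C. lie.representation C v c * lie.representation B c b)"
    using assms by (intro sum.cong) (auto simp: lie.representation_scale)
  finally show ?thesis .
qed

lemma trace_on_compose_commute:
  assumes B: "finite B" "lie.independent B"
    and f: "lie_linear f" "f ` lie.span B \<subseteq> lie.span B" and g: "lie_linear g" "g ` lie.span B \<subseteq> lie.span B"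
  shows "trace_on B (f \<circ> g) = trace_on B (g \<circ> f)"
proof -
  have *: "trace_on B (f \<circ> g) = (\<Sum>b\<in>B. \<Sum>c\<in>B. lie.representation B (g b) c * lie.representation B (f c) b)"
    if f: "lie_linear f" "f ` lie.span B \<subseteq> lie.span B" and g: "lie_linear g" "g ` lie.span B \<subseteq> lie.span B"
    for f g
    unfolding trace_on_def
  proof (rule sum.cong[OF refl])
    fix b assume b: "b \<in> B"
    interpret f: Vector_Spaces.linear scaleC scaleC f by fact
    have gb: "g b \<in> lie.span B" and fB: "\<And>c. c \<in> B \<Longrightarrow> f c \<in> lie.span B"
      using b f g lie.span_base by blast+
    have "f (g b) = f (\<Sum>c\<in>B. lie.representation B (g b) c *\<^sub>C c)"
      using B gb by (simp add: lie.sum_representation_eq)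
    also have "\<dots> = (\<Sum>c\<in>B. lie.representation B (g b) c *\<^sub>C f c)"
      by (simp add: f.sum f.scale)
    finally have "lie.representation B (f (g b)) b = lie.representation B (\<Sum>c\<in>B. lie.representation B (g b) c *\<^sub>C f c) b"
      by simp
    also have "\<dots> = (\<Sum>c\<in>B. lie.representation B (lie.representation B (g b) c *\<^sub>C f c) b)"
      using B fB by (subst lie.representation_sum) (auto intro: lie.span_scale)
    also have "\<dots> = (\<Sum>c\<in>B. lie.representation B (g b) c * lie.representation B (f c) b)"
      using B fB by (intro sum.cong) (auto simp: lie.representation_scale)
    finally show "lie.representation B ((f \<circ> g) b) b = \<dots>" by simp
  qed
  show ?thesis
    unfolding *[OF f g] *[OF g f] by (subst sum.swap) (simp add: mult.commute)
qed

text \<open>Both traces equal the trace of the transition matrix between the bases times a mixed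
  matrix of \<open>f\<close>. This permits, below, a basis adapted to the image of
  \<open>f\<close>.\<close>

lemma trace_on_basis_change:
  assumes B: "finite B" "lie.independent B" and C: "finite C" "lie.independent C" "lie.span C = lie.span B"
    and f: "lie_linear f" "f ` lie.span B \<subseteq> lie.span B"
  shows "trace_on B f = trace_on C f"
proof -
  interpret f: Vector_Spaces.linear scaleC scaleC f by fact
  have fB: "f b \<in> lie.span B" if "b \<in> lie.span B" for b using f that by blast
  have BC: "B \<subseteq> lie.span C" "C \<subseteq> lie.span B" using C lie.span_superset by auto
  have fC: "f c \<in> lie.span C" if "c \<in> C" for c using fB C(3) BC that by auto
  have "trace_on B f = (\<Sum>b\<in>B. \<Sum>c\<in>C. lie.representation C (f b) c * lie.representation B c b)"
    unfolding trace_on_def using B C BC fB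
    by (intro sum.cong refl representation_expand) (auto simp: lie.span_base)
  also have "\<dots> = (\<Sum>c\<in>C. \<Sum>b\<in>B. lie.representation B c b * lie.representation C (f b) c)"
    by (subst sum.swap) (simp add: mult.commute)
  also have "\<dots> = (\<Sum>c\<in>C. lie.representation C (f c) c)"
  proof (rule sum.cong[OF refl])
    fix c assume c: "c \<in> C"
    have "f c = f (\<Sum>b\<in>B. lie.representation B c b *\<^sub>C b)"
      using B C BC c by (subst lie.sum_representation_eq) auto
    also have "\<dots> = (\<Sum>b\<in>B. lie.representation B c b *\<^sub>C f b)" by (simp add: f.sum f.scale)
    finally have "lie.representation C (f c) c = lie.representation C (\<Sum>b\<in>B. lie.representation B c b *\<^sub>C f b) c"
      by simp
    also have "\<dots> = (\<Sum>b\<in>B. lie.representation C (lie.representation B c b *\<^sub>C f b) c)"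
      using C fB by (subst lie.representation_sum) (auto intro!: lie.span_scale simp: lie.span_base)
    also have "\<dots> = (\<Sum>b\<in>B. lie.representation B c b * lie.representation C (f b) c)"
      using C fB by (intro sum.cong) (auto simp: lie.representation_scale lie.span_base)
    finally show "(\<Sum>b\<in>B. lie.representation B c b * lie.representation C (f b) c) = lie.representation C (f c) c" ..
  qed
  finally show ?thesis unfolding trace_on_def .
qed

lemma lie_span_image:
  fixes f :: "'g::complex_lie_algebra \<Rightarrow> 'g"
  assumes "lie_linear f"
  shows "lie.span (f ` B) = f ` lie.span B"
proof -
  interpret f: Vector_Spaces.linear scaleC scaleC f by fact
  show ?thesis using f.span_image[of B] by (simp add: lie_span_def)
qed

text \<open>Passing from V to f(V) lowers the exponent by one and keeps the trace: in a basis of V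
  that extends a basis C of f(V), the vectors outside C contribute nothing, since f sends them into
  the span of C.\<close>

lemma trace_on_nilpotent:
  assumes "finite B" "lie.independent B" "lie_linear f" "f ` lie.span B \<subseteq> lie.span B"
    and "\<And>x. x \<in> lie.span B \<Longrightarrow> (f ^^ n) x = 0"
  shows "trace_on B f = 0"
  using assms
proof (induction n arbitrary: B)
  case 0
  then have "B \<subseteq> {0}" by (auto simp: lie.span_base)
  moreover have "0 \<notin> B" using 0 lie.dependent_zero by blast
  ultimately have "B = {}" by auto
  then show ?case by (simp add: trace_on_def)
next
  case (Suc n)
  note f = Suc.prems(3)
  obtain C where C: "C \<subseteq> f ` B" "lie.independent C" "f ` B \<subseteq> lie.span C"
    using lie.maximal_independent_subset by blast
  have "finite C" using C Suc.prems(1) finite_subset by blast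
  have spanC: "lie.span C = f ` lie.span B"
  proof
    show "lie.span C \<subseteq> f ` lie.span B"
      unfolding lie_span_image[OF f, symmetric] by (rule lie.span_mono[OF C(1)])
    show "f ` lie.span B \<subseteq> lie.span C"
      unfolding lie_span_image[OF f, symmetric] by (rule lie.span_minimal[OF C(3) lie.subspace_span])
  qed
  have CB: "C \<subseteq> lie.span B" using C Suc.prems(4) lie.span_superset by blast
  obtain D where D: "C \<subseteq> D" "D \<subseteq> lie.span B" "lie.independent D" "lie.span B \<subseteq> lie.span D"
    using lie.maximal_independent_subset_extend[OF CB C(2)] by blast
  have DB: "lie.span D = lie.span B" using D by (metis lie.span_minimal lie.subspace_span subset_antisym)
  have "finite D"
    using lie.independent_span_bound[OF Suc.prems(1) D(3) D(2)] by simp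
  have "trace_on B f = trace_on D f"
    using Suc.prems D DB \<open>finite D\<close> by (intro trace_on_basis_change) auto
  also have "\<dots> = trace_on C f"
    unfolding trace_on_def
  proof (rule sum.mono_neutral_cong_right)
    have *: "lie.representation D (f d) = lie.representation C (f d)" if "d \<in> D" for d
      using that D C spanC by (intro lie.representation_extend) auto
    show "\<forall>d\<in>D - C. lie.representation D (f d) d = 0"
      using * lie.representation_ne_zero by fastforce
    show "lie.representation D (f d) d = lie.representation C (f d) d" if "d \<in> C" for d
      using * that D by auto
  qed (use D \<open>finite D\<close> in auto)
  also have "\<dots> = 0"
  proof (rule Suc.IH)
    show "f ` lie.span C \<subseteq> lie.span C" using spanC Suc.prems(4) CB by (metis image_mono lie.span_minimal lie.subspace_span)
    fix x assume "x \<in> lie.span C"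
    then obtain y where "x = f y" "y \<in> lie.span B" using spanC by auto
    then show "(f ^^ n) x = 0" using Suc.prems(5)[of y] by (simp del: funpow.simps add: funpow_Suc_right)
  qed (use C \<open>finite C\<close> Suc.prems in auto)
  finally show ?case .
qed

text \<open>The operator f - c is nilpotent on the span, so its trace, which is that of f minus c
  times the dimension, vanishes.\<close>

lemma trace_on_generalized_eigenvalue:
  assumes B: "finite B" "lie.independent B" and f: "lie_linear f" "f ` lie.span B \<subseteq> lie.span B"
    and nil: "\<And>x. x \<in> lie.span B \<Longrightarrow> ((\<lambda>x. f x - c *\<^sub>C x) ^^ n) x = 0"
  shows "trace_on B f = c * of_nat (card B)"
proof -
  interpret f: Vector_Spaces.linear scaleC scaleC f by fact
  have fB: "f b \<in> lie.span B" if "b \<in> lie.span B" for b using f that by blast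
  have "trace_on B (\<lambda>x. f x - c *\<^sub>C x) = 0"
  proof (rule trace_on_nilpotent[OF B _ _ nil])
    show "lie_linear (\<lambda>x. f x - c *\<^sub>C x)"
      by unfold_locales (simp_all add: f.add f.scale algebra_simps)
  qed (auto intro!: lie.span_diff lie.span_scale fB)
  moreover have "trace_on B (\<lambda>x. f x - c *\<^sub>C x) = trace_on B f - c * of_nat (card B)"
  proof -
    have "lie.representation B (f b - c *\<^sub>C b) b = lie.representation B (f b) b - c" if "b \<in> B" for b
      using that B fB by (simp add: lie.representation_diff lie.representation_scale lie.span_base lie.span_scale
          lie.representation_basis)
    then show ?thesis by (simp add: trace_on_def sum_subtractf)
  qed
  ultimately show ?thesis by simp
qed

lemma trace_on_UN:
  assumes I: "finite I" and B: "\<And>i. i \<in> I \<Longrightarrow> finite (B i)" "lie.independent (\<Union>i\<in>I. B i)"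
    and disj: "\<And>i j. i \<in> I \<Longrightarrow> j \<in> I \<Longrightarrow> i \<noteq> j \<Longrightarrow> B i \<inter> B j = {}"
    and f: "\<And>i b. i \<in> I \<Longrightarrow> b \<in> B i \<Longrightarrow> f b \<in> lie.span (B i)"
  shows "trace_on (\<Union>i\<in>I. B i) f = (\<Sum>i\<in>I. trace_on (B i) f)"
proof -
  have "trace_on (\<Union>i\<in>I. B i) f = (\<Sum>i\<in>I. \<Sum>b\<in>B i. lie.representation (\<Union>i\<in>I. B i) (f b) b)"
    unfolding trace_on_def using I B disj by (intro sum.UNION_disjoint) auto
  also have "\<dots> = (\<Sum>i\<in>I. trace_on (B i) f)"
    unfolding trace_on_def
  proof (intro sum.cong refl)
    fix i b assume "i \<in> I" "b \<in> B i"
    then show "lie.representation (\<Union>i\<in>I. B i) (f b) b = lie.representation (B i) (f b) b"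
      using B f by (subst lie.representation_extend[of _ _ "B i"]) auto
  qed
  finally show ?thesis .
qed

text \<open>Among the nonzero polynomials p with p(f) v = 0, one of least degree has a root c;
  dividing it by X - c gives q with q(f) v nonzero and annihilated by f - c.\<close>

lemma exists_eigenvector:
  fixes f :: "'g::complex_lie_algebra \<Rightarrow> 'g"
  assumes f: "lie_linear f" and V: "lie_subspace V" "f ` V \<subseteq> V" "v \<in> V" "v \<noteq> 0"
    and fin: "finite B" "V \<subseteq> lie_span B"
  shows "\<exists>c. \<exists>x\<in>V. x \<noteq> 0 \<and> f x = c *\<^sub>C x"
proof -
  interpret f: Vector_Spaces.linear scaleC scaleC f by fact
  define ev where "ev p = (\<Sum>i\<le>degree p. coeff p i *\<^sub>C (f ^^ i) v)" for p
  have it: "(f ^^ i) v \<in> V" for i using V by (induction i) auto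
  have evV: "ev p \<in> V" for p unfolding ev_def by (intro lie.subspace_sum lie.subspace_scale V it)
  have ev_ge: "ev p = (\<Sum>i\<le>n. coeff p i *\<^sub>C (f ^^ i) v)" if "degree p \<le> n" for p n
    unfolding ev_def using that by (intro sum.mono_neutral_left) (auto simp: coeff_eq_0)
  have ev_lin: "ev ([:- c, 1:] * q) = f (ev q) - c *\<^sub>C ev q" for c q
  proof -
    have "degree ([:- c, 1:] * q) \<le> Suc (degree q)" using degree_mult_le[of "[:-c,1:]" q] by simp
    then have "ev ([:- c, 1:] * q) = (\<Sum>i\<le>Suc (degree q). coeff ([:- c, 1:] * q) i *\<^sub>C (f ^^ i) v)"
      by (rule ev_ge)
    also have "\<dots> = (\<Sum>i\<le>Suc (degree q). (case i of 0 \<Rightarrow> 0 | Suc j \<Rightarrow> coeff q j) *\<^sub>C (f ^^ i) v)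
        - (\<Sum>i\<le>Suc (degree q). c *\<^sub>C coeff q i *\<^sub>C (f ^^ i) v)"
      unfolding sum_subtractf[symmetric]
      by (intro sum.cong refl) (auto simp: coeff_pCons algebra_simps lie.scale_left_diff_distrib split: nat.splits)
    also have "(\<Sum>i\<le>Suc (degree q). (case i of 0 \<Rightarrow> 0 | Suc j \<Rightarrow> coeff q j) *\<^sub>C (f ^^ i) v) = f (ev q)"
      unfolding sum.atMost_Suc_shift by (simp add: ev_def f.sum f.scale)
    also have "(\<Sum>i\<le>Suc (degree q). c *\<^sub>C coeff q i *\<^sub>C (f ^^ i) v) = c *\<^sub>C ev q"
      by (subst ev_ge[of q "Suc (degree q)"]) (auto simp: lie.scale_sum_right lie.scale_right_distrib)
    finally show ?thesis .
  qed
  \<comment> \<open>Linear dependence is a property of the set of iterates, which cannot see a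
    repetition. A repetition f^i v = f^j v is therefore treated separately, with the polynomial X^i
    - X^j.\<close>
  have "\<exists>p. p \<noteq> 0 \<and> ev p = 0"
  proof (cases "inj (\<lambda>i. (f ^^ i) v)")
    case True
    then have inf: "infinite (range (\<lambda>i. (f ^^ i) v))" using finite_imageD by blast
    have "range (\<lambda>i. (f ^^ i) v) \<subseteq> lie_span B" using it fin by auto
    then have "\<not> \<not> lie.dependent (range (\<lambda>i. (f ^^ i) v))"
      using lie.independent_span_bound[OF fin(1)] inf by blast
    then obtain T u w where T: "finite T" "T \<subseteq> range (\<lambda>i. (f ^^ i) v)" "(\<Sum>x\<in>T. u x *\<^sub>C x) = 0"
      "w \<in> T" "u w \<noteq> 0" unfolding lie.dependent_explicit by blast
    obtain A where A: "finite A" "T = (\<lambda>i. (f ^^ i) v) ` A"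
      using finite_subset_image[OF T(1,2)] by blast
    define p where "p = (\<Sum>i\<in>A. monom (u ((f ^^ i) v)) i)"
    have cp: "coeff p i = (if i \<in> A then u ((f ^^ i) v) else 0)" for i
      by (simp only: p_def coeff_sum coeff_monom sum.delta[OF A(1)])
    obtain k where "k \<in> A" "w = (f ^^ k) v" using T(4) A(2) by blast
    then have "coeff p k \<noteq> 0" using T(5) cp[of k] by simp
    then have "p \<noteq> 0" by auto
    moreover have "ev p = 0"
    proof -
      have "degree p \<le> Max (insert 0 A)"
        by (rule degree_le) (use A in \<open>auto simp: cp\<close>)
      then have "ev p = (\<Sum>i\<le>Max (insert 0 A). coeff p i *\<^sub>C (f ^^ i) v)" by (rule ev_ge)
      also have "\<dots> = (\<Sum>i\<in>A. u ((f ^^ i) v) *\<^sub>C (f ^^ i) v)"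
        using A by (intro sum.mono_neutral_cong_right) (auto simp: cp)
      also have "\<dots> = (\<Sum>x\<in>T. u x *\<^sub>C x)"
        unfolding A(2) using True by (subst sum.reindex) (auto simp: inj_on_def)
      finally show ?thesis using T by simp
    qed
    ultimately show ?thesis by blast
  next
    case False
    then obtain i j where ij: "i < j" "(f ^^ i) v = (f ^^ j) v"
      unfolding inj_def by (metis linorder_neqE_nat)
    define p :: "complex poly" where "p = monom 1 i - monom 1 j"
    have cp: "coeff p k = (if k = i then 1 else 0) - (if k = j then 1 else 0)" for k
      by (simp add: p_def)
    have "p \<noteq> 0" using ij cp[of i] by auto
    moreover have "degree p \<le> j" by (rule degree_le) (use ij cp in auto)
    then have "ev p = (\<Sum>k\<le>j. coeff p k *\<^sub>C (f ^^ k) v)" by (rule ev_ge)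
    then have "ev p = (f ^^ i) v - (f ^^ j) v"
      using ij by (simp add: cp lie.scale_left_diff_distrib sum_subtractf if_distrib[of "\<lambda>c. c *\<^sub>C _"] cong: if_cong)
    ultimately show ?thesis using ij by auto
  qed
  then obtain p where p: "p \<noteq> 0" "ev p = 0" and min: "\<And>q. q \<noteq> 0 \<Longrightarrow> ev q = 0 \<Longrightarrow> degree p \<le> degree q"
    using ex_has_least_nat[of "\<lambda>p. p \<noteq> 0 \<and> ev p = 0" _ degree] by blast
  have "degree p \<noteq> 0"
  proof
    assume "degree p = 0"
    then have "ev p = coeff p 0 *\<^sub>C v" "coeff p 0 \<noteq> 0" using p by (auto simp: ev_def elim: degree_eq_zeroE)
    then show False using p V by simp
  qed
  then obtain c where "poly p c = 0"
    using fundamental_theorem_of_algebra[of p] constant_degree[of p] by auto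
  then obtain q where q: "p = [:- c, 1:] * q" using poly_eq_0_iff_dvd by (metis dvdE)
  have "q \<noteq> 0" using p q by auto
  moreover have "degree q < degree p"
    unfolding q using \<open>q \<noteq> 0\<close> by (subst degree_mult_eq) auto
  ultimately have "ev q \<noteq> 0" using min by fastforce
  moreover have "f (ev q) = c *\<^sub>C ev q" using ev_lin[of c q] p q by simp
  ultimately show ?thesis using evV by blast
qed


section \<open>Generalized weight spaces\<close>

lemma bracket_0_left [simp]: "bracket 0 x = (0::'g::complex_lie_algebra)"
  using bracket_add_left[of 0 0 x] by simp

lemma bracket_0_right [simp]: "bracket x 0 = (0::'g::complex_lie_algebra)"
  using bracket_add_right[of x 0 0] by simp

lemma bracket_swap: "bracket y x = - bracket x (y::'g::complex_lie_algebra)"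
proof -
  have "bracket (x + y) (x + y) = 0" by (rule bracket_self)
  then have "bracket x y + bracket y x = 0"
    unfolding bracket_add_left bracket_add_right by (simp add: bracket_self add.commute)
  then show ?thesis by (metis add_eq_0_iff)
qed

lemma bracket_minus_left: "bracket (- x) y = - bracket x (y::'g::complex_lie_algebra)"
  using bracket_add_left[of x "- x" y] by (simp add: add_eq_0_iff)

lemma bracket_minus_right: "bracket x (- y) = - bracket x (y::'g::complex_lie_algebra)"
  using bracket_add_right[of x y "- y"] by (simp add: add_eq_0_iff)

lemma bracket_diff_left: "bracket (x - y) z = bracket x z - bracket y (z::'g::complex_lie_algebra)"
  using bracket_add_left[of x "- y" z] by (simp add: bracket_minus_left)

lemma bracket_diff_right: "bracket x (y - z) = bracket x y - bracket x (z::'g::complex_lie_algebra)"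
  using bracket_add_right[of x y "- z"] by (simp add: bracket_minus_right)

lemma bracket_bracket_left:
  "bracket (bracket x y) z = bracket x (bracket y z) - bracket y (bracket x (z::'g::complex_lie_algebra))"
proof -
  have "bracket z (bracket x y) = - bracket (bracket x y) z" "bracket y (bracket z x) = - bracket y (bracket x z)"
    by (metis bracket_swap) (metis bracket_swap bracket_minus_right)
  then show ?thesis using jacobi[of x y z] by (simp add: algebra_simps)
qed

lemma linear_bracket: "lie_linear (bracket (x::'g::complex_lie_algebra))"
  by unfold_locales (simp_all add: bracket_add_right bracket_scaleC_right)

definition ad_shift :: "complex \<Rightarrow> 'g::complex_lie_algebra \<Rightarrow> 'g \<Rightarrow> 'g" where
  "ad_shift c h x = bracket h x - c *\<^sub>C x"

lemma linear_ad_shift: "lie_linear (ad_shift c h)"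
  by unfold_locales
    (simp_all add: ad_shift_def bracket_add_right bracket_scaleC_right lie.scale_right_distrib
      lie.scale_right_diff_distrib mult.commute)

lemma linear_funpow:
  fixes f :: "'g::complex_lie_algebra \<Rightarrow> 'g"
  assumes "lie_linear f"
  shows "lie_linear (f ^^ n)"
proof -
  interpret f: Vector_Spaces.linear scaleC scaleC f by fact
  have "(f ^^ n) (x + y) = (f ^^ n) x + (f ^^ n) y" "(f ^^ n) (c *\<^sub>C x) = c *\<^sub>C (f ^^ n) x" for x y c
    by (induction n) (simp_all add: f.add f.scale)
  then show ?thesis by unfold_locales auto
qed

lemma funpow_0_mono:
  fixes f :: "'g::complex_lie_algebra \<Rightarrow> 'g"
  assumes "lie_linear f" "(f ^^ m) x = 0" "m \<le> n"
  shows "(f ^^ n) x = 0"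
proof -
  interpret f: Vector_Spaces.linear scaleC scaleC "f ^^ (n - m)" using linear_funpow assms(1) .
  have "(f ^^ n) x = (f ^^ (n - m)) ((f ^^ m) x)"
    using assms(3) by (metis comp_apply funpow_add le_add_diff_inverse2)
  then show ?thesis using assms(2) f.zero by simp
qed

lemma funpow_commute: "(\<And>x. f (g x) = g (f x)) \<Longrightarrow> (f ^^ n) (g x) = g ((f ^^ n) x)"
  by (induction n) auto

lemma ad_shift_0 [simp]: "ad_shift c h 0 = 0"
  by (simp add: ad_shift_def)

lemma ad_shift_funpow_0 [simp]: "(ad_shift c h ^^ n) 0 = 0"
  by (induction n) auto

lemma ad_shift_commute_scalar: "ad_shift c h (ad_shift d h x) = ad_shift d h (ad_shift c h x)"
  by (simp add: ad_shift_def bracket_diff_right bracket_scaleC_right lie.scale_right_diff_distrib mult.commute)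

lemma ad_shift_bracket:
  "ad_shift (c + d) h (bracket x y) = bracket (ad_shift c h x) y + bracket x (ad_shift d h y)"
proof -
  have "bracket h (bracket x y) = bracket (bracket h x) y + bracket x (bracket h y)"
    using bracket_bracket_left[of h x y] by simp
  then show ?thesis
    by (simp add: ad_shift_def bracket_diff_left bracket_diff_right bracket_scaleC_left bracket_scaleC_right
        lie.scale_left_distrib)
qed

text \<open>By the Leibniz rule \<open>ad_shift_bracket\<close>, one application of the shifted
  operator turns [x, y] into two brackets, in each of which one factor needs one power less; hence
  the induction on m + n.\<close>

lemma ad_shift_funpow_bracket:
  assumes "(ad_shift c h ^^ m) x = 0" "(ad_shift d h ^^ n) y = 0"
  shows "(ad_shift (c + d) h ^^ (m + n)) (bracket x y) = 0"
  using assms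
proof (induction "m + n" arbitrary: m n x y)
  case (Suc k)
  interpret f: Vector_Spaces.linear scaleC scaleC "ad_shift (c + d) h ^^ k" using linear_funpow linear_ad_shift .
  show ?case
  proof (cases "m = 0 \<or> n = 0")
    case True
    then show ?thesis using Suc.prems by auto
  next
    case False
    then obtain m' n' where mn: "m = Suc m'" "n = Suc n'" using not0_implies_Suc by blast
    have "(ad_shift (c + d) h ^^ (m' + n)) (bracket (ad_shift c h x) y) = 0"
      using Suc.prems Suc.hyps(2) mn by (intro Suc.hyps(1)) (simp_all add: funpow_swap1)
    moreover have "(ad_shift (c + d) h ^^ (m + n')) (bracket x (ad_shift d h y)) = 0"
      using Suc.prems Suc.hyps(2) mn by (intro Suc.hyps(1)) (simp_all add: funpow_swap1)
    moreover have "m' + n = k" "m + n' = k" using Suc.hyps(2) mn by auto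
    ultimately have "(ad_shift (c + d) h ^^ k) (ad_shift (c + d) h (bracket x y)) = 0"
      by (simp add: ad_shift_bracket f.add)
    then show ?thesis using Suc.hyps(2) by (metis comp_apply funpow_Suc_right)
  qed
qed auto

text \<open>Powers of X - c and X - d are coprime. By induction on m + n both shifted images of x
  vanish, and their difference is (d - c) x.\<close>

lemma ad_shift_funpow_coprime:
  assumes "(ad_shift c h ^^ m) x = 0" "(ad_shift d h ^^ n) x = 0" "c \<noteq> d"
  shows "x = 0"
  using assms
proof (induction "m + n" arbitrary: m n x)
  case (Suc k)
  show ?case
  proof (cases "m = 0 \<or> n = 0")
    case True
    then show ?thesis using Suc.prems by auto
  next
    case False
    then obtain m' n' where mn: "m = Suc m'" "n = Suc n'" using not0_implies_Suc by blast
    have "(ad_shift e h ^^ j) (ad_shift e' h x) = ad_shift e' h ((ad_shift e h ^^ j) x)" for e e' j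
      by (rule funpow_commute) (rule ad_shift_commute_scalar)
    moreover have "(ad_shift e h ^^ j) (ad_shift e h x) = 0" if "(ad_shift e h ^^ Suc j) x = 0" for e j
      using that by (simp only: funpow_Suc_right comp_apply)
    ultimately have "ad_shift c h x = 0" "ad_shift d h x = 0"
      using Suc.hyps(1)[of m' n "ad_shift c h x"] Suc.hyps(1)[of m n' "ad_shift d h x"] Suc.hyps(2) Suc.prems
      unfolding mn by (simp_all del: funpow.simps)
    then have "(d - c) *\<^sub>C x = 0" by (auto simp: ad_shift_def lie.scale_left_diff_distrib)
    then show ?thesis using Suc.prems by simp
  qed
qed auto

text \<open>The exponent may depend on both h and x, because diagonalizability of ad h is
  established only later. The function \<nu> is arbitrary; its linearity on \<open>H\<close> will be
  a consequence when the space is nonzero.\<close>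

definition weight_space :: "'g::complex_lie_algebra set \<Rightarrow> ('g \<Rightarrow> complex) \<Rightarrow> 'g set" where
  "weight_space H \<nu> = {x. \<forall>h\<in>H. \<exists>n. (ad_shift (\<nu> h) h ^^ n) x = 0}"

lemma subspace_weight_space: "lie_subspace (weight_space H \<nu>)"
proof (rule lie.subspaceI)
  fix x y assume xy: "x \<in> weight_space H \<nu>" "y \<in> weight_space H \<nu>"
  show "x + y \<in> weight_space H \<nu>"
    unfolding weight_space_def
  proof safe
    fix h assume "h \<in> H"
    then obtain m n where mn: "(ad_shift (\<nu> h) h ^^ m) x = 0" "(ad_shift (\<nu> h) h ^^ n) y = 0"
      using xy unfolding weight_space_def by blast
    interpret f: Vector_Spaces.linear scaleC scaleC "ad_shift (\<nu> h) h ^^ (max m n)"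
      using linear_funpow linear_ad_shift .
    show "\<exists>n. (ad_shift (\<nu> h) h ^^ n) (x + y) = 0"
      using funpow_0_mono[OF linear_ad_shift mn(1), of "max m n"] funpow_0_mono[OF linear_ad_shift mn(2), of "max m n"]
      by (intro exI[of _ "max m n"]) (simp add: f.add)
  qed
next
  fix c x assume x: "x \<in> weight_space H \<nu>"
  have "(ad_shift (\<nu> h) h ^^ n) (c *\<^sub>C x) = c *\<^sub>C (ad_shift (\<nu> h) h ^^ n) x" for h n
  proof -
    interpret f: Vector_Spaces.linear scaleC scaleC "ad_shift (\<nu> h) h ^^ n"
      using linear_funpow linear_ad_shift .
    show ?thesis by (rule f.scale)
  qed
  then show "c *\<^sub>C x \<in> weight_space H \<nu>" using x by (auto simp: weight_space_def)
qed (auto simp: weight_space_def)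

lemma zero_in_weight_space [simp]: "0 \<in> weight_space H \<nu>"
  using subspace_weight_space lie.subspace_0 by blast

lemma bracket_weight_space:
  assumes "x \<in> weight_space H \<nu>" "y \<in> weight_space H \<mu>"
  shows "bracket x y \<in> weight_space H (\<nu> + \<mu>)"
  unfolding weight_space_def
proof safe
  fix h assume "h \<in> H"
  then obtain m n where "(ad_shift (\<nu> h) h ^^ m) x = 0" "(ad_shift (\<mu> h) h ^^ n) y = 0"
    using assms unfolding weight_space_def by blast
  then show "\<exists>n. (ad_shift ((\<nu> + \<mu>) h) h ^^ n) (bracket x y) = 0"
    using ad_shift_funpow_bracket by (fastforce simp: plus_fun_def)
qed

lemma weight_space_cong: "(\<And>h. h \<in> H \<Longrightarrow> \<nu> h = \<mu> h) \<Longrightarrow> weight_space H \<nu> = weight_space H \<mu>"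
  by (auto simp: weight_space_def)

lemma root_space_subset_weight_space: "root_space H \<nu> \<subseteq> weight_space H \<nu>"
proof
  fix x assume "x \<in> root_space H \<nu>"
  then have "(ad_shift (\<nu> h) h ^^ 1) x = 0" if "h \<in> H" for h
    using that by (simp add: root_space_def ad_shift_def)
  then show "x \<in> weight_space H \<nu>" unfolding weight_space_def by blast
qed

lemma span_UN_sum:
  fixes U :: "'i \<Rightarrow> 'g::complex_lie_algebra set"
  assumes "x \<in> lie.span (\<Union>i\<in>I. U i)" "finite I" "\<And>i. i \<in> I \<Longrightarrow> lie_subspace (U i)"
  shows "\<exists>f. (\<forall>i\<in>I. f i \<in> U i) \<and> x = (\<Sum>i\<in>I. f i)"
  using assms(1)
proof (induction rule: lie.span_induct_alt)
  case base
  then show ?case using assms(3) lie.subspace_0 by (intro exI[of _ "\<lambda>_. 0"]) auto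
next
  case (step c x y)
  then obtain f where f: "\<forall>i\<in>I. f i \<in> U i" "y = sum f I" by blast
  obtain j where j: "j \<in> I" "x \<in> U j" using step by blast
  have "(\<Sum>i\<in>I. f i + (if i = j then c *\<^sub>C x else 0)) = y + c *\<^sub>C x"
    using j assms(2) f by (simp add: sum.distrib)
  moreover have "f i + (if i = j then c *\<^sub>C x else 0) \<in> U i" if "i \<in> I" for i
    using f j that assms(3)[OF that] by (auto intro: lie.subspace_add lie.subspace_scale)
  ultimately show ?case
    by (intro exI[of _ "\<lambda>i. f i + (if i = j then c *\<^sub>C x else 0)"]) (simp add: add.commute)
qed

text \<open>Finite dimension is a hypothesis about the type and not part of the class, so the
  library fact is instantiated with a basis extracted from the given spanning set.\<close>

lemma dim_psubset:
  assumes "finite_dimensional_lie_algebra TYPE('g::complex_lie_algebra)"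
    and "lie_subspace S" "lie_subspace T" "S \<subset> (T :: 'g set)"
  shows "lie.dim S < lie.dim T"
proof -
  obtain A :: "'g set" where A: "finite A" "lie_span A = UNIV"
    using assms(1) unfolding finite_dimensional_lie_algebra_def by blast
  obtain B where B: "B \<subseteq> A" "lie.independent B" "A \<subseteq> lie_span B"
    using lie.maximal_independent_subset by blast
  have "finite_dimensional_vector_space scaleC B"
  proof unfold_locales
    show "finite B" using A B finite_subset by blast
    show "lie.independent B" by fact
    show "module.span scaleC B = UNIV"
      using A B lie.span_minimal[OF B(3)] unfolding lie_span_def by (metis lie.subspace_span lie_span_def top.extremum_uniqueI)
  qed
  from finite_dimensional_vector_space.dim_psubset[OF this, of S T] show ?thesis
    using assms(2-4) unfolding lie_span_def[symmetric] by (simp only: iffD2[OF lie.span_eq_iff])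
qed

lemma finite_independent:
  assumes "finite_dimensional_lie_algebra TYPE('g::complex_lie_algebra)" "lie.independent (B :: 'g set)"
  shows "finite B"
  using assms lie.independent_span_bound[of _ B] unfolding finite_dimensional_lie_algebra_def by auto


section \<open>The weight space decomposition\<close>

lemma dual_subspace: "fn.subspace (dual H)"
  by (rule fn.subspaceI) (auto simp: dual_def algebra_simps)

lemma dual_eqI:
  assumes "\<alpha> \<in> dual H" "\<beta> \<in> dual H" "\<And>h. h \<in> H \<Longrightarrow> \<alpha> h = \<beta> h"
  shows "\<alpha> = \<beta>"
proof
  fix x show "\<alpha> x = \<beta> x" using assms by (cases "x \<in> H") (auto simp: dual_def)
qed

lemma dual_sum:
  assumes "lie_subspace H" "\<alpha> \<in> dual H" "\<And>i. i \<in> I \<Longrightarrow> x i \<in> H"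
  shows "\<alpha> (sum x I) = (\<Sum>i\<in>I. \<alpha> (x i))"
proof -
  have "\<alpha> (0 *\<^sub>C 0) = 0 * \<alpha> 0" using assms(1,2) lie.subspace_0 unfolding dual_def by blast
  then have "\<alpha> 0 = 0" by simp
  then show ?thesis using assms(3)
  proof (induction I rule: infinite_finite_induct)
    case (insert j I)
    then have "x j \<in> H" "sum x I \<in> H" by (auto intro: lie.subspace_sum[OF assms(1)])
    then show ?case using insert assms(2) by (simp add: dual_def)
  qed auto
qed

lemma exists_dual_nonzero:
  assumes "lie_subspace H" "h \<in> H" "h \<noteq> 0"
  shows "\<exists>f\<in>dual H. f h \<noteq> 0"
proof -
  have "{h} \<subseteq> H" "lie.independent {h}" using assms by auto
  then obtain B where B: "{h} \<subseteq> B" "B \<subseteq> H" "lie.independent B" "H \<subseteq> lie_span B"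
    using lie.maximal_independent_subset_extend[of "{h}" H] by blast
  have *: "lie.representation B (x + y) b = lie.representation B x b + lie.representation B y b"
      "lie.representation B (c *\<^sub>C x) b = c * lie.representation B x b" if "x \<in> H" "y \<in> H" for x y b c
    using lie.representation_add[OF B(3), of x y] lie.representation_scale[OF B(3), of x c] B(4) that
    by (simp_all add: subset_iff add.commute)
  define f where "f x = (if x \<in> H then lie.representation B x h else 0)" for x
  have "f \<in> dual H"
    using * assms(1) by (auto simp: f_def dual_def lie.subspace_add lie.subspace_scale)
  moreover have "f h = 1" using B assms(2) lie.representation_basis[OF B(3), of h] by (simp add: f_def)
  ultimately show ?thesis by (intro bexI[of _ f]) auto
qed

locale cartan =
  fixes H :: "'g::complex_lie_algebra set" and \<pi> :: "('g \<Rightarrow> complex) set"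
  assumes finite_dimensional: "finite_dimensional_lie_algebra TYPE('g)"
    and simple: "simple_lie_algebra TYPE('g)"
    and cartan: "cartan_subalgebra H"
    and simple_roots: "simple_roots H \<pi>"
begin

abbreviation W :: "('g \<Rightarrow> complex) \<Rightarrow> 'g set" where
  "W \<equiv> weight_space H"

lemma subspace_H: "lie_subspace H"
  using cartan by (simp add: cartan_subalgebra_def lie_subalgebra_def)

lemma zero_in_H [simp]: "0 \<in> H"
  using subspace_H lie.subspace_0 by blast

lemma root_in_dual: "\<alpha> \<in> roots H \<Longrightarrow> \<alpha> \<in> dual H"
  by (simp add: roots_def)

lemma separating:
  assumes "x \<in> H" "\<And>\<alpha>. \<alpha> \<in> \<pi> \<Longrightarrow> \<alpha> x = 0"
  shows "x = 0"
proof (rule ccontr)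
  assume "x \<noteq> 0"
  then obtain f where f: "f \<in> dual H" "f x \<noteq> 0" using exists_dual_nonzero[OF subspace_H assms(1)] by blast
  have "fn.subspace {f. f x = 0}" by (rule fn.subspaceI) auto
  then have "fn_span \<pi> \<subseteq> {f. f x = 0}" using assms(2) by (intro fn.span_minimal) auto
  then show False using f simple_roots by (auto simp: simple_roots_def)
qed

lemma simple_root_is_root: "\<alpha> \<in> \<pi> \<Longrightarrow> \<alpha> \<in> roots H"
  using simple_roots by (auto simp: simple_roots_def)

text \<open>On a root vector for \<alpha> both x and y act by scalars, so [x, y] acts by 0 and
  \<alpha>([x, y]) = 0. The simple roots span the dual, hence separate the points of
  \<open>H\<close>.\<close>

lemma abelian:
  assumes "x \<in> H" "y \<in> H"
  shows "bracket x y = 0"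
proof (rule separating)
  show xy: "bracket x y \<in> H" using assms cartan by (simp add: cartan_subalgebra_def lie_subalgebra_def)
  fix \<alpha> assume "\<alpha> \<in> \<pi>"
  then have "\<alpha> \<in> roots H" by (rule simple_root_is_root)
  then obtain v where v: "v \<in> root_space H \<alpha>" "v \<noteq> 0"
    by (auto simp: roots_def root_space_def)
  have "bracket (bracket x y) v = bracket x (\<alpha> y *\<^sub>C v) - bracket y (\<alpha> x *\<^sub>C v)"
    using assms v by (simp add: bracket_bracket_left root_space_def)
  also have "\<dots> = 0" using assms v by (simp add: bracket_scaleC_right root_space_def mult.commute)
  finally show "\<alpha> (bracket x y) = 0" using xy v by (simp add: root_space_def)
qed

lemma ad_shift_commute:
  assumes "h \<in> H" "h' \<in> H"
  shows "ad_shift c h (ad_shift d h' x) = ad_shift d h' (ad_shift c h x)"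
proof -
  have "bracket h (bracket h' x) = bracket h' (bracket h x)"
    using bracket_bracket_left[of h h' x] abelian[OF assms] by simp
  then show ?thesis
    by (simp add: ad_shift_def bracket_diff_right bracket_scaleC_right lie.scale_right_diff_distrib mult.commute)
qed

lemma ad_shift_weight_space:
  assumes "x \<in> W \<nu>" "h \<in> H"
  shows "ad_shift c h x \<in> W \<nu>"
  unfolding weight_space_def
proof safe
  fix h' assume h': "h' \<in> H"
  then obtain n where n: "(ad_shift (\<nu> h') h' ^^ n) x = 0" using assms by (auto simp: weight_space_def)
  have "(ad_shift (\<nu> h') h' ^^ n) (ad_shift c h x) = ad_shift c h ((ad_shift (\<nu> h') h' ^^ n) x)"
    by (rule funpow_commute) (rule ad_shift_commute[OF h' assms(2)])
  then show "\<exists>n. (ad_shift (\<nu> h') h' ^^ n) (ad_shift c h x) = 0" using n by auto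
qed

lemma ad_shift_funpow_weight_space:
  "x \<in> W \<nu> \<Longrightarrow> h \<in> H \<Longrightarrow> (ad_shift c h ^^ n) x \<in> W \<nu>"
  by (induction n) (auto intro: ad_shift_weight_space)

lemma weight_sum_eq_0:
  assumes "finite L" "L \<subseteq> dual H" "\<And>\<nu>. \<nu> \<in> L \<Longrightarrow> x \<nu> \<in> W \<nu>" "sum x L = 0"
  shows "\<forall>\<nu>\<in>L. x \<nu> = 0"
  using assms
proof (induction L arbitrary: x rule: finite_induct)
  case (insert \<mu> L)
  have "x \<nu> = 0" if \<nu>: "\<nu> \<in> L" for \<nu>
  proof -
    have "\<nu> \<noteq> \<mu>" using \<nu> insert.hyps by auto
    then obtain h where h: "h \<in> H" "\<nu> h \<noteq> \<mu> h"
      using dual_eqI[of \<nu> H \<mu>] \<nu> insert.prems(1) by blast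
    obtain n where n: "(ad_shift (\<mu> h) h ^^ n) (x \<mu>) = 0"
      using insert.prems(2)[of \<mu>] h by (auto simp: weight_space_def)
    interpret f: Vector_Spaces.linear scaleC scaleC "ad_shift (\<mu> h) h ^^ n"
      using linear_funpow linear_ad_shift .
    have "(\<Sum>\<nu>\<in>L. (ad_shift (\<mu> h) h ^^ n) (x \<nu>)) = (ad_shift (\<mu> h) h ^^ n) (x \<mu> + sum x L)"
      by (simp add: f.add f.sum n)
    also have "\<dots> = 0" using insert.prems(3) insert.hyps by (simp add: f.zero)
    finally have "(ad_shift (\<mu> h) h ^^ n) (x \<nu>) = 0"
      using insert.IH[of "\<lambda>\<nu>. (ad_shift (\<mu> h) h ^^ n) (x \<nu>)"] insert.prems h \<nu>
      by (auto intro: ad_shift_funpow_weight_space)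
    moreover obtain m where "(ad_shift (\<nu> h) h ^^ m) (x \<nu>) = 0"
      using insert.prems(2)[of \<nu>] \<nu> h by (auto simp: weight_space_def)
    ultimately show ?thesis using ad_shift_funpow_coprime h(2) by metis
  qed
  then show ?case using insert.prems(3) insert.hyps by simp
qed auto

lemma weight_space_disjoint_span:
  assumes "finite L" "L \<subseteq> dual H" "\<mu> \<in> dual H" "\<mu> \<notin> L"
    and "x \<in> W \<mu>" "x \<in> lie_span (\<Union>\<nu>\<in>L. W \<nu>)"
  shows "x = 0"
proof -
  obtain f where f: "\<forall>\<nu>\<in>L. f \<nu> \<in> W \<nu>" "x = sum f L"
    using span_UN_sum[OF assms(6,1)] subspace_weight_space by blast
  define g where "g \<nu> = (if \<nu> = \<mu> then - x else f \<nu>)" for \<nu>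
  have "sum g L = x" using f assms(4) by (auto simp: g_def intro!: sum.cong)
  then have "sum g (insert \<mu> L) = 0" using assms(1,4) by (simp add: g_def)
  moreover have "g \<nu> \<in> W \<nu>" if "\<nu> \<in> insert \<mu> L" for \<nu>
    using that f assms(5) subspace_weight_space by (auto simp: g_def intro: lie.subspace_neg)
  ultimately have "\<forall>\<nu>\<in>insert \<mu> L. g \<nu> = 0"
    using assms by (intro weight_sum_eq_0) auto
  then show ?thesis by (simp add: g_def)
qed

text \<open>A form of Engel's theorem for commuting operators acting on \<open>M/Z\<close>.\<close>

lemma exists_annihilated_mod:
  assumes "finite F" "F \<subseteq> H" "x \<in> M - Z" "\<And>h x. h \<in> H \<Longrightarrow> x \<in> M \<Longrightarrow> ad_shift (\<nu> h) h x \<in> M"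
    and Z: "\<And>h x. h \<in> H \<Longrightarrow> x \<in> Z \<Longrightarrow> ad_shift (\<nu> h) h x \<in> Z"
    and nil: "\<And>h x. h \<in> H \<Longrightarrow> x \<in> M \<Longrightarrow> \<exists>n. (ad_shift (\<nu> h) h ^^ n) x \<in> Z"
  shows "\<exists>y\<in>M - Z. \<forall>h\<in>F. ad_shift (\<nu> h) h y \<in> Z"
  using assms(1,2)
proof (induction F rule: finite_induct)
  case empty
  then show ?case using assms(3) by blast
next
  case (insert h F)
  then obtain y where y: "y \<in> M" "y \<notin> Z" "\<forall>h\<in>F. ad_shift (\<nu> h) h y \<in> Z" by blast
  \<comment> \<open>With k the least exponent that carries y into Z, the vector with exponent k - 1
    lies outside Z and is sent into Z by h; as the operators commute, it keeps the conditions for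
    F.\<close>
  define k where "k = (LEAST n. (ad_shift (\<nu> h) h ^^ n) y \<in> Z)"
  have h: "h \<in> H" using insert.prems by simp
  have kZ: "(ad_shift (\<nu> h) h ^^ k) y \<in> Z" unfolding k_def using nil[OF h y(1)] by (rule LeastI_ex)
  then have "k \<noteq> 0" using y by (intro notI) simp
  then obtain j where j: "k = Suc j" using not0_implies_Suc by blast
  then have jZ: "(ad_shift (\<nu> h) h ^^ j) y \<notin> Z" using not_less_Least[of j "\<lambda>n. (ad_shift (\<nu> h) h ^^ n) y \<in> Z"] k_def by simp
  have "(ad_shift (\<nu> h) h ^^ n) z \<in> Z" if "z \<in> Z" for n z using that by (induction n) (auto intro: Z h)
  moreover have "(ad_shift (\<nu> h) h ^^ j) (ad_shift (\<nu> h') h' y) = ad_shift (\<nu> h') h' ((ad_shift (\<nu> h) h ^^ j) y)"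
    if "h' \<in> F" for h'
    by (rule funpow_commute) (rule ad_shift_commute, use that insert.prems in auto)
  ultimately have "\<forall>h'\<in>F. ad_shift (\<nu> h') h' ((ad_shift (\<nu> h) h ^^ j) y) \<in> Z" using y(3) by metis
  moreover have "(ad_shift (\<nu> h) h ^^ j) y \<in> M" using y(1) by (induction j) (auto intro: assms(4) h)
  ultimately show ?case using jZ kZ j by (intro bexI[of _ "(ad_shift (\<nu> h) h ^^ j) y"]) auto
qed

lemma exists_finite_basis:
  fixes V :: "'g set"
  assumes "lie_subspace V"
  shows "\<exists>B. finite B \<and> B \<subseteq> V \<and> lie.independent B \<and> lie_span B = V"
proof -
  obtain B where B: "B \<subseteq> V" "lie.independent B" "V \<subseteq> lie_span B"
    using lie.maximal_independent_subset by blast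
  have "finite B" using finite_independent[OF finite_dimensional B(2)] .
  moreover have "lie_span B = V" using B lie.span_minimal[OF B(1) assms] by blast
  ultimately show ?thesis using B by blast
qed

text \<open>The nontrivial inclusion is self-normalization: if \<open>W 0\<close> were larger than
  \<open>H\<close>, the Engel argument on \<open>W 0\<close> modulo \<open>H\<close> would give y
  outside \<open>H\<close> with [h, y] in \<open>H\<close> for all h in a basis of \<open>H\<close>,
  hence for all of \<open>H\<close>, so that y normalizes \<open>H\<close>.\<close>

lemma weight_space_0: "W 0 = H"
proof
  show "H \<subseteq> W 0"
  proof
    fix x assume "x \<in> H"
    then have "(ad_shift 0 h ^^ 1) x = 0" if "h \<in> H" for h using that abelian by (simp add: ad_shift_def)
    then show "x \<in> W 0" unfolding weight_space_def zero_fun_apply by blast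
  qed
  show "W 0 \<subseteq> H"
  proof (rule ccontr)
    assume "\<not> W 0 \<subseteq> H"
    then obtain x where x: "x \<in> W 0 - H" by blast
    obtain B where B: "finite B" "B \<subseteq> H" "lie_span B = H" using exists_finite_basis[OF subspace_H] by blast
    have "\<exists>y\<in>W 0 - H. \<forall>h\<in>B. ad_shift ((0 :: 'g \<Rightarrow> complex) h) h y \<in> H"
    proof (rule exists_annihilated_mod[OF B(1,2) x])
      fix h x assume h: "h \<in> H" 
      show "ad_shift ((0 :: 'g \<Rightarrow> complex) h) h x \<in> W 0" if "x \<in> W 0"
        using that h by (rule ad_shift_weight_space)
      show "ad_shift ((0 :: 'g \<Rightarrow> complex) h) h x \<in> H" if "x \<in> H" using that h abelian by (simp add: ad_shift_def)
      show "\<exists>n. (ad_shift ((0 :: 'g \<Rightarrow> complex) h) h ^^ n) x \<in> H" if "x \<in> W 0"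
        using that h zero_in_H unfolding weight_space_def mem_Collect_eq by metis
    qed
    then obtain y where y: "y \<notin> H" "\<forall>h\<in>B. bracket h y \<in> H" by (auto simp: ad_shift_def)
    have "lie_subspace {h. bracket h y \<in> H}"
      using subspace_H by (intro lie.subspaceI) (auto simp: bracket_add_left bracket_scaleC_left lie.subspace_add lie.subspace_scale)
    then have "lie_span B \<subseteq> {h. bracket h y \<in> H}" using y by (intro lie.span_minimal) auto
    then have "bracket y h \<in> H" if "h \<in> H" for h
      using that B(3) bracket_swap[of y h] lie.subspace_neg[OF subspace_H] by auto
    then have "y \<in> H" using cartan by (auto simp: cartan_subalgebra_def)
    then show False using y by simp
  qed
qed

text \<open>The Engel argument with Z = {0} gives a common eigenvector for a basis of
  \<open>H\<close>. As \<nu> is not assumed linear, on the rest of \<open>H\<close> first only some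
  eigenvalue is found; coprimality then identifies it as \<nu>(h).\<close>

lemma exists_weight_vector:
  assumes "x \<in> W \<nu>" "x \<noteq> 0"
  shows "\<exists>y. y \<noteq> 0 \<and> (\<forall>h\<in>H. bracket h y = \<nu> h *\<^sub>C y)"
proof -
  obtain B where B: "finite B" "B \<subseteq> H" "lie_span B = H" using exists_finite_basis[OF subspace_H] by blast
  have "\<exists>y\<in>W \<nu> - {0}. \<forall>h\<in>B. ad_shift (\<nu> h) h y \<in> {0}"
    by (rule exists_annihilated_mod[OF B(1,2), of x])
      (use assms in \<open>auto intro: ad_shift_weight_space\<close>, auto simp: weight_space_def)
  then obtain y where y: "y \<in> W \<nu>" "y \<noteq> 0" "\<forall>h\<in>B. bracket h y = \<nu> h *\<^sub>C y" by (auto simp: ad_shift_def)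
  have "lie_subspace {h. \<exists>c. bracket h y = c *\<^sub>C y}"
    by (rule lie.subspaceI)
      (auto simp: bracket_add_left bracket_scaleC_left lie.scale_left_distrib[symmetric] intro: exI[of _ 0])
  then have "lie_span B \<subseteq> {h. \<exists>c. bracket h y = c *\<^sub>C y}" using y by (intro lie.span_minimal) auto
  then have ev: "\<exists>c. bracket h y = c *\<^sub>C y" if "h \<in> H" for h using that B(3) by auto
  have "bracket h y = \<nu> h *\<^sub>C y" if h: "h \<in> H" for h
  proof -
    obtain c where c: "bracket h y = c *\<^sub>C y" using ev h by blast
    then have "(ad_shift c h ^^ 1) y = 0" by (simp add: ad_shift_def)
    moreover obtain n where "(ad_shift (\<nu> h) h ^^ n) y = 0" using y(1) h by (auto simp: weight_space_def)
    ultimately have "c = \<nu> h" using ad_shift_funpow_coprime y(2) by blast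
    then show ?thesis using c by simp
  qed
  then show ?thesis using y(2) by blast
qed

definition weights :: "('g \<Rightarrow> complex) set" where
  "weights = {\<nu> \<in> dual H. W \<nu> \<noteq> {0}}"

text \<open>Roots are defined by true eigenvectors and weights by generalized ones, but a nonzero
  generalized space contains a true eigenvector. The weight 0 has the space
  \<open>H\<close>.\<close>

lemma weights_eq: "weights = roots H \<union> (if H = {0} then {} else {0})"
proof -
  have "root_space H \<nu> \<noteq> {0} \<longleftrightarrow> W \<nu> \<noteq> {0}" for \<nu>
  proof
    assume "root_space H \<nu> \<noteq> {0}"
    then show "W \<nu> \<noteq> {0}"
      using root_space_subset_weight_space[of H \<nu>] by (auto simp: root_space_def)
  next
    assume "W \<nu> \<noteq> {0}"
    then obtain x where "x \<in> W \<nu>" "x \<noteq> 0" using zero_in_weight_space by blast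
    from exists_weight_vector[OF this] show "root_space H \<nu> \<noteq> {0}" by (auto simp: root_space_def)
  qed
  moreover have "0 \<in> dual H" by (auto simp: dual_def)
  ultimately show ?thesis
    using weight_space_0 by (auto simp: weights_def roots_def)
qed

lemma root_is_weight: "\<alpha> \<in> roots H \<Longrightarrow> \<alpha> \<in> weights"
  using weights_eq by auto

text \<open>A common eigenvector makes \<nu> linear on \<open>H\<close>. Setting \<nu> to 0 off
  \<open>H\<close> then yields an element of the dual and leaves the weight space alone, which sees
  only values on \<open>H\<close>.\<close>

lemma restrict_weight:
  assumes "W \<nu> \<noteq> {0}"
  shows "(\<lambda>h. if h \<in> H then \<nu> h else 0) \<in> weights"
    and "W (\<lambda>h. if h \<in> H then \<nu> h else 0) = W \<nu>"
proof -
  show eq: "W (\<lambda>h. if h \<in> H then \<nu> h else 0) = W \<nu>"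
    by (rule weight_space_cong) simp
  obtain x where "x \<in> W \<nu>" "x \<noteq> 0" using assms zero_in_weight_space by blast
  from exists_weight_vector[OF this] obtain y where y: "y \<noteq> 0" "\<And>h. h \<in> H \<Longrightarrow> bracket h y = \<nu> h *\<^sub>C y"
    by blast
  have "\<nu> (h + h') = \<nu> h + \<nu> h'" if "h \<in> H" "h' \<in> H" for h h'
  proof -
    have "\<nu> (h + h') *\<^sub>C y = (\<nu> h + \<nu> h') *\<^sub>C y"
      using y(2)[of "h + h'"] y(2) that lie.subspace_add[OF subspace_H] by (simp add: bracket_add_left lie.scale_left_distrib)
    then show ?thesis using y by simp
  qed
  moreover have "\<nu> (c *\<^sub>C h) = c * \<nu> h" if "h \<in> H" for c h
  proof -
    have "\<nu> (c *\<^sub>C h) *\<^sub>C y = bracket (c *\<^sub>C h) y"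
      using y(2)[of "c *\<^sub>C h"] that lie.subspace_scale[OF subspace_H] by simp
    also have "\<dots> = (c * \<nu> h) *\<^sub>C y" using y(2)[OF that] by (simp add: bracket_scaleC_left)
    finally show ?thesis using y(1) by simp
  qed
  ultimately show "(\<lambda>h. if h \<in> H then \<nu> h else 0) \<in> weights"
    using subspace_H assms eq by (auto simp: weights_def dual_def lie.subspace_add lie.subspace_scale)
qed

text \<open>Fitting decomposition, by induction on the dimension. If some ad h has no single
  generalized eigenvalue on V, take an eigenvalue c; then V is the sum of the kernel and the image
  of a suitable power of ad h - c, both proper and, since \<open>H\<close> is abelian, both stable.
  Otherwise V lies in one weight space, for a function of h not yet known to be linear.\<close>

lemma subspace_subset_span_weight_spaces:
  assumes "lie_subspace V" "\<And>h x. h \<in> H \<Longrightarrow> x \<in> V \<Longrightarrow> bracket h x \<in> V"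
  shows "V \<subseteq> lie_span (\<Union>\<nu>. W \<nu>)"
  using assms
proof (induction "lie.dim V" arbitrary: V rule: less_induct)
  case less
  note V = less.prems(1) and stable = less.prems(2)
  have shV: "ad_shift c h x \<in> V" if "h \<in> H" "x \<in> V" for c h x
    using that stable V by (auto simp: ad_shift_def intro!: lie.subspace_diff lie.subspace_scale)
  have shV': "(ad_shift c h ^^ n) x \<in> V" if "h \<in> H" "x \<in> V" for c h x n
    using that by (induction n) (auto intro: shV)
  show ?case
  proof (cases "\<forall>h\<in>H. \<exists>c n. \<forall>x\<in>V. (ad_shift c h ^^ n) x = 0")
    case True
    from bchoice[OF this]
    obtain c where c: "\<forall>h\<in>H. \<exists>n. \<forall>x\<in>V. (ad_shift (c h) h ^^ n) x = 0" ..
    have "V \<subseteq> W c"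
      unfolding weight_space_def
    proof safe
      fix x h assume "x \<in> V" "h \<in> H"
      then show "\<exists>n. (ad_shift (c h) h ^^ n) x = 0" using c by meson
    qed
    then show ?thesis using lie.span_superset by fast
  next
    case False
    then obtain h where h: "h \<in> H" and neq: "\<And>c n. \<exists>x\<in>V. (ad_shift c h ^^ n) x \<noteq> 0" by blast
    obtain v where v: "v \<in> V" "v \<noteq> 0" using neq[of 0 0] by auto
    obtain A where A: "finite A" "A \<subseteq> V" "lie_span A = V" using exists_finite_basis[OF V] by blast
    have "\<exists>c. \<exists>x\<in>V. x \<noteq> 0 \<and> bracket h x = c *\<^sub>C x"
      by (rule exists_eigenvector[OF linear_bracket V _ v A(1)]) (use stable h A in auto)
    then obtain c x0 where x0: "x0 \<in> V" "x0 \<noteq> 0" "ad_shift c h x0 = 0" by (auto simp: ad_shift_def)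
    define f where "f = ad_shift c h"
    have linf: "lie_linear (f ^^ n)" for n
      unfolding f_def by (rule linear_funpow[OF linear_ad_shift])
    have subf: "lie_subspace ((f ^^ n) ` V)" for n
    proof -
      interpret g: Vector_Spaces.linear scaleC scaleC "f ^^ n" by (rule linf)
      show ?thesis using g.subspace_image[of V] V by (simp add: lie_subspace_def)
    qed
    \<comment> \<open>The exponent is \<open>Suc k\<close>, never 0, so that the eigenvector
      \<open>x0\<close> is killed and the image is smaller than V. Minimality of the dimension makes
      the same power map the image onto itself.\<close>
    obtain k where k: "\<And>j. lie.dim ((f ^^ Suc k) ` V) \<le> lie.dim ((f ^^ Suc j) ` V)"
      using ex_has_least_nat[of "\<lambda>_. True" 0 "\<lambda>k. lie.dim ((f ^^ Suc k) ` V)"] by auto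
    define I K where "I = (f ^^ Suc k) ` V" and "K = {x \<in> V. (f ^^ Suc k) x = 0}"
    have IV: "I \<subseteq> V" unfolding I_def f_def using shV'[OF h] by blast
    have II: "I = (f ^^ Suc k) ` I"
    proof (rule ccontr)
      assume neq: "I \<noteq> (f ^^ Suc k) ` I"
      have eq: "(f ^^ Suc k) ` I = (f ^^ Suc (k + Suc k)) ` V"
        unfolding I_def image_image comp_apply[symmetric, of "f ^^ Suc k"] funpow_add[symmetric] by simp
      have "(f ^^ Suc k) ` I \<subset> I" using neq IV unfolding I_def by blast
      moreover have "lie_subspace ((f ^^ Suc k) ` I)" unfolding eq by (rule subf)
      moreover have "lie_subspace I" unfolding I_def by (rule subf)
      ultimately have "lie.dim ((f ^^ Suc k) ` I) < lie.dim I"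
        using dim_psubset[OF finite_dimensional] by blast
      then show False using k[of "k + Suc k"] unfolding eq unfolding I_def by linarith
    qed
    have KI: "V \<subseteq> lie_span (I \<union> K)"
    proof
      fix v assume v: "v \<in> V"
      then obtain u where u: "u \<in> I" "(f ^^ Suc k) v = (f ^^ Suc k) u" using II unfolding I_def by blast
      interpret g: Vector_Spaces.linear scaleC scaleC "f ^^ Suc k" by (rule linf)
      have "v - u \<in> K" using u v IV lie.subspace_diff[OF V] by (auto simp: K_def g.diff simp del: funpow.simps)
      then have "u + (v - u) \<in> lie_span (I \<union> K)" using u by (intro lie.span_add) (auto intro: lie.span_base)
      then show "v \<in> lie_span (I \<union> K)" by simp
    qed
    have subI: "lie_subspace I" unfolding I_def by (rule subf)
    have subK: "lie_subspace K"
    proof -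
      interpret g: Vector_Spaces.linear scaleC scaleC "f ^^ Suc k" by (rule linf)
      show ?thesis using V unfolding K_def
        by (intro lie.subspaceI) (auto simp del: funpow.simps simp: g.add g.scale g.zero lie.subspace_0 lie.subspace_add lie.subspace_scale)
    qed
    have commute: "(f ^^ n) (bracket h' x) = bracket h' ((f ^^ n) x)" if "h' \<in> H" for h' x n
      using ad_shift_commute[OF h that, of c 0] by (intro funpow_commute) (simp add: f_def ad_shift_def)
    have "K \<subset> V" using neq[where n = "Suc k" and c = c] unfolding K_def f_def by blast
    then have "lie.dim K < lie.dim V" by (rule dim_psubset[OF finite_dimensional subK V])
    then have "K \<subseteq> lie_span (\<Union>\<nu>. W \<nu>)"
      by (rule less.hyps) (use subK stable commute in \<open>auto simp: K_def simp del: funpow.simps\<close>)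
    moreover have "lie.dim I < lie.dim V"
    proof -
      have "{x0} \<subseteq> V" "lie.independent {x0}" using x0 by auto
      then obtain C where C: "{x0} \<subseteq> C" "C \<subseteq> V" "lie.independent C" "V \<subseteq> lie_span C"
        using lie.maximal_independent_subset_extend[of "{x0}" V] by blast
      have fin: "finite C" using finite_independent[OF finite_dimensional C(3)] .
      have "(f ^^ Suc k) x0 = 0" using x0 by (simp add: f_def funpow_swap1)
      then have "(f ^^ Suc k) ` C \<subseteq> lie_span ((f ^^ Suc k) ` (C - {x0}))"
        using lie.span_base[of _ "(f ^^ Suc k) ` (C - {x0})"] lie.span_zero[of "(f ^^ Suc k) ` (C - {x0})"]
        by (metis DiffI image_eqI image_subsetI singletonD)
      then have "lie_span ((f ^^ Suc k) ` C) \<subseteq> lie_span ((f ^^ Suc k) ` (C - {x0}))"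
        by (rule lie.span_minimal) simp
      then have "I \<subseteq> lie_span ((f ^^ Suc k) ` (C - {x0}))"
        using C(4) unfolding I_def lie_span_image[OF linf, of _ C] by blast
      then have "lie.dim I \<le> card ((f ^^ Suc k) ` (C - {x0}))" using fin by (intro lie.dim_le_card) auto
      also have "\<dots> \<le> card (C - {x0})" using fin by (intro card_image_le) auto
      also have "\<dots> < card C" using fin C(1) by (intro psubset_card_mono) auto
      also have "card C = lie.dim V" using C by (intro lie.basis_card_eq_dim) auto
      finally show ?thesis .
    qed
    then have "I \<subseteq> lie_span (\<Union>\<nu>. W \<nu>)"
    proof (rule less.hyps[OF _ subI])
      fix h' x assume h': "h' \<in> H" and "x \<in> I"
      then obtain y where y: "y \<in> V" "x = (f ^^ Suc k) y" unfolding I_def by blast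
      show "bracket h' x \<in> I"
        unfolding y(2) commute[OF h', symmetric] I_def using stable[OF h' y(1)] by (rule imageI)
    qed
    ultimately have "lie_span (I \<union> K) \<subseteq> lie_span (\<Union>\<nu>. W \<nu>)"
      by (intro lie.span_minimal) auto
    then show ?thesis using KI by blast
  qed
qed

lemma span_weights: "lie_span (\<Union>\<nu>\<in>weights. W \<nu>) = UNIV"
proof -
  have "W \<nu> \<subseteq> lie_span (\<Union>\<nu>\<in>weights. W \<nu>)" for \<nu>
  proof (cases "W \<nu> = {0}")
    case False
    from restrict_weight[OF this] show ?thesis using lie.span_superset by fast
  qed (simp add: lie.span_zero)
  then have "lie_span (\<Union>\<nu>. W \<nu>) \<subseteq> lie_span (\<Union>\<nu>\<in>weights. W \<nu>)"
    by (intro lie.span_minimal) auto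
  then show ?thesis using subspace_subset_span_weight_spaces[of UNIV] by auto
qed

text \<open>A finite basis chosen from weight vectors involves finitely many weights. The space of a
  weight outside that list would meet their span only in 0, although they span everything.\<close>

lemma finite_weights: "finite weights"
proof -
  obtain B where B: "B \<subseteq> (\<Union>\<nu>\<in>weights. W \<nu>)" "lie.independent B"
      "(\<Union>\<nu>\<in>weights. W \<nu>) \<subseteq> lie_span B"
    using lie.maximal_independent_subset by blast
  have "finite B" using finite_independent[OF finite_dimensional B(2)] .
  then obtain L where L: "L \<subseteq> weights" "finite L" "B \<subseteq> (\<Union>\<nu>\<in>L. W \<nu>)"
    using finite_subset_Union[of B "W ` weights"] B(1)
    by (metis (no_types, lifting) finite_subset_image)
  have "lie_span B = UNIV" using span_weights lie.span_minimal[OF B(3)] by auto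
  then have L': "lie_span (\<Union>\<nu>\<in>L. W \<nu>) = UNIV" using lie.span_mono[OF L(3)] by auto
  have "weights \<subseteq> L"
  proof
    fix \<mu> assume mu: "\<mu> \<in> weights"
    then obtain x where x: "x \<in> W \<mu>" "x \<noteq> 0" using zero_in_weight_space unfolding weights_def by blast
    show "\<mu> \<in> L"
    proof (rule ccontr)
      assume "\<mu> \<notin> L"
      from weight_space_disjoint_span[OF L(2) _ _ this x(1)] show False
        using L(1) mu x(2) L' by (auto simp: weights_def)
    qed
  qed
  then show ?thesis using L(2) finite_subset by blast
qed

lemma finite_roots: "finite (roots H)"
  using finite_weights weights_eq by simp

end


section \<open>Root systems with a base\<close>

lemma sum_apply: "sum f A x = (\<Sum>a\<in>A. f a x)" for f :: "'a \<Rightarrow> 'b \<Rightarrow> complex"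
  by (induction A rule: infinite_finite_induct) auto

lemma sum_list_closed:
  assumes "\<And>x y. P x \<Longrightarrow> P y \<Longrightarrow> P (x + y)" "P 0" "\<And>x. x \<in> set xs \<Longrightarrow> P x"
  shows "P (sum_list xs :: 'a :: comm_monoid_add)"
  using assms(3) by (induction xs) (auto intro: assms(1,2))

lemma nat_span_coefficient:
  assumes "\<not> fn_dependent \<pi>" "\<beta> \<in> nat_span \<pi>"
  shows "\<beta> \<in> fn_span \<pi> \<and> (\<exists>n. coefficient \<pi> \<beta> a = of_nat n)"
proof -
  obtain xs where xs: "\<beta> = sum_list xs" "set xs \<subseteq> \<pi>" using assms(2) by (auto simp: nat_span_def)
  show ?thesis
    unfolding xs(1)
  proof (rule sum_list_closed[where P = "\<lambda>x. x \<in> fn_span \<pi> \<and> (\<exists>n. coefficient \<pi> x a = of_nat n)"])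
    fix x y
    assume "x \<in> fn_span \<pi> \<and> (\<exists>n. coefficient \<pi> x a = of_nat n)" "y \<in> fn_span \<pi> \<and> (\<exists>n. coefficient \<pi> y a = of_nat n)"
    then show "x + y \<in> fn_span \<pi> \<and> (\<exists>n. coefficient \<pi> (x + y) a = of_nat n)"
      by (auto simp: fn.representation_add[OF assms(1)] intro: fn.span_add) (metis of_nat_add)
  next
    show "0 \<in> fn_span \<pi> \<and> (\<exists>n. coefficient \<pi> 0 a = of_nat n)"
      by (auto simp: fn.representation_zero intro: fn.span_zero exI[of _ 0])
  next
    fix x assume "x \<in> set xs"
    then have "x \<in> \<pi>" using xs by auto
    then show "x \<in> fn_span \<pi> \<and> (\<exists>n. coefficient \<pi> x a = of_nat n)"
      using fn.representation_basis[OF assms(1), of x] fn.span_base[of x \<pi>]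
      by (auto intro: exI[of _ 0] exI[of _ 1])
  qed
qed

lemma nat_span_height:
  assumes "\<not> fn_dependent \<pi>" "finite \<pi>" "\<beta> \<in> nat_span \<pi>" "\<beta> \<noteq> 0"
  shows "\<exists>n>0. (\<Sum>a\<in>\<pi>. coefficient \<pi> \<beta> a) = of_nat n"
proof -
  obtain n where n: "\<And>a. coefficient \<pi> \<beta> a = of_nat (n a)"
    using nat_span_coefficient[OF assms(1,3)] by metis
  have "(\<Sum>a\<in>\<pi>. n a) \<noteq> 0"
  proof
    assume "(\<Sum>a\<in>\<pi>. n a) = 0"
    then have "\<forall>a\<in>\<pi>. n a = 0" using assms(2) by simp
    moreover have "\<beta> = (\<Sum>a\<in>\<pi>. (\<lambda>x. coefficient \<pi> \<beta> a * a x))"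
      using fn.sum_representation_eq[OF assms(1) _ assms(2), of \<beta>] nat_span_coefficient[OF assms(1,3)] by simp
    ultimately show False using assms(4) n by (auto simp: fun_eq_iff sum_apply)
  qed
  then show ?thesis by (intro exI[of _ "\<Sum>a\<in>\<pi>. n a"]) (simp add: n)
qed

lemma nat_span_subset_group_closure: "nat_span A \<subseteq> group_closure A"
proof
  fix x assume "x \<in> nat_span A"
  then obtain xs where xs: "x = sum_list xs" "set xs \<subseteq> A" by (auto simp: nat_span_def)
  show "x \<in> group_closure A"
    unfolding xs(1) using xs(2)
    by (intro sum_list_closed[of "\<lambda>x. x \<in> group_closure A"]) (auto intro: group_closure_add group_closure.base)
qed

lemma group_closure_sum_mem: "(\<And>i. i \<in> I \<Longrightarrow> f i \<in> group_closure A) \<Longrightarrow> sum f I \<in> group_closure A"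
  by (induction I rule: infinite_finite_induct) (auto intro: group_closure_add)

lemma group_closure_subset_span: "group_closure \<pi> \<subseteq> fn_span \<pi>"
proof
  fix x assume "x \<in> group_closure \<pi>"
  then show "x \<in> fn_span \<pi>"
  proof induction
    case (base s)
    then show ?case using fn.span_base[of s \<pi>] fn.span_zero[of \<pi>] by blast
  next
    case (diff s t)
    from diff.IH show ?case by (rule fn.span_diff)
  qed
qed

text \<open>Every lattice element is y + k a with y in the lattice of the other generators, and
  independence identifies k with the coefficient at a.\<close>

lemma group_closure_remove:
  assumes "\<not> fn_dependent \<pi>" "a \<in> \<pi>" "x \<in> group_closure \<pi>" "coefficient \<pi> x a = 0"
  shows "x \<in> group_closure (\<pi> - {a})"
proof -
  have "\<exists>k::int. \<exists>y\<in>group_closure (\<pi> - {a}). x = y + (\<lambda>h. of_int k * a h)"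
    using assms(3)
  proof induction
    case (base s)
    then consider "s = a" | "s \<in> group_closure (\<pi> - {a})" by (auto intro: group_closure.base)
    then show ?case
    proof cases
      case 1
      then show ?thesis by (intro exI[of _ 1] bexI[of _ 0]) (auto simp: fun_eq_iff)
    next
      case 2
      then show ?thesis by (intro exI[of _ 0] bexI[of _ s]) (auto simp: fun_eq_iff)
    qed
  next
    case (diff s t)
    then obtain k y l z where "y \<in> group_closure (\<pi> - {a})" "s = y + (\<lambda>h. of_int k * a h)"
      "z \<in> group_closure (\<pi> - {a})" "t = z + (\<lambda>h. of_int l * a h)" by blast
    then show ?case
      by (intro exI[of _ "k - l"] bexI[of _ "y - z"])
        (auto simp: fun_eq_iff algebra_simps intro: group_closure.diff)
  qed
  then obtain k :: int and y where y: "y \<in> group_closure (\<pi> - {a})" "x = y + (\<lambda>h. of_int k * a h)" by blast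
  have yspan: "y \<in> fn_span (\<pi> - {a})" using y(1) group_closure_subset_span by blast
  then have "coefficient \<pi> y = coefficient (\<pi> - {a}) y"
    by (intro fn.representation_extend[OF assms(1)]) auto
  then have "coefficient \<pi> y a = 0" using fn.representation_ne_zero[of "\<pi> - {a}" y a] by auto
  moreover have "y \<in> fn_span \<pi>" using yspan fn.span_mono[of "\<pi> - {a}" \<pi>] by auto
  moreover have "coefficient \<pi> (\<lambda>h. of_int k * a h) a = of_int k"
    using assms(1,2) by (simp add: fn.representation_scale fn.span_base fn.representation_basis)
  moreover have "(\<lambda>h. of_int k * a h) \<in> fn_span \<pi>" using assms(2) by (intro fn.span_scale fn.span_base)
  ultimately have "k = 0" using assms(4) y(2) by (simp add: fn.representation_add[OF assms(1)])
  then have "x = y" using y(2) by (auto simp: fun_eq_iff)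
  then show ?thesis using y(1) by simp
qed

text \<open>Roots enter only through their values at coroots, which separates the combinatorics of
  the Weyl group from the Lie algebra. \<open>reduced\<close> has the shape in which
  \<open>refl_simple_pos\<close> uses it.\<close>

locale root_base =
  fixes R \<pi> :: "('h \<Rightarrow> complex) set" and co :: "('h \<Rightarrow> complex) \<Rightarrow> 'h"
  assumes finite_R: "finite R"
    and co_self: "\<alpha> \<in> R \<Longrightarrow> \<alpha> (co \<alpha>) = 2"
    and co_int: "\<alpha> \<in> R \<Longrightarrow> \<beta> \<in> R \<Longrightarrow> \<beta> (co \<alpha>) \<in> \<int>"
    and refl_root': "\<alpha> \<in> R \<Longrightarrow> \<beta> \<in> R \<Longrightarrow> (\<lambda>x. \<beta> x - \<beta> (co \<alpha>) * \<alpha> x) \<in> R"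
    and base_subset: "\<pi> \<subseteq> R"
    and base_independent: "\<not> fn_dependent \<pi>"
    and base_sign: "\<beta> \<in> R \<Longrightarrow> \<beta> \<in> nat_span \<pi> \<or> - \<beta> \<in> nat_span \<pi>"
    and reduced: "\<alpha> \<in> \<pi> \<Longrightarrow> (\<lambda>x. of_nat n * \<alpha> x) \<in> R \<Longrightarrow> n = 1"
begin

text \<open>Unlike \<open>reflection\<close> this is not cut off outside the dual, so linearity and
  composition hold for all functions.\<close>

definition refl :: "('h \<Rightarrow> complex) \<Rightarrow> ('h \<Rightarrow> complex) \<Rightarrow> 'h \<Rightarrow> complex" where
  "refl \<alpha> \<mu> = (\<lambda>x. \<mu> x - \<mu> (co \<alpha>) * \<alpha> x)"

definition pos :: "('h \<Rightarrow> complex) set" where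
  "pos = {\<beta> \<in> R. \<beta> \<in> nat_span \<pi>}"

abbreviation "V \<equiv> fn_span \<pi>"

definition height :: "('h \<Rightarrow> complex) \<Rightarrow> complex" where
  "height \<beta> = (\<Sum>a\<in>\<pi>. coefficient \<pi> \<beta> a)"

lemma refl_root: "\<alpha> \<in> R \<Longrightarrow> \<beta> \<in> R \<Longrightarrow> refl \<alpha> \<beta> \<in> R"
  using refl_root' by (simp add: refl_def)

lemma finite_base: "finite \<pi>" using finite_R base_subset finite_subset by blast

lemma pos_subset: "pos \<subseteq> R" by (auto simp: pos_def)

lemma finite_pos: "finite pos" using finite_R pos_subset finite_subset by blast

lemma base_pos: "a \<in> \<pi> \<Longrightarrow> a \<in> pos"
  using base_subset by (auto simp: pos_def nat_span_def intro!: exI[of _ "[a]"])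

lemma root_nonzero: "\<alpha> \<in> R \<Longrightarrow> \<alpha> \<noteq> 0" using co_self[of 0] by auto

lemma refl_add: "refl \<alpha> (\<mu> + \<nu>) = refl \<alpha> \<mu> + refl \<alpha> \<nu>"
  and refl_diff: "refl \<alpha> (\<mu> - \<nu>) = refl \<alpha> \<mu> - refl \<alpha> \<nu>"
  and refl_minus: "refl \<alpha> (- \<mu>) = - refl \<alpha> \<mu>"
  and refl_scale: "refl \<alpha> (\<lambda>x. c * \<mu> x) = (\<lambda>x. c * refl \<alpha> \<mu> x)"
  and refl_0: "refl \<alpha> 0 = 0"
  by (auto simp: refl_def fun_eq_iff algebra_simps)

lemma refl_self: "\<alpha> \<in> R \<Longrightarrow> refl \<alpha> \<alpha> = - \<alpha>"
  by (auto simp: refl_def fun_eq_iff co_self)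

lemma refl_refl: "\<alpha> \<in> R \<Longrightarrow> refl \<alpha> (refl \<alpha> \<mu>) = \<mu>"
  by (auto simp: refl_def fun_eq_iff co_self algebra_simps)

lemma uminus_root: "\<alpha> \<in> R \<Longrightarrow> - \<alpha> \<in> R"
  using refl_root[of \<alpha> \<alpha>] refl_self by simp

lemma pos_coefficient: "\<beta> \<in> pos \<Longrightarrow> \<exists>n. coefficient \<pi> \<beta> a = of_nat n"
  using nat_span_coefficient[OF base_independent] by (auto simp: pos_def)

lemma root_cases: "\<beta> \<in> R \<Longrightarrow> \<beta> \<in> pos \<or> - \<beta> \<in> pos"
  using base_sign uminus_root by (auto simp: pos_def)

lemma pos_in_V: "\<beta> \<in> pos \<Longrightarrow> \<beta> \<in> V"
  using nat_span_coefficient[OF base_independent] by (auto simp: pos_def)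

lemma root_in_V: "\<beta> \<in> R \<Longrightarrow> \<beta> \<in> V"
  using root_cases pos_in_V fn.span_neg[of "- \<beta>" \<pi>] by auto

lemma refl_in_V: "\<alpha> \<in> R \<Longrightarrow> \<mu> \<in> V \<Longrightarrow> refl \<alpha> \<mu> \<in> V"
  unfolding refl_def using fn.span_diff[OF _ fn.span_scale[OF root_in_V]] by (auto simp: fun_diff_def)

lemma expand: "\<mu> \<in> V \<Longrightarrow> \<mu> = (\<Sum>a\<in>\<pi>. (\<lambda>x. coefficient \<pi> \<mu> a * a x))"
  using fn.sum_representation_eq[OF base_independent _ finite_base, of \<mu>] by simp

lemma coefficient_minus: "\<mu> \<in> V \<Longrightarrow> coefficient \<pi> (- \<mu>) a = - coefficient \<pi> \<mu> a"
  using fn.representation_neg[OF base_independent] by simp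

lemma pos_not_neg: "\<beta> \<in> pos \<Longrightarrow> - \<beta> \<notin> pos"
proof
  assume b: "\<beta> \<in> pos" "- \<beta> \<in> pos"
  have "coefficient \<pi> \<beta> a = 0" for a
  proof -
    obtain m n where "coefficient \<pi> \<beta> a = of_nat m" "- coefficient \<pi> \<beta> a = of_nat n"
      using pos_coefficient b coefficient_minus[OF pos_in_V] by metis
    then have "of_nat (m + n) = (0 :: complex)" by (metis add.right_inverse of_nat_add)
    then have "m = 0" by (simp only: of_nat_eq_0_iff)
    then show ?thesis using \<open>coefficient \<pi> \<beta> a = of_nat m\<close> by simp
  qed
  then have "\<beta> = 0" using expand[OF pos_in_V[OF b(1)]] by (auto simp: fun_eq_iff)
  then show False using b root_nonzero pos_subset by auto
qed

text \<open>Reflecting in a changes no coefficient except the one at a. As \<beta> is not a multiple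
  of a, some other coefficient is positive; it survives, and the coefficients of a root have one
  sign.\<close>

lemma refl_simple_pos:
  assumes "a \<in> \<pi>" "\<beta> \<in> pos" "\<beta> \<noteq> a"
  shows "refl a \<beta> \<in> pos"
proof -
  have aR: "a \<in> R" and bR: "\<beta> \<in> R" using assms base_subset pos_subset by auto
  have "\<exists>b\<in>\<pi>. b \<noteq> a \<and> coefficient \<pi> \<beta> b \<noteq> 0"
  proof (rule ccontr)
    assume "\<not> ?thesis"
    then have "(\<Sum>b\<in>\<pi>. (\<lambda>x. coefficient \<pi> \<beta> b * b x)) = (\<Sum>b\<in>{a}. (\<lambda>x. coefficient \<pi> \<beta> b * b x))"
      using assms(1) finite_base by (intro sum.mono_neutral_right) (auto simp: fun_eq_iff)
    then have eq: "\<beta> = (\<lambda>x. coefficient \<pi> \<beta> a * a x)" using expand[OF pos_in_V[OF assms(2)]] by simp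
    obtain n where n: "coefficient \<pi> \<beta> a = of_nat n" using pos_coefficient[OF assms(2)] by blast
    have "\<beta> = (\<lambda>x. of_nat n * a x)" using eq unfolding n .
    moreover from this have "n = 1" using reduced[OF assms(1)] bR by auto
    ultimately show False using assms(3) by simp
  qed
  then obtain b where b: "b \<in> \<pi>" "b \<noteq> a" "coefficient \<pi> \<beta> b \<noteq> 0" by blast
  have "refl a \<beta> = \<beta> - (\<lambda>x. \<beta> (co a) * a x)" by (auto simp: refl_def fun_eq_iff)
  moreover have "coefficient \<pi> (\<lambda>x. \<beta> (co a) * a x) b = 0"
    using b(2) assms(1) base_independent by (simp add: fn.representation_scale fn.span_base fn.representation_basis)
  ultimately have "coefficient \<pi> (refl a \<beta>) b = coefficient \<pi> \<beta> b"
    using fn.representation_diff[OF base_independent fn.span_scale[OF fn.span_base[OF assms(1)]] pos_in_V[OF assms(2)]]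
    by simp
  moreover obtain n where "coefficient \<pi> \<beta> b = of_nat n" using pos_coefficient[OF assms(2)] by blast
  ultimately have n: "coefficient \<pi> (refl a \<beta>) b = of_nat n" "n > 0" using b(3) by auto
  show ?thesis
  proof (rule ccontr)
    assume "refl a \<beta> \<notin> pos"
    then have "- refl a \<beta> \<in> pos" using root_cases refl_root[OF aR bR] by blast
    then obtain m where "- coefficient \<pi> (refl a \<beta>) b = of_nat m"
      using pos_coefficient coefficient_minus[OF refl_in_V[OF aR pos_in_V[OF assms(2)]]] by metis
    then have "of_nat (m + n) = (0 :: complex)" using n(1) by (metis add.left_inverse of_nat_add)
    then show False using n(2) by (simp only: of_nat_eq_0_iff)
  qed
qed

text \<open>With \<gamma> = \<open>refl \<alpha> \<beta>\<close>, both s_\<alpha> s_\<beta>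
  s_\<alpha> and s_\<gamma> negate \<gamma> and permute the finite set \<open>R\<close>. Their
  product is a transvection, whose powers would produce infinitely many roots if the two sides
  differed on some root.\<close>

lemma coroot_refl:
  assumes "\<alpha> \<in> R" "\<beta> \<in> R" "\<mu> \<in> V"
  shows "\<mu> (co (refl \<alpha> \<beta>)) = refl \<alpha> \<mu> (co \<beta>)"
proof -
  define \<gamma> where "\<gamma> = refl \<alpha> \<beta>"
  have gR: "\<gamma> \<in> R" unfolding \<gamma>_def using assms refl_root by blast
  define d where "d \<mu> = \<mu> (co \<gamma>) - refl \<alpha> \<mu> (co \<beta>)" for \<mu>
  have g: "refl \<alpha> \<gamma> = \<beta>" unfolding \<gamma>_def using assms refl_refl by blast
  have "d \<gamma> = 0" unfolding d_def g using co_self[OF gR] co_self[OF assms(2)] by simp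
  have "d \<mu> = 0" if "\<mu> \<in> R" for \<mu>
  proof (rule ccontr)
    assume nz: "d \<mu> \<noteq> 0"
    \<comment> \<open>The product of the four reflections translates \<nu> by d(\<nu>) \<gamma>.
      Since d(\<gamma>) = 0, d is constant along the translates, and each iteration moves \<mu> by
      the same amount.\<close>
    have step: "refl \<alpha> (refl \<beta> (refl \<alpha> (refl \<gamma> \<nu>))) = \<nu> + (\<lambda>x. d \<nu> * \<gamma> x)" for \<nu>
    proof -
      have 1: "refl \<alpha> (refl \<beta> (refl \<alpha> \<eta>)) = \<eta> - (\<lambda>x. refl \<alpha> \<eta> (co \<beta>) * \<gamma> x)" for \<eta>
      proof -
        have "refl \<beta> (refl \<alpha> \<eta>) = refl \<alpha> \<eta> - (\<lambda>x. refl \<alpha> \<eta> (co \<beta>) * \<beta> x)" by (auto simp: refl_def fun_eq_iff)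
        then show ?thesis by (simp add: refl_diff refl_scale refl_refl[OF assms(1)] \<gamma>_def)
      qed
      have "refl \<gamma> \<nu> = \<nu> - (\<lambda>x. \<nu> (co \<gamma>) * \<gamma> x)" by (auto simp: refl_def fun_eq_iff)
      then have 2: "refl \<alpha> (refl \<gamma> \<nu>) (co \<beta>) = refl \<alpha> \<nu> (co \<beta>) - 2 * \<nu> (co \<gamma>)"
        using co_self[OF assms(2)] by (simp add: refl_diff refl_scale g)
      show ?thesis unfolding 1 2 by (auto simp: refl_def[of \<gamma>] fun_eq_iff d_def algebra_simps)
    qed
    have d_add: "d (\<mu> + (\<lambda>x. c * \<gamma> x)) = d \<mu>" for c
      using \<open>d \<gamma> = 0\<close> by (auto simp: d_def refl_add refl_scale algebra_simps)
    have "\<mu> + (\<lambda>x. of_nat n * d \<mu> * \<gamma> x) \<in> R" for n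
    proof (induction n)
      case 0
      then show ?case using that by (simp add: plus_fun_def)
    next
      case (Suc n)
      define \<nu> where "\<nu> = \<mu> + (\<lambda>x. of_nat n * d \<mu> * \<gamma> x)"
      have "d \<nu> = d \<mu>" unfolding \<nu>_def by (rule d_add)
      then have "\<nu> + (\<lambda>x. d \<mu> * \<gamma> x) \<in> R"
        using refl_root[OF assms(1) refl_root[OF assms(2) refl_root[OF assms(1) refl_root[OF gR Suc[folded \<nu>_def]]]]]
        unfolding step by simp
      moreover have "\<nu> + (\<lambda>x. d \<mu> * \<gamma> x) = \<mu> + (\<lambda>x. of_nat (Suc n) * d \<mu> * \<gamma> x)"
        by (auto simp: \<nu>_def fun_eq_iff algebra_simps)
      ultimately show ?case by (simp only:)
    qed
    then have "range (\<lambda>n. \<mu> + (\<lambda>x. of_nat n * d \<mu> * \<gamma> x)) \<subseteq> R" by blast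
    then have fin: "finite (range (\<lambda>n. \<mu> + (\<lambda>x. of_nat n * d \<mu> * \<gamma> x)))" using finite_R finite_subset by blast
    have "inj (\<lambda>n::nat. \<mu> + (\<lambda>x. of_nat n * d \<mu> * \<gamma> x))"
    proof (rule injI)
      fix m n :: nat assume "\<mu> + (\<lambda>x. of_nat m * d \<mu> * \<gamma> x) = \<mu> + (\<lambda>x. of_nat n * d \<mu> * \<gamma> x)"
      then have "of_nat m * d \<mu> * \<gamma> (co \<gamma>) = of_nat n * d \<mu> * \<gamma> (co \<gamma>)"
        by (simp only: add_left_cancel) (rule fun_cong)
      then show "m = n" using nz co_self[OF gR] by simp
    qed
    then show False using fin finite_imageD by fastforce
  qed
  then have "\<mu> \<in> R \<Longrightarrow> d \<mu> = 0" for \<mu> .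
  moreover have "fn.subspace {\<mu>. d \<mu> = 0}"
    by (rule fn.subspaceI) (auto simp: d_def refl_add refl_scale refl_0)
  ultimately have "V \<subseteq> {\<mu>. d \<mu> = 0}" using base_subset by (intro fn.span_minimal) auto
  then show ?thesis using assms(3) by (auto simp: d_def \<gamma>_def)
qed

lemma refl_conj:
  assumes "\<alpha> \<in> R" "\<beta> \<in> R" "\<mu> \<in> V"
  shows "refl \<alpha> (refl \<beta> (refl \<alpha> \<mu>)) = refl (refl \<alpha> \<beta>) \<mu>"
proof -
  have "refl \<beta> (refl \<alpha> \<mu>) = refl \<alpha> \<mu> - (\<lambda>x. refl \<alpha> \<mu> (co \<beta>) * \<beta> x)" by (auto simp: refl_def fun_eq_iff)
  then have "refl \<alpha> (refl \<beta> (refl \<alpha> \<mu>)) = \<mu> - (\<lambda>x. refl \<alpha> \<mu> (co \<beta>) * refl \<alpha> \<beta> x)"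
    by (simp add: refl_diff refl_scale refl_refl[OF assms(1)])
  also have "\<dots> = refl (refl \<alpha> \<beta>) \<mu>"
    unfolding coroot_refl[OF assms, symmetric] by (auto simp: refl_def[of "refl \<alpha> \<beta>"] fun_eq_iff)
  finally show ?thesis .
qed

section \<open>The invariant form\<close>

text \<open>Summing over all coroots gives invariance, because reflections permute the coroots as
  functionals on \<open>V\<close>. Real parts make the form real and positive semidefinite on
  complex functionals and lose nothing on integral ones.\<close>

definition form :: "('h \<Rightarrow> complex) \<Rightarrow> ('h \<Rightarrow> complex) \<Rightarrow> real" where
  "form \<mu> \<nu> = (\<Sum>\<beta>\<in>R. Re (\<mu> (co \<beta>)) * Re (\<nu> (co \<beta>)))"

lemma form_add_left: "form (\<mu> + \<nu>) \<eta> = form \<mu> \<eta> + form \<nu> \<eta>"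
  and form_add_right: "form \<eta> (\<mu> + \<nu>) = form \<eta> \<mu> + form \<eta> \<nu>"
  and form_minus_right: "form \<eta> (- \<nu>) = - form \<eta> \<nu>"
  and form_0_right [simp]: "form \<eta> 0 = 0"
  and form_sym: "form \<mu> \<nu> = form \<nu> \<mu>"
  by (simp_all add: form_def algebra_simps sum.distrib sum_negf)

lemma form_sum_right: "form \<eta> (sum f A) = (\<Sum>a\<in>A. form \<eta> (f a))"
  by (induction A rule: infinite_finite_induct)
    (simp_all only: sum.infinite sum.empty sum.insert form_0_right form_add_right not_False_eq_True)

lemma form_nat_scale: "form \<eta> (\<lambda>x. of_nat n * \<mu> x) = of_nat n * form \<eta> \<mu>"
  by (simp add: form_def sum_distrib_left algebra_simps)

lemma form_nonneg: "form \<mu> \<mu> \<ge> 0"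
  by (simp add: form_def sum_nonneg)

lemma form_refl:
  assumes "\<alpha> \<in> R" "\<mu> \<in> V" "\<nu> \<in> V"
  shows "form (refl \<alpha> \<mu>) (refl \<alpha> \<nu>) = form \<mu> \<nu>"
  unfolding form_def
proof (rule sum.reindex_bij_witness[of _ "refl \<alpha>" "refl \<alpha>"])
  fix \<beta> assume b: "\<beta> \<in> R"
  show "refl \<alpha> (refl \<alpha> \<beta>) = \<beta>" "refl \<alpha> (refl \<alpha> \<beta>) = \<beta>" using assms refl_refl by auto
  show "refl \<alpha> \<beta> \<in> R" "refl \<alpha> \<beta> \<in> R" using assms b refl_root by auto
  show "Re (\<mu> (co (refl \<alpha> \<beta>))) * Re (\<nu> (co (refl \<alpha> \<beta>))) = Re (refl \<alpha> \<mu> (co \<beta>)) * Re (refl \<alpha> \<nu> (co \<beta>))"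
    using coroot_refl[OF assms(1) b] assms by simp
qed

lemma form_root_pos: "\<alpha> \<in> R \<Longrightarrow> form \<alpha> \<alpha> > 0"
proof -
  assume a: "\<alpha> \<in> R"
  have "0 < Re (\<alpha> (co \<alpha>)) * Re (\<alpha> (co \<alpha>))" using co_self[OF a] by simp
  also have "\<dots> \<le> form \<alpha> \<alpha>" unfolding form_def
    using a finite_R by (intro member_le_sum[of \<alpha> R "\<lambda>\<beta>. Re (\<alpha> (co \<beta>)) * Re (\<alpha> (co \<beta>))"]) auto
  finally show ?thesis .
qed

text \<open>Compute (s_\<alpha> \<mu>, \<alpha>) twice: invariance gives -(\<mu>, \<alpha>), and
  expanding the reflection gives (\<mu>, \<alpha>) - Re \<mu>(\<open>co \<alpha>\<close>) (\<alpha>,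
  \<alpha>).\<close>

lemma form_root:
  assumes "\<alpha> \<in> R" "\<mu> \<in> V"
  shows "2 * form \<mu> \<alpha> = Re (\<mu> (co \<alpha>)) * form \<alpha> \<alpha>"
proof -
  have "form (refl \<alpha> \<mu>) \<alpha> = form \<mu> (refl \<alpha> \<alpha>)"
    using form_refl[OF assms(1) assms(2) root_in_V[OF refl_root[OF assms(1,1)]]] refl_refl[OF assms(1)] by simp
  then have "form (refl \<alpha> \<mu>) \<alpha> = - form \<mu> \<alpha>" using refl_self[OF assms(1)] form_minus_right by simp
  moreover have "form (refl \<alpha> \<mu>) \<alpha> = form \<mu> \<alpha> - Re (\<mu> (co \<alpha>)) * form \<alpha> \<alpha>"
  proof -
    \<comment> \<open>Real parts are not multiplicative; the product splits here because
      \<alpha>(\<open>co \<beta>\<close>) is an integer.\<close>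
    have "Re (refl \<alpha> \<mu> (co \<beta>)) = Re (\<mu> (co \<beta>)) - Re (\<mu> (co \<alpha>)) * Re (\<alpha> (co \<beta>))" if b: "\<beta> \<in> R" for \<beta>
    proof -
      obtain k where "\<alpha> (co \<beta>) = of_int k" using co_int[OF b assms(1)] by (auto elim: Ints_cases)
      then show ?thesis by (simp add: refl_def)
    qed
    then have "form (refl \<alpha> \<mu>) \<alpha> =
        (\<Sum>\<beta>\<in>R. (Re (\<mu> (co \<beta>)) - Re (\<mu> (co \<alpha>)) * Re (\<alpha> (co \<beta>))) * Re (\<alpha> (co \<beta>)))"
      unfolding form_def by (intro sum.cong) auto
    then show ?thesis by (simp add: form_def algebra_simps sum_subtractf sum_distrib_left)
  qed
  ultimately show ?thesis by simp
qed

section \<open>Words in reflections and generation by simple reflections\<close>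

text \<open>The head of the word acts last, which matches the order of the product in
  \<open>weyl_length\<close>.\<close>

abbreviation act :: "('h \<Rightarrow> complex) list \<Rightarrow> ('h \<Rightarrow> complex) \<Rightarrow> 'h \<Rightarrow> complex" where
  "act as \<mu> \<equiv> foldr refl as \<mu>"

lemma act_add: "act as (\<mu> + \<nu>) = act as \<mu> + act as \<nu>"
  and act_minus: "act as (- \<mu>) = - act as \<mu>"
  and act_0: "act as 0 = 0"
  by (induction as) (auto simp: refl_add refl_minus refl_0)

lemma act_sum: "act as (sum f A) = (\<Sum>a\<in>A. act as (f a))"
  by (induction A rule: infinite_finite_induct)
    (simp_all only: sum.infinite sum.empty sum.insert act_add act_0 not_False_eq_True)

lemma act_rev: "set as \<subseteq> R \<Longrightarrow> act (rev as) (act as \<mu>) = \<mu>" "set as \<subseteq> R \<Longrightarrow> act as (act (rev as) \<mu>) = \<mu>"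
  by (induction as arbitrary: \<mu>) (auto simp: refl_refl)

lemma act_root: "set as \<subseteq> R \<Longrightarrow> \<beta> \<in> R \<Longrightarrow> act as \<beta> \<in> R"
  by (induction as) (auto intro: refl_root)

lemma act_in_V: "set as \<subseteq> R \<Longrightarrow> \<mu> \<in> V \<Longrightarrow> act as \<mu> \<in> V"
  by (induction as) (auto intro: refl_in_V)

lemma form_act: "set as \<subseteq> R \<Longrightarrow> \<mu> \<in> V \<Longrightarrow> \<nu> \<in> V \<Longrightarrow> form (act as \<mu>) (act as \<nu>) = form \<mu> \<nu>"
  by (induction as) (auto simp: form_refl act_in_V)

lemma height_add: "\<mu> \<in> V \<Longrightarrow> \<nu> \<in> V \<Longrightarrow> height (\<mu> + \<nu>) = height \<mu> + height \<nu>"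
  by (simp add: height_def fn.representation_add[OF base_independent] sum.distrib)

lemma height_0: "height 0 = 0"
  by (simp only: height_def fn.representation_zero sum.neutral_const)

lemma height_diff: "\<mu> \<in> V \<Longrightarrow> \<nu> \<in> V \<Longrightarrow> height (\<mu> - \<nu>) = height \<mu> - height \<nu>"
  by (simp add: height_def fn.representation_diff[OF base_independent] sum_subtractf)

lemma height_scale_base: "a \<in> \<pi> \<Longrightarrow> height (\<lambda>x. c * a x) = c"
  using finite_base
  by (simp add: height_def fn.representation_scale[OF base_independent] fn.span_base
      fn.representation_basis[OF base_independent] if_distrib[of "\<lambda>x. c * x"] cong: if_cong)

lemma height_pos: "\<beta> \<in> pos \<Longrightarrow> \<exists>n>0. height \<beta> = of_nat n"
  unfolding height_def using root_nonzero by (intro nat_span_height base_independent finite_base) (auto simp: pos_def)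

text \<open>Induction on the height. A positive root \<alpha> that is not simple has (\<alpha>, a) >
  0 for some simple a; then s_a \<alpha> is positive of smaller height, and conjugating its
  reflection by s_a gives s_\<alpha>. Agreement is claimed on \<open>V\<close>, where
  \<open>refl_conj\<close> holds.\<close>

lemma refl_eq_act_pos:
  assumes "\<alpha> \<in> pos"
  shows "\<exists>as. set as \<subseteq> \<pi> \<and> (\<forall>\<mu>\<in>V. refl \<alpha> \<mu> = act as \<mu>)"
proof -
  have "\<exists>as. set as \<subseteq> \<pi> \<and> (\<forall>\<mu>\<in>V. refl \<alpha> \<mu> = act as \<mu>)" if "\<alpha> \<in> pos" "height \<alpha> = of_nat n" for n \<alpha>
    using that
  proof (induction n arbitrary: \<alpha> rule: less_induct)
    case (less n)
    have aR: "\<alpha> \<in> R" using less.prems pos_subset by auto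
    show ?case
    proof (cases "\<alpha> \<in> \<pi>")
      case True
      then show ?thesis by (intro exI[of _ "[\<alpha>]"]) auto
    next
      case False
      \<comment> \<open>Otherwise (\<alpha>, \<alpha>), a nonnegative combination of the numbers
        (\<alpha>, a), would not be positive.\<close>
      have "\<exists>a\<in>\<pi>. form \<alpha> a > 0"
      proof (rule ccontr)
        assume *: "\<not> ?thesis"
        obtain m where m: "\<And>a. coefficient \<pi> \<alpha> a = of_nat (m a)" using pos_coefficient less.prems by metis
        have "form \<alpha> \<alpha> = form \<alpha> (\<Sum>a\<in>\<pi>. (\<lambda>x. of_nat (m a) * a x))"
          using expand[OF pos_in_V[OF less.prems(1)]] unfolding m by simp
        also have "\<dots> = (\<Sum>a\<in>\<pi>. of_nat (m a) * form \<alpha> a)" by (simp add: form_sum_right form_nat_scale)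
        also have "\<dots> \<le> 0" using * by (intro sum_nonpos mult_nonneg_nonpos) (auto simp: not_less)
        finally show False using form_root_pos[OF aR] by simp
      qed
      then obtain a where a: "a \<in> \<pi>" "form \<alpha> a > 0" by blast
      have aR': "a \<in> R" using a base_subset by auto
      obtain k where k: "\<alpha> (co a) = of_int k" using co_int[OF aR' aR] by (auto elim: Ints_cases)
      have "Re (\<alpha> (co a)) * form a a > 0" using form_root[OF aR' root_in_V[OF aR]] a by simp
      then have "k > 0" using form_root_pos[OF aR'] k by (simp add: zero_less_mult_iff)
      define \<gamma> where "\<gamma> = refl a \<alpha>"
      have g: "\<gamma> \<in> pos" unfolding \<gamma>_def using less.prems(1) a False by (intro refl_simple_pos) auto
      have gR: "\<gamma> \<in> R" using g pos_subset by auto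
      obtain j where j: "height \<gamma> = of_nat j" using height_pos[OF g] by blast
      have "\<gamma> = \<alpha> - (\<lambda>x. of_int k * a x)" by (auto simp: \<gamma>_def refl_def k fun_eq_iff)
      then have "height \<gamma> = height \<alpha> - of_int k"
        using height_diff[OF root_in_V[OF aR] fn.span_scale[OF fn.span_base[OF a(1)]]] height_scale_base[OF a(1)] by simp
      then have "of_int (int j) = (of_int (int n - k) :: complex)" using j less.prems(2) by simp
      then have "int j = int n - k" by (simp only: of_int_eq_iff)
      then have "j < n" using \<open>k > 0\<close> by simp
      from less.IH[OF this g j] obtain as where as: "set as \<subseteq> \<pi>" "\<forall>\<mu>\<in>V. refl \<gamma> \<mu> = act as \<mu>" by blast
      have "refl \<alpha> \<mu> = act (a # as @ [a]) \<mu>" if "\<mu> \<in> V" for \<mu>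
        using refl_conj[OF aR' gR that] as refl_in_V[OF aR' that] refl_refl[OF aR'] by (simp add: \<gamma>_def)
      then show ?thesis using as a by (intro exI[of _ "a # as @ [a]"]) auto
    qed
  qed
  then show ?thesis using assms height_pos by blast
qed

lemma refl_eq_act:
  assumes "\<alpha> \<in> R"
  shows "\<exists>as. set as \<subseteq> \<pi> \<and> (\<forall>\<mu>\<in>V. refl \<alpha> \<mu> = act as \<mu>)"
proof -
  \<comment> \<open>Conjugating s_\<alpha> by itself gives the reflection in s_\<alpha> \<alpha> =
    -\<alpha>.\<close>
  have "refl (- \<alpha>) \<mu> = refl \<alpha> \<mu>" if "\<mu> \<in> V" for \<mu>
    using refl_conj[OF assms assms that] refl_self[OF assms] refl_refl[OF assms] by simp
  then show ?thesis using root_cases[OF assms] refl_eq_act_pos by metis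
qed

section \<open>Inversions, the exchange property and length\<close>

text \<open>With w the action of the word, these are the positive roots made negative by the inverse
  of w; they depend only on w restricted to \<open>V\<close>.\<close>

definition inversions :: "('h \<Rightarrow> complex) list \<Rightarrow> ('h \<Rightarrow> complex) set" where
  "inversions as = {\<beta> \<in> pos. - \<beta> \<in> act as ` pos}"

lemma inversions_subset: "inversions as \<subseteq> pos" by (auto simp: inversions_def)

lemma finite_inversions: "finite (inversions as)" using finite_pos inversions_subset finite_subset by blast

text \<open>Multiplication by s_\<beta> deletes one letter. If \<beta> is the head, delete the head;
  otherwise s_a \<beta> is an inversion of the tail, and s_\<beta> s_a = s_a s_{s_a \<beta>} moves
  the deletion there.\<close>

lemma exchange:
  assumes "set as \<subseteq> \<pi>" "\<beta> \<in> inversions as"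
  shows "\<exists>bs. set bs \<subseteq> \<pi> \<and> length as = Suc (length bs) \<and> (\<forall>\<mu>\<in>V. act bs \<mu> = refl \<beta> (act as \<mu>))"
  using assms
proof (induction as arbitrary: \<beta>)
  case Nil
  then show ?case using pos_not_neg by (auto simp: inversions_def)
next
  case (Cons a as)
  have aR: "a \<in> R" and asR: "set as \<subseteq> R" using Cons.prems base_subset by auto
  show ?case
  proof (cases "\<beta> = a")
    case True
    then show ?thesis using Cons.prems refl_refl[OF aR] by (intro exI[of _ as]) auto
  next
    case False
    obtain \<gamma> where g: "\<gamma> \<in> pos" "- \<beta> = refl a (act as \<gamma>)" using Cons.prems(2) by (auto simp: inversions_def)
    have b: "\<beta> \<in> pos" using Cons.prems(2) by (simp add: inversions_def)
    have bR: "\<beta> \<in> R" using b pos_subset by auto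
    have "refl a (- \<beta>) = act as \<gamma>" using g refl_refl[OF aR] by simp
    then have "- refl a \<beta> = act as \<gamma>" by (simp add: refl_minus)
    then have "refl a \<beta> \<in> inversions as"
      using g(1) refl_simple_pos[of a \<beta>] Cons.prems(1) b False by (auto simp: inversions_def)
    from Cons.IH[OF _ this] Cons.prems(1) obtain bs where bs: "set bs \<subseteq> \<pi>" "length as = Suc (length bs)"
      "\<forall>\<mu>\<in>V. act bs \<mu> = refl (refl a \<beta>) (act as \<mu>)" by auto
    have "act (a # bs) \<mu> = refl \<beta> (act (a # as) \<mu>)" if "\<mu> \<in> V" for \<mu>
    proof -
      have v: "refl a (act as \<mu>) \<in> V" using that asR aR by (intro refl_in_V act_in_V)
      show ?thesis
        using refl_conj[OF aR refl_root[OF aR bR] v] refl_refl[OF aR] bs(3) that by simp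
    qed
    then show ?thesis using bs Cons.prems by (intro exI[of _ "a # bs"]) auto
  qed
qed

definition reduced_word :: "('h \<Rightarrow> complex) list \<Rightarrow> bool" where
  "reduced_word as \<longleftrightarrow> set as \<subseteq> \<pi> \<and>
     (\<forall>bs. set bs \<subseteq> \<pi> \<and> (\<forall>\<mu>\<in>V. act bs \<mu> = act as \<mu>) \<longrightarrow> length as \<le> length bs)"

text \<open>The head a of a reduced word is not an inversion of the tail, or the exchange property
  would shorten the word. Hence s_a maps the inversions of the tail injectively to inversions of the
  word, and a itself is the one new inversion.\<close>

lemma card_inversions:
  assumes "reduced_word as"
  shows "card (inversions as) = length as"
  using assms
proof (induction as)
  case Nil
  have "inversions [] = {}" using pos_not_neg by (auto simp: inversions_def)
  then show ?case by simp
next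
  case (Cons a as)
  have sub: "set as \<subseteq> \<pi>" "a \<in> \<pi>" using Cons.prems by (auto simp: reduced_word_def)
  have aR: "a \<in> R" and asR: "set as \<subseteq> R" using sub base_subset by auto
  have "reduced_word as"
    unfolding reduced_word_def
  proof (intro conjI allI impI sub, elim conjE)
    fix bs assume bs: "set bs \<subseteq> \<pi>" "\<forall>\<mu>\<in>V. act bs \<mu> = act as \<mu>"
    then have "length (a # as) \<le> length (a # bs)"
      using Cons.prems unfolding reduced_word_def by (elim conjE allE[of _ "a # bs"]) auto
    then show "length as \<le> length bs" by simp
  qed
  then have IH: "card (inversions as) = length as" by (rule Cons.IH)
  have notin: "a \<notin> inversions as"
  proof
    assume "a \<in> inversions as"
    from exchange[OF sub(1) this] obtain bs where bs: "set bs \<subseteq> \<pi>" "length as = Suc (length bs)"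
      "\<forall>\<mu>\<in>V. act bs \<mu> = act (a # as) \<mu>" by auto
    then have "length (a # as) \<le> length bs" using Cons.prems unfolding reduced_word_def by blast
    then show False using bs(2) by simp
  qed
  \<comment> \<open>The inverse of the tail sends a to a positive root, which the whole word maps to
    -a; this makes a an inversion of the word.\<close>
  have "act (rev as) a \<in> R" using act_root[of "rev as" a] asR aR by simp
  then have "act (rev as) a \<in> pos \<or> - act (rev as) a \<in> pos" by (rule root_cases)
  moreover have "- act (rev as) a \<notin> pos"
  proof
    assume "- act (rev as) a \<in> pos"
    moreover have "act as (- act (rev as) a) = - a" using act_rev(2)[OF asR] by (simp add: act_minus)
    ultimately show False using notin base_pos[OF sub(2)] by (auto simp: inversions_def intro!: image_eqI[of "- a"])
  qed
  ultimately have apos: "act (rev as) a \<in> pos" by blast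
  have "inversions (a # as) = insert a (refl a ` inversions as)"
  proof (intro equalityI subsetI)
    fix \<beta> assume "\<beta> \<in> inversions (a # as)"
    then obtain \<gamma> where g: "\<gamma> \<in> pos" "- \<beta> = refl a (act as \<gamma>)" and b: "\<beta> \<in> pos" by (auto simp: inversions_def)
    have "refl a (- \<beta>) = act as \<gamma>" using g refl_refl[OF aR] by simp
    then have "- refl a \<beta> = act as \<gamma>" by (simp add: refl_minus)
    then have "\<beta> \<noteq> a \<Longrightarrow> refl a \<beta> \<in> inversions as"
      using g(1) refl_simple_pos[of a \<beta>] sub b by (auto simp: inversions_def)
    moreover have "\<beta> = refl a (refl a \<beta>)" using refl_refl[OF aR] by simp
    ultimately show "\<beta> \<in> insert a (refl a ` inversions as)" by blast
  next
    fix \<beta> assume "\<beta> \<in> insert a (refl a ` inversions as)"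
    then consider "\<beta> = a" | \<delta> where "\<delta> \<in> inversions as" "\<beta> = refl a \<delta>" by blast
    then show "\<beta> \<in> inversions (a # as)"
    proof cases
      case 1
      have "act (a # as) (act (rev as) a) = - a" using act_rev(2)[OF asR] refl_self[OF aR] by simp
      then show ?thesis using 1 apos base_pos[OF sub(2)] by (auto simp: inversions_def simp del: foldr.simps intro!: image_eqI[of "- a"])
    next
      case 2
      then obtain \<gamma> where g: "\<gamma> \<in> pos" "- \<delta> = act as \<gamma>" "\<delta> \<in> pos" by (auto simp: inversions_def)
      have "act (a # as) \<gamma> = - \<beta>" using g 2 by (simp add: refl_minus flip: g(2))
      moreover have "\<beta> \<in> pos" using 2 g(3) notin refl_simple_pos sub by metis
      ultimately show ?thesis using g(1) unfolding inversions_def mem_Collect_eq by (metis image_eqI)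
    qed
  qed
  moreover have "a \<notin> refl a ` inversions as"
  proof
    assume "a \<in> refl a ` inversions as"
    then obtain \<delta> where d: "\<delta> \<in> inversions as" "a = refl a \<delta>" by blast
    then have "\<delta> = - a" using refl_refl[OF aR, of \<delta>] refl_self[OF aR] by simp
    then show False using d(1) inversions_subset pos_not_neg[OF base_pos[OF sub(2)]] by auto
  qed
  moreover have "inj (refl a)" using refl_refl[OF aR] by (metis injI)
  ultimately show ?case
    using IH finite_inversions by (simp add: card_image inj_on_subset)
qed

lemma exists_reduced_word:
  assumes "set as \<subseteq> \<pi>"
  shows "\<exists>bs. reduced_word bs \<and> (\<forall>\<mu>\<in>V. act bs \<mu> = act as \<mu>)"
proof -
  obtain bs where "set bs \<subseteq> \<pi> \<and> (\<forall>\<mu>\<in>V. act bs \<mu> = act as \<mu>)"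
      and "\<And>cs. set cs \<subseteq> \<pi> \<and> (\<forall>\<mu>\<in>V. act cs \<mu> = act as \<mu>) \<Longrightarrow> length bs \<le> length cs"
    using ex_has_least_nat[of "\<lambda>bs. set bs \<subseteq> \<pi> \<and> (\<forall>\<mu>\<in>V. act bs \<mu> = act as \<mu>)" as length] assms by blast
  then show ?thesis by (intro exI[of _ bs]) (auto simp: reduced_word_def)
qed

lemma inversions_cong: "(\<And>\<mu>. \<mu> \<in> V \<Longrightarrow> act bs \<mu> = act as \<mu>) \<Longrightarrow> inversions bs = inversions as"
  using pos_in_V by (auto simp: inversions_def image_iff)

text \<open>A reduced word with the same action has as many letters as inversions, so it is
  empty.\<close>

lemma act_eq_id_if_no_inversions:
  assumes "set as \<subseteq> \<pi>" "inversions as = {}" "\<mu> \<in> V"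
  shows "act as \<mu> = \<mu>"
proof -
  obtain bs where bs: "reduced_word bs" "\<forall>\<mu>\<in>V. act bs \<mu> = act as \<mu>" using exists_reduced_word[OF assms(1)] by blast
  then have "inversions bs = {}" using inversions_cong[of bs as] assms(2) by simp
  then have "bs = []" using card_inversions[OF bs(1)] by simp
  then show ?thesis using bs(2) assms(3) by simp
qed

text \<open>To avoid halving, the sum \<open>2\<rho>\<close> of all positive roots is used in place of \<open>\<rho>\<close>.\<close>

definition two_rho :: "'h \<Rightarrow> complex" where "two_rho = \<Sum>pos"

lemma two_rho_in_V: "two_rho \<in> V"
  unfolding two_rho_def by (intro fn.span_sum pos_in_V)

text \<open>The image of the positive roots under w consists of the positive roots outside the
  inversion set and the negatives of those inside.\<close>

lemma act_two_rho:
  assumes "set as \<subseteq> \<pi>"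
  shows "act as two_rho = two_rho - (\<Sum>(inversions as) + \<Sum>(inversions as))"
proof -
  have asR: "set as \<subseteq> R" using assms base_subset by auto
  have inj: "inj_on (act as) A" for A using act_rev(1)[OF asR] by (metis inj_onI)
  have "act as two_rho = (\<Sum>\<beta>\<in>pos. act as \<beta>)" by (simp add: two_rho_def act_sum)
  also have "\<dots> = \<Sum>(act as ` pos)" by (simp add: sum.reindex[OF inj])
  also have "act as ` pos = (pos - inversions as) \<union> uminus ` inversions as"
  proof (intro equalityI subsetI)
    fix \<gamma> assume g: "\<gamma> \<in> act as ` pos"
    then have "\<gamma> \<in> R" using act_root[OF asR] pos_subset by auto
    have "- \<gamma> \<notin> act as ` pos"
    proof
      assume "- \<gamma> \<in> act as ` pos"
      then obtain \<delta> \<eta> where "\<delta> \<in> pos" "\<eta> \<in> pos" "act as \<delta> = - act as \<eta>" using g by fastforce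
      then have "\<delta> = - \<eta>" using act_rev(1)[OF asR, of \<delta>] act_rev(1)[OF asR, of \<eta>] by (simp add: act_minus)
      then show False using \<open>\<delta> \<in> pos\<close> \<open>\<eta> \<in> pos\<close> pos_not_neg by auto
    qed
    then have "\<gamma> \<in> pos \<Longrightarrow> \<gamma> \<in> pos - inversions as" by (auto simp: inversions_def)
    moreover have "- \<gamma> \<in> pos \<Longrightarrow> - \<gamma> \<in> inversions as" using g by (auto simp: inversions_def)
    ultimately show "\<gamma> \<in> (pos - inversions as) \<union> uminus ` inversions as"
      using root_cases[OF \<open>\<gamma> \<in> R\<close>] by (metis UnI1 UnI2 image_eqI minus_minus)
  next
    fix \<gamma> assume "\<gamma> \<in> (pos - inversions as) \<union> uminus ` inversions as"
    then consider "\<gamma> \<in> pos" "\<gamma> \<notin> inversions as" | "- \<gamma> \<in> inversions as" by force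
    then show "\<gamma> \<in> act as ` pos"
    proof cases
      case 1
      have "act (rev as) \<gamma> \<in> R" using act_root[of "rev as"] asR 1 pos_subset by auto
      moreover have "- act (rev as) \<gamma> \<notin> pos"
      proof
        assume "- act (rev as) \<gamma> \<in> pos"
        moreover have "- \<gamma> = act as (- act (rev as) \<gamma>)" using act_rev(2)[OF asR] by (simp add: act_minus)
        ultimately show False using 1 by (auto simp: inversions_def)
      qed
      ultimately have "act (rev as) \<gamma> \<in> pos" using root_cases by blast
      then show ?thesis using act_rev(2)[OF asR, of \<gamma>] by (metis image_eqI)
    qed (auto simp: inversions_def)
  qed
  also have "\<Sum>((pos - inversions as) \<union> uminus ` inversions as) = \<Sum>(pos - inversions as) + \<Sum>(uminus ` inversions as)"
    using finite_pos finite_inversions pos_not_neg inversions_subset by (intro sum.union_disjoint) fastforce+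
  also have "\<Sum>(pos - inversions as) = two_rho - \<Sum>(inversions as)"
    unfolding two_rho_def using finite_pos inversions_subset by (intro sum_diff) auto
  also have "\<Sum>(uminus ` inversions as) = - \<Sum>(inversions as)"
    by (subst sum.reindex) (auto simp: sum_negf)
  finally show ?thesis by (simp only: fun_eq_iff plus_fun_apply minus_apply uminus_apply) (simp add: algebra_simps)
qed

text \<open>The only inversion of s_a is a, so s_a moves 2\<rho> by -2a. Hence 2\<rho> has the value
  2 at the coroot of a, and \<open>form_root\<close> gives (2\<rho>, a) = (a, a).\<close>

lemma form_two_rho_nonneg:
  assumes "\<beta> \<in> pos"
  shows "form two_rho \<beta> \<ge> 0"
proof -
  have simple: "form two_rho a \<ge> 0" if a: "a \<in> \<pi>" for a
  proof -
    have aR: "a \<in> R" using a base_subset by auto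
    have "inversions [a] = {a}"
    proof
      show "{a} \<subseteq> inversions [a]" using base_pos[OF a] refl_self[OF aR] by (auto simp: inversions_def intro!: image_eqI[of _ _ a])
      show "inversions [a] \<subseteq> {a}"
      proof
        fix \<beta> assume "\<beta> \<in> inversions [a]"
        then obtain \<gamma> where "\<gamma> \<in> pos" "- \<beta> = refl a \<gamma>" "\<beta> \<in> pos" by (auto simp: inversions_def)
        then show "\<beta> \<in> {a}" using refl_simple_pos[OF a] pos_not_neg refl_self[OF aR] by (metis minus_equation_iff singletonI)
      qed
    qed
    then have "refl a two_rho = two_rho - (a + a)" using act_two_rho[of "[a]"] a by simp
    \<comment> \<open>The reflection negates the value at \<open>co a\<close>, so that value v
      satisfies -v = v - 4.\<close>
    then have "refl a two_rho (co a) = two_rho (co a) - 4" using co_self[OF aR] by simp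
    then have "two_rho (co a) = 2" using co_self[OF aR] by (simp add: refl_def)
    then show ?thesis using form_root[OF aR two_rho_in_V] form_root_pos[OF aR] by simp
  qed
  obtain m where m: "\<And>a. coefficient \<pi> \<beta> a = of_nat (m a)" using pos_coefficient assms by metis
  have "form two_rho \<beta> = form two_rho (\<Sum>a\<in>\<pi>. (\<lambda>x. of_nat (m a) * a x))"
    using expand[OF pos_in_V[OF assms]] unfolding m by simp
  also have "\<dots> = (\<Sum>a\<in>\<pi>. of_nat (m a) * form two_rho a)" by (simp add: form_sum_right form_nat_scale)
  also have "\<dots> \<ge> 0" using simple by (intro sum_nonneg) auto
  finally show ?thesis .
qed

text \<open>The left side is the pairing with the dual analogue of 2\<rho>. Reflection in a simple
  root a permutes the other positive roots and negates a, so only the summand a(\<open>co a\<close>)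
  = 2 remains; the general case follows by expansion in the base.\<close>

lemma sum_coroots:
  assumes "\<mu> \<in> V"
  shows "(\<Sum>\<beta>\<in>pos. \<mu> (co \<beta>)) = 2 * height \<mu>"
proof -
  have simple: "(\<Sum>\<beta>\<in>pos. a (co \<beta>)) = 2" if a: "a \<in> \<pi>" for a
  proof -
    have aR: "a \<in> R" using a base_subset by auto
    have "(\<Sum>\<beta>\<in>pos - {a}. a (co \<beta>)) = (\<Sum>\<beta>\<in>pos - {a}. - a (co \<beta>))"
    proof (rule sum.reindex_bij_witness[of _ "refl a" "refl a"])
      fix \<beta> assume b: "\<beta> \<in> pos - {a}"
      have "refl a \<beta> \<noteq> a"
      proof
        assume "refl a \<beta> = a"
        then have "\<beta> = - a" using refl_refl[OF aR, of \<beta>] refl_self[OF aR] by simp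
        then show False using b pos_not_neg[OF base_pos[OF a]] by auto
      qed
      then show "refl a \<beta> \<in> pos - {a}" "refl a \<beta> \<in> pos - {a}" using b refl_simple_pos[OF a] by auto
      show "refl a (refl a \<beta>) = \<beta>" "refl a (refl a \<beta>) = \<beta>" using refl_refl[OF aR] by auto
      have "a (co (refl a \<beta>)) = refl a a (co \<beta>)" using b pos_subset aR by (intro coroot_refl root_in_V) auto
      then show "- a (co (refl a \<beta>)) = a (co \<beta>)" using refl_self[OF aR] by simp
    qed
    then have "(\<Sum>\<beta>\<in>pos - {a}. a (co \<beta>)) = 0" by (simp add: sum_negf)
    then show ?thesis using sum.remove[OF finite_pos base_pos[OF a], of "\<lambda>\<beta>. a (co \<beta>)"] co_self[OF aR] by simp
  qed
  have "(\<Sum>\<beta>\<in>pos. \<mu> (co \<beta>)) = (\<Sum>\<beta>\<in>pos. \<Sum>a\<in>\<pi>. coefficient \<pi> \<mu> a * a (co \<beta>))"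
  proof (rule sum.cong[OF refl])
    fix \<beta> 
    have "\<mu> (co \<beta>) = (\<Sum>a\<in>\<pi>. (\<lambda>x. coefficient \<pi> \<mu> a * a x)) (co \<beta>)" using expand[OF assms] by simp
    also have "\<dots> = (\<Sum>a\<in>\<pi>. coefficient \<pi> \<mu> a * a (co \<beta>))"
      by (simp only: sum_apply)
    finally show "\<mu> (co \<beta>) = (\<Sum>a\<in>\<pi>. coefficient \<pi> \<mu> a * a (co \<beta>))" .
  qed
  also have "\<dots> = (\<Sum>a\<in>\<pi>. coefficient \<pi> \<mu> a * (\<Sum>\<beta>\<in>pos. a (co \<beta>)))"
    by (subst sum.swap) (simp add: sum_distrib_left)
  also have "\<dots> = 2 * height \<mu>" by (simp add: simple height_def sum_distrib_left mult.commute)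
  finally show ?thesis .
qed

lemma sum_list_pos_in_V: "set \<gamma>s \<subseteq> pos \<Longrightarrow> sum_list \<gamma>s \<in> V"
  by (intro sum_list_closed[of "\<lambda>x. x \<in> V"]) (auto intro: fn.span_add fn.span_zero pos_in_V)

text \<open>The bound makes height 0 a test for the empty list, since each positive root has height
  at least 1.\<close>

lemma height_sum_list_pos:
  assumes "set \<gamma>s \<subseteq> pos"
  shows "\<exists>n. height (sum_list \<gamma>s) = of_nat n \<and> length \<gamma>s \<le> n"
  using assms
proof (induction \<gamma>s)
  case Nil
  then show ?case by (intro exI[of _ 0]) (simp only: sum_list.Nil height_0 of_nat_0 list.size le_refl simp_thms)
next
  case (Cons \<gamma> \<gamma>s)
  then obtain n where "height (sum_list \<gamma>s) = of_nat n" "length \<gamma>s \<le> n" by auto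
  moreover obtain m where "height \<gamma> = of_nat m" "m > 0" using height_pos[of \<gamma>] Cons.prems by auto
  moreover have "sum_list \<gamma>s \<in> V" using Cons.prems sum_list_pos_in_V by simp
  moreover have "\<gamma> \<in> V" using Cons.prems pos_in_V by simp
  ultimately have "height (sum_list (\<gamma> # \<gamma>s)) = of_nat (m + n)" "length (\<gamma> # \<gamma>s) \<le> m + n"
    unfolding sum_list.Cons of_nat_add by (simp_all only: height_add) simp
  then show ?case by blast
qed

lemma sum_list_pos_eq_0: "set \<gamma>s \<subseteq> pos \<Longrightarrow> height (sum_list \<gamma>s) = 0 \<Longrightarrow> \<gamma>s = []"
  using height_sum_list_pos[of \<gamma>s] by auto

text \<open>The stabilizer of 2\<rho> is trivial: if w fixes 2\<rho>, the sum of its inversions is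
  0, so it has height 0 and no summands.\<close>

lemma act_eq_if_two_rho_eq:
  assumes "set as \<subseteq> \<pi>" "set bs \<subseteq> \<pi>" "act as two_rho = act bs two_rho" "\<mu> \<in> V"
  shows "act as \<mu> = act bs \<mu>"
proof -
  define cs where "cs = rev bs @ as"
  have R: "set as \<subseteq> R" "set bs \<subseteq> R" using assms base_subset by auto
  have cs: "set cs \<subseteq> \<pi>" using assms by (auto simp: cs_def)
  have "act cs two_rho = two_rho" using assms act_rev(1)[OF R(2)] by (simp add: cs_def)
  then have "\<Sum>(inversions cs) + \<Sum>(inversions cs) = 0" using act_two_rho[OF cs] by (simp add: algebra_simps)
  then have "2 * \<Sum>(inversions cs) x = 0" for x by (metis mult_2 plus_fun_apply zero_fun_apply)
  then have 0: "\<Sum>(inversions cs) = 0" by (auto simp: fun_eq_iff)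
  obtain \<gamma>s where gs: "set \<gamma>s = inversions cs" "distinct \<gamma>s"
    using finite_distinct_list[OF finite_inversions] by blast
  then have "sum_list \<gamma>s = 0" using 0 by (simp add: distinct_sum_list_conv_Sum)
  then have "height (sum_list \<gamma>s) = 0" by (simp only: height_0)
  then have "\<gamma>s = []" using gs inversions_subset by (intro sum_list_pos_eq_0) auto
  then have "inversions cs = {}" using gs by simp
  from act_eq_id_if_no_inversions[OF cs this assms(4)] have "act (rev bs) (act as \<mu>) = \<mu>" by (simp add: cs_def)
  then show ?thesis using act_rev(2)[OF R(2), of "act as \<mu>"] by simp
qed

text \<open>The relation w_1 \<rho> = w_2 \<rho> + \<gamma> appears doubled. The summands of
  \<gamma> are also images of positive roots under w_2, which gives (w_2 \<rho>, \<gamma>) \<ge> 0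
  and lets the comparison of norms conclude.\<close>

lemma act_eq_if_difference_dominated:
  assumes as: "set as \<subseteq> \<pi>" and bs: "set bs \<subseteq> \<pi>"
    and eq: "act as two_rho = act bs two_rho + (sum_list \<gamma>s + sum_list \<gamma>s)"
    and pos: "set \<gamma>s \<subseteq> pos" "set \<gamma>s \<subseteq> act bs ` pos" and "\<mu> \<in> V"
  shows "act as \<mu> = act bs \<mu>"
proof -
  have R: "set as \<subseteq> R" "set bs \<subseteq> R" using assms base_subset by auto
  define \<gamma> where "\<gamma> = sum_list \<gamma>s"
  have gV: "\<gamma> \<in> V" unfolding \<gamma>_def by (rule sum_list_pos_in_V[OF pos(1)])
  have ge: "form (act bs two_rho) \<gamma> \<ge> 0"
    unfolding \<gamma>_def
  proof (rule sum_list_closed[of "\<lambda>x. form (act bs two_rho) x \<ge> 0"])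
    fix x assume "x \<in> set \<gamma>s"
    then obtain \<delta> where "\<delta> \<in> pos" "x = act bs \<delta>" using pos by auto
    then show "form (act bs two_rho) x \<ge> 0"
      using form_act[OF R(2) two_rho_in_V pos_in_V] form_two_rho_nonneg by simp
  qed (auto simp: form_add_right)
  have "form two_rho two_rho = form (act as two_rho) (act as two_rho)"
    using form_act[OF R(1) two_rho_in_V two_rho_in_V] by simp
  also have "\<dots> = form (act bs two_rho) (act bs two_rho) + 4 * form (act bs two_rho) \<gamma> + 4 * form \<gamma> \<gamma>"
    unfolding eq \<gamma>_def[symmetric] form_add_left form_add_right
    using form_sym[of \<gamma> "act bs two_rho"] by simp
  also have "form (act bs two_rho) (act bs two_rho) = form two_rho two_rho"
    using form_act[OF R(2) two_rho_in_V two_rho_in_V] by simp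
  finally have "form \<gamma> \<gamma> = 0" using ge form_nonneg[of \<gamma>] by simp
  then have 0: "\<forall>\<beta>\<in>R. Re (\<gamma> (co \<beta>)) = 0"
    unfolding form_def using finite_R by (subst (asm) sum_nonneg_eq_0_iff) auto
  \<comment> \<open>Norm 0 kills only real parts; the values of \<gamma> at coroots are integers, so
    they vanish, and with them the sum over the positive coroots, which is twice the height.\<close>
  have "\<gamma> (co \<beta>) = 0" if "\<beta> \<in> R" for \<beta>
  proof -
    have "\<gamma> (co \<beta>) \<in> \<int>" unfolding \<gamma>_def
      using pos pos_subset co_int[OF that] by (intro sum_list_closed[of "\<lambda>x. x (co \<beta>) \<in> \<int>"]) auto
    then show ?thesis using 0 that by (auto elim!: Ints_cases)
  qed
  then have "height \<gamma> = 0" using sum_coroots[OF gV] pos_subset by (simp add: subset_iff)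
  then have "\<gamma>s = []" unfolding \<gamma>_def using sum_list_pos_eq_0 pos by blast
  then have "act as two_rho = act bs two_rho" using eq by simp
  then show ?thesis using act_eq_if_two_rho_eq as bs \<open>\<mu> \<in> V\<close> by blast
qed

end


section \<open>The Killing form\<close>

lemma trace_on_diff:
  assumes "lie.independent B" "\<And>b. b \<in> B \<Longrightarrow> f b \<in> lie_span B" "\<And>b. b \<in> B \<Longrightarrow> g b \<in> lie_span B"
  shows "trace_on B (\<lambda>x. f x - g x) = trace_on B f - trace_on B g"
  using assms by (simp add: trace_on_def lie.representation_diff sum_subtractf)

lemma trace_on_add:
  assumes "lie.independent B" "\<And>b. b \<in> B \<Longrightarrow> f b \<in> lie_span B" "\<And>b. b \<in> B \<Longrightarrow> g b \<in> lie_span B"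
  shows "trace_on B (\<lambda>x. f x + g x) = trace_on B f + trace_on B g"
  using assms by (simp add: trace_on_def lie.representation_add sum.distrib)

lemma trace_on_scale:
  assumes "lie.independent B" "\<And>b. b \<in> B \<Longrightarrow> f b \<in> lie_span B"
  shows "trace_on B (\<lambda>x. c *\<^sub>C f x) = c * trace_on B f"
  using assms by (simp add: trace_on_def lie.representation_scale sum_distrib_left)

context cartan
begin

section \<open>Traces on sums of weight spaces\<close>

lemma independent_UN:
  assumes L: "finite L" "L \<subseteq> dual H"
    and B: "\<And>\<nu>. \<nu> \<in> L \<Longrightarrow> finite (B \<nu>)" "\<And>\<nu>. \<nu> \<in> L \<Longrightarrow> lie.independent (B \<nu>)"
      "\<And>\<nu>. \<nu> \<in> L \<Longrightarrow> B \<nu> \<subseteq> W \<nu>"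
  shows "\<And>\<mu> \<nu>. \<mu> \<in> L \<Longrightarrow> \<nu> \<in> L \<Longrightarrow> \<mu> \<noteq> \<nu> \<Longrightarrow> B \<mu> \<inter> B \<nu> = {}"
    and "lie.independent (\<Union>\<nu>\<in>L. B \<nu>)"
proof -
  show disj: "B \<mu> \<inter> B \<nu> = {}" if "\<mu> \<in> L" "\<nu> \<in> L" "\<mu> \<noteq> \<nu>" for \<mu> \<nu>
  proof (rule ccontr)
    assume "B \<mu> \<inter> B \<nu> \<noteq> {}"
    then obtain b where b: "b \<in> B \<mu>" "b \<in> B \<nu>" by blast
    have "b \<in> W \<mu>" "b \<in> W \<nu>" using b B(3) that by blast+
    then have "b = 0"
      by (intro weight_space_disjoint_span[of "{\<nu>}" \<mu> b]) (use that L in \<open>auto intro: lie.span_base\<close>)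
    then show False using b(1) B(2)[OF that(1)] lie.dependent_zero by blast
  qed
  show "lie.independent (\<Union>\<nu>\<in>L. B \<nu>)"
  proof (rule lie.independent_if_scalars_zero)
    show "finite (\<Union>\<nu>\<in>L. B \<nu>)" using L B by blast
    fix f x assume sum0: "(\<Sum>x\<in>(\<Union>\<nu>\<in>L. B \<nu>). f x *\<^sub>C x) = 0" and x: "x \<in> (\<Union>\<nu>\<in>L. B \<nu>)"
    have "(\<Sum>\<nu>\<in>L. \<Sum>x\<in>B \<nu>. f x *\<^sub>C x) = 0"
      using sum0 L B disj by (subst (asm) sum.UNION_disjoint) auto
    moreover have "(\<Sum>x\<in>B \<nu>. f x *\<^sub>C x) \<in> W \<nu>" if "\<nu> \<in> L" for \<nu>
      using B(3)[OF that] by (intro lie.subspace_sum lie.subspace_scale subspace_weight_space) auto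
    ultimately have "\<forall>\<nu>\<in>L. (\<Sum>x\<in>B \<nu>. f x *\<^sub>C x) = 0" by (intro weight_sum_eq_0[OF L]) auto
    then show "f x = 0" using x B(1,2) lie.independentD[of _ _ f x] by blast
  qed
qed

text \<open>In \<open>weight_space\<close> the exponent depends on the vector; the maximum over a
  finite basis serves for the whole span.\<close>

lemma uniform_nilpotent:
  assumes "finite B" "lie_span B \<subseteq> W \<nu>" "t \<in> H"
  shows "\<exists>n. \<forall>x\<in>lie_span B. (ad_shift (\<nu> t) t ^^ n) x = 0"
proof -
  have "\<forall>b\<in>B. \<exists>n. (ad_shift (\<nu> t) t ^^ n) b = 0"
    using assms lie.span_superset[of B] unfolding weight_space_def by blast
  then obtain n where n: "\<forall>b\<in>B. (ad_shift (\<nu> t) t ^^ n b) b = 0" using bchoice[of B] by metis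
  define N where "N = Max (insert 0 (n ` B))"
  have "n b \<le> N" if "b \<in> B" for b using that assms(1) by (simp add: N_def)
  then have "\<forall>b\<in>B. (ad_shift (\<nu> t) t ^^ N) b = 0" using n funpow_0_mono[OF linear_ad_shift] by blast
  moreover have "lie_subspace {x. (ad_shift (\<nu> t) t ^^ N) x = 0}"
  proof -
    interpret f: Vector_Spaces.linear scaleC scaleC "ad_shift (\<nu> t) t ^^ N" using linear_funpow linear_ad_shift .
    show ?thesis by (rule lie.subspaceI) (auto simp: f.add f.scale f.zero)
  qed
  ultimately have "lie_span B \<subseteq> {x. (ad_shift (\<nu> t) t ^^ N) x = 0}" by (intro lie.span_minimal) auto
  then show ?thesis by blast
qed

text \<open>On the sum of the \<open>U \<nu>\<close> the operator ad [x, y] is a commutator, so its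
  trace is 0; it also preserves each \<open>U \<nu>\<close>, with the single generalized eigenvalue
  \<nu>([x, y]). Proper subspaces of weight spaces are allowed because \<open>dim_opposite\<close>
  takes a single line for \<alpha>.\<close>

lemma trace_commutator_weights:
  assumes L: "finite L" "L \<subseteq> dual H"
    and U: "\<And>\<nu>. \<nu> \<in> L \<Longrightarrow> lie_subspace (U \<nu>)" "\<And>\<nu>. \<nu> \<in> L \<Longrightarrow> U \<nu> \<subseteq> W \<nu>"
    and x: "\<And>\<nu> u. \<nu> \<in> L \<Longrightarrow> u \<in> U \<nu> \<Longrightarrow> bracket x u \<in> lie_span (\<Union>\<nu>\<in>L. U \<nu>)"
    and y: "\<And>\<nu> u. \<nu> \<in> L \<Longrightarrow> u \<in> U \<nu> \<Longrightarrow> bracket y u \<in> lie_span (\<Union>\<nu>\<in>L. U \<nu>)"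
    and t: "bracket x y \<in> H" "\<And>\<nu> u. \<nu> \<in> L \<Longrightarrow> u \<in> U \<nu> \<Longrightarrow> bracket (bracket x y) u \<in> U \<nu>"
  shows "(\<Sum>\<nu>\<in>L. \<nu> (bracket x y) * of_nat (lie.dim (U \<nu>))) = 0"
proof -
  have "\<forall>\<nu>\<in>L. \<exists>B. finite B \<and> B \<subseteq> U \<nu> \<and> lie.independent B \<and> lie_span B = U \<nu>"
    using exists_finite_basis U by blast
  from bchoice[OF this] obtain B where
    B0: "\<forall>\<nu>\<in>L. finite (B \<nu>) \<and> B \<nu> \<subseteq> U \<nu> \<and> lie.independent (B \<nu>) \<and> lie_span (B \<nu>) = U \<nu>" ..
  have B: "\<And>\<nu>. \<nu> \<in> L \<Longrightarrow> finite (B \<nu>)" "\<And>\<nu>. \<nu> \<in> L \<Longrightarrow> B \<nu> \<subseteq> U \<nu>"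
      "\<And>\<nu>. \<nu> \<in> L \<Longrightarrow> lie.independent (B \<nu>)" "\<And>\<nu>. \<nu> \<in> L \<Longrightarrow> lie_span (B \<nu>) = U \<nu>"
    using B0 by simp_all
  have Bw: "B \<nu> \<subseteq> W \<nu>" if "\<nu> \<in> L" for \<nu> using B(2) U(2) that by blast
  let ?B = "\<Union>\<nu>\<in>L. B \<nu>"
  have fin: "finite ?B" using L B by blast
  have ind: "lie.independent ?B" by (rule independent_UN(2)[OF L B(1,3) Bw])
  have span: "lie_span ?B = lie_span (\<Union>\<nu>\<in>L. U \<nu>)"
  proof (rule lie.span_eq[THEN iffD2], intro conjI)
    show "?B \<subseteq> lie_span (\<Union>\<nu>\<in>L. U \<nu>)" using B(2) lie.span_superset[of "\<Union>\<nu>\<in>L. U \<nu>"] by blast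
    show "(\<Union>\<nu>\<in>L. U \<nu>) \<subseteq> lie_span ?B"
    proof (rule UN_least)
      fix \<nu> assume \<nu>: "\<nu> \<in> L"
      then have "B \<nu> \<subseteq> ?B" by blast
      from lie.span_mono[OF this] show "U \<nu> \<subseteq> lie_span ?B" unfolding B(4)[OF \<nu>] .
    qed
  qed
  have stable: "bracket z ` lie_span ?B \<subseteq> lie_span ?B" "\<And>b. b \<in> lie_span ?B \<Longrightarrow> bracket z b \<in> lie_span ?B"
    if z: "\<And>\<nu> u. \<nu> \<in> L \<Longrightarrow> u \<in> U \<nu> \<Longrightarrow> bracket z u \<in> lie_span (\<Union>\<nu>\<in>L. U \<nu>)" for z
  proof -
    have "lie_span (bracket z ` ?B) \<subseteq> lie_span ?B"
      using z B(2) span by (intro lie.span_minimal) auto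
    then show "bracket z ` lie_span ?B \<subseteq> lie_span ?B" using lie_span_image[OF linear_bracket] by metis
    then show "\<And>b. b \<in> lie_span ?B \<Longrightarrow> bracket z b \<in> lie_span ?B" by blast
  qed
  have sx: "\<And>b. b \<in> lie_span ?B \<Longrightarrow> bracket x b \<in> lie_span ?B" using stable(2)[of x] x by blast
  have sy: "\<And>b. b \<in> lie_span ?B \<Longrightarrow> bracket y b \<in> lie_span ?B" using stable(2)[of y] y by blast
  have "trace_on ?B (bracket (bracket x y)) = trace_on ?B (\<lambda>b. (bracket x \<circ> bracket y) b - (bracket y \<circ> bracket x) b)"
    by (simp add: bracket_bracket_left fun_eq_iff trace_on_def)
  also have "\<dots> = trace_on ?B (bracket x \<circ> bracket y) - trace_on ?B (bracket y \<circ> bracket x)"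
    by (intro trace_on_diff ind) (simp_all only: comp_apply sx sy lie.span_base)
  also have "trace_on ?B (bracket y \<circ> bracket x) = trace_on ?B (bracket x \<circ> bracket y)"
    by (intro trace_on_compose_commute fin ind linear_bracket stable(1) x y)
  finally have "trace_on ?B (bracket (bracket x y)) = 0" by (simp add: comp_def)
  moreover have "trace_on ?B (bracket (bracket x y)) = (\<Sum>\<nu>\<in>L. trace_on (B \<nu>) (bracket (bracket x y)))"
  proof (intro trace_on_UN L(1) ind independent_UN(1)[OF L B(1,3) Bw] B(1))
    fix \<nu> b assume b: "\<nu> \<in> L" "b \<in> B \<nu>"
    then show "bracket (bracket x y) b \<in> lie_span (B \<nu>)"
      unfolding B(4)[OF b(1)] using t(2) B(2) by blast
  qed
  moreover have "trace_on (B \<nu>) (bracket (bracket x y)) = \<nu> (bracket x y) * of_nat (lie.dim (U \<nu>))" if \<nu>: "\<nu> \<in> L" for \<nu>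
  proof -
    obtain n where n: "\<forall>b\<in>lie_span (B \<nu>). (ad_shift (\<nu> (bracket x y)) (bracket x y) ^^ n) b = 0"
      using uniform_nilpotent[OF B(1)[OF \<nu>] _ t(1), of \<nu>] B(4)[OF \<nu>] U(2)[OF \<nu>] by auto
    have "trace_on (B \<nu>) (bracket (bracket x y)) = \<nu> (bracket x y) * of_nat (card (B \<nu>))"
      by (rule trace_on_generalized_eigenvalue[where n = n])
        (use n t(2) \<nu> B in \<open>auto intro: linear_bracket simp: ad_shift_def[abs_def]\<close>)
    moreover have "card (B \<nu>) = lie.dim (U \<nu>)"
      using B \<nu> by (intro lie.basis_card_eq_dim) auto
    ultimately show ?thesis by simp
  qed
  ultimately show ?thesis by simp
qed

section \<open>Invariance and nondegeneracy of the Killing form\<close>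

definition weight_basis :: "('g \<Rightarrow> complex) \<Rightarrow> 'g set" where
  "weight_basis \<nu> = (SOME B. finite B \<and> B \<subseteq> W \<nu> \<and> lie.independent B \<and> lie_span B = W \<nu>)"

lemma weight_basis: "finite (weight_basis \<nu>)" "weight_basis \<nu> \<subseteq> W \<nu>"
  "lie.independent (weight_basis \<nu>)" "lie_span (weight_basis \<nu>) = W \<nu>"
  using someI_ex[OF exists_finite_basis[OF subspace_weight_space[of H \<nu>]]] unfolding weight_basis_def by auto

text \<open>A basis of weight vectors: operators that shift weights have zero diagonal in
  it.\<close>

definition full_basis :: "'g set" where "full_basis = (\<Union>\<nu>\<in>weights. weight_basis \<nu>)"

lemma weights_subset: "weights \<subseteq> dual H" by (auto simp: weights_def)

lemma full_basis: "finite full_basis" "lie.independent full_basis" "lie_span full_basis = UNIV"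
proof -
  show "finite full_basis" unfolding full_basis_def using finite_weights weight_basis by blast
  show "lie.independent full_basis"
    unfolding full_basis_def by (intro independent_UN finite_weights weights_subset weight_basis)
  have "(\<Union>\<nu>\<in>weights. W \<nu>) \<subseteq> lie_span full_basis"
    unfolding full_basis_def using weight_basis(4) lie.span_mono[of "weight_basis _" "\<Union>\<nu>\<in>weights. weight_basis \<nu>"] by blast
  then show "lie_span full_basis = UNIV"
    using span_weights lie.span_minimal[OF _ lie.subspace_span[of full_basis], of "\<Union>\<nu>\<in>weights. W \<nu>"]
    by auto
qed

definition killing :: "'g \<Rightarrow> 'g \<Rightarrow> complex" where
  "killing x y = trace_on full_basis (bracket x \<circ> bracket y)"

lemma killing_sym: "killing x y = killing y x"
  unfolding killing_def by (intro trace_on_compose_commute full_basis linear_bracket) (simp_all add: full_basis)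

lemma killing_add_left: "killing (x + y) z = killing x z + killing y z"
proof -
  have "bracket (x + y) \<circ> bracket z = (\<lambda>b. (bracket x \<circ> bracket z) b + (bracket y \<circ> bracket z) b)"
    by (auto simp: bracket_add_left)
  then show ?thesis unfolding killing_def by (simp only:) (intro trace_on_add full_basis, simp_all add: full_basis)
qed

lemma killing_scale_left: "killing (c *\<^sub>C x) y = c * killing x y"
proof -
  have "bracket (c *\<^sub>C x) \<circ> bracket y = (\<lambda>b. c *\<^sub>C (bracket x \<circ> bracket y) b)"
    by (auto simp: bracket_scaleC_left)
  then show ?thesis unfolding killing_def by (simp only:) (intro trace_on_scale full_basis, simp add: full_basis)
qed

lemma killing_0_left [simp]: "killing 0 y = 0"
  using killing_scale_left[of 0 0 y] by simp

lemma killing_minus_left: "killing (- x) y = - killing x y"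
  using killing_scale_left[of "-1" x y] by simp

lemma killing_sum_right: "killing x (sum f A) = (\<Sum>a\<in>A. killing x (f a))"
  unfolding killing_sym[of x] by (induction A rule: infinite_finite_induct) (auto simp: killing_add_left)

text \<open>By cyclicity of the trace ad y moves past ad x ad z, which turns the commutator of ad x
  and ad y into that of ad y and ad z.\<close>

lemma killing_invariant: "killing (bracket x y) z = killing x (bracket y z)"
proof -
  have lin: "lie_linear (bracket x \<circ> bracket z)" for x z :: 'g
    by unfold_locales (simp_all add: bracket_add_right bracket_scaleC_right)
  have "killing (bracket x y) z = trace_on full_basis (\<lambda>b. (bracket x \<circ> bracket y \<circ> bracket z) b - (bracket y \<circ> (bracket x \<circ> bracket z)) b)"
    unfolding killing_def by (simp add: bracket_bracket_left trace_on_def)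
  also have "\<dots> = trace_on full_basis (bracket x \<circ> bracket y \<circ> bracket z) - trace_on full_basis (bracket y \<circ> (bracket x \<circ> bracket z))"
    by (intro trace_on_diff full_basis) (simp_all add: full_basis)
  also have "trace_on full_basis (bracket y \<circ> (bracket x \<circ> bracket z)) = trace_on full_basis ((bracket x \<circ> bracket z) \<circ> bracket y)"
    by (intro trace_on_compose_commute full_basis linear_bracket lin) (simp_all add: full_basis)
  also have "trace_on full_basis (bracket x \<circ> bracket y \<circ> bracket z) - trace_on full_basis ((bracket x \<circ> bracket z) \<circ> bracket y)
      = trace_on full_basis (\<lambda>b. (bracket x \<circ> bracket y \<circ> bracket z) b - ((bracket x \<circ> bracket z) \<circ> bracket y) b)"
    by (intro trace_on_diff[symmetric] full_basis) (simp_all add: full_basis)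
  also have "\<dots> = killing x (bracket y z)"
    unfolding killing_def by (simp add: bracket_bracket_left bracket_diff_right trace_on_def)
  finally show ?thesis .
qed

text \<open>The operator ad x ad y shifts weights by \<alpha> + \<beta>, so it has no diagonal
  entries in a basis of weight vectors.\<close>

lemma killing_orthogonal:
  assumes "x \<in> W \<alpha>" "y \<in> W \<beta>" "\<alpha> \<in> dual H" "\<beta> \<in> dual H" "\<alpha> + \<beta> \<noteq> 0"
  shows "killing x y = 0"
  unfolding killing_def trace_on_def
proof (rule sum.neutral, safe)
  fix b assume "b \<in> full_basis"
  then obtain \<nu> where \<nu>: "\<nu> \<in> weights" "b \<in> weight_basis \<nu>" by (auto simp: full_basis_def)
  let ?z = "bracket x (bracket y b)" and ?\<mu> = "\<alpha> + (\<beta> + \<nu>)"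
  have b: "b \<in> W \<nu>" using \<nu> weight_basis by blast
  have z: "?z \<in> W ?\<mu>"
    by (rule bracket_weight_space[OF assms(1) bracket_weight_space[OF assms(2) b]])
  have mu: "?\<mu> \<in> dual H" using fn.subspace_add[OF dual_subspace] assms \<nu> weights_subset by blast
  have "?\<mu> = (\<alpha> + \<beta>) + \<nu>" by (simp only: add.assoc)
  then have ne: "?\<mu> \<noteq> \<nu>" using assms(5) by (metis add_cancel_right_left)
  have "lie.representation full_basis ?z b = 0"
  proof (cases "?\<mu> \<in> weights")
    case True
    have "lie.representation full_basis ?z = lie.representation (weight_basis ?\<mu>) ?z"
      using True z weight_basis(4)[of ?\<mu>] by (intro lie.representation_extend full_basis) (auto simp: full_basis_def)
    moreover have "b \<notin> weight_basis ?\<mu>"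
      using independent_UN(1)[OF finite_weights weights_subset weight_basis(1,3,2) \<nu>(1) True ne[symmetric]] \<nu>(2) by blast
    ultimately show ?thesis using lie.representation_ne_zero by metis
  next
    case False
    then have "?z = 0" using z mu by (auto simp: weights_def)
    then show ?thesis by (simp add: lie.representation_zero)
  qed
  then show "lie.representation full_basis ((bracket x \<circ> bracket y) b) b = 0" by simp
qed

lemma killing_H:
  assumes "h \<in> H"
  shows "killing h h = (\<Sum>\<nu>\<in>weights. (\<nu> h)\<^sup>2 * of_nat (lie.dim (W \<nu>)))"
proof -
  have stable: "bracket h x \<in> W \<nu>" if "x \<in> W \<nu>" for x \<nu>
    using ad_shift_weight_space[OF that assms, of 0] by (simp add: ad_shift_def)
  have "killing h h = (\<Sum>\<nu>\<in>weights. trace_on (weight_basis \<nu>) (bracket h \<circ> bracket h))"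
    unfolding killing_def full_basis_def
    by (intro trace_on_UN finite_weights weight_basis full_basis(2)[unfolded full_basis_def]
        independent_UN(1)[OF finite_weights weights_subset weight_basis(1,3,2)])
      (use weight_basis(2,4) stable in \<open>auto simp: subset_iff\<close>)
  also have "\<dots> = (\<Sum>\<nu>\<in>weights. (\<nu> h)\<^sup>2 * of_nat (lie.dim (W \<nu>)))"
  proof (intro sum.cong refl)
    fix \<nu> assume "\<nu> \<in> weights"
    obtain n where n: "\<forall>b\<in>lie_span (weight_basis \<nu>). (ad_shift (\<nu> h) h ^^ n) b = 0"
      using uniform_nilpotent[OF weight_basis(1) _ assms, of \<nu> \<nu>] weight_basis(4) by auto
    \<comment> \<open>On \<open>W \<nu>\<close> it is ad h - \<nu>(h) that is known to be nilpotent;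
      factoring (ad h)^2 - \<nu>(h)^2 into two commuting factors transfers this to the
      square.\<close>
    have *: "((\<lambda>x. (bracket h \<circ> bracket h) x - (\<nu> h)\<^sup>2 *\<^sub>C x) ^^ m) x = (ad_shift (- \<nu> h) h ^^ m) ((ad_shift (\<nu> h) h ^^ m) x)" for m x
    proof (induction m arbitrary: x)
      case (Suc m)
      have "(bracket h \<circ> bracket h) x - (\<nu> h)\<^sup>2 *\<^sub>C x = ad_shift (- \<nu> h) h (ad_shift (\<nu> h) h x)" for x
        by (simp add: ad_shift_def bracket_diff_right bracket_scaleC_right lie.scale_right_diff_distrib power2_eq_square)
      moreover have "(ad_shift (\<nu> h) h ^^ m) (ad_shift (- \<nu> h) h y) = ad_shift (- \<nu> h) h ((ad_shift (\<nu> h) h ^^ m) y)" for y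
        by (rule funpow_commute) (rule ad_shift_commute_scalar)
      ultimately show ?case
        using Suc.IH by (simp del: funpow.simps add: funpow_Suc_right)
    qed auto
    have "trace_on (weight_basis \<nu>) (bracket h \<circ> bracket h) = (\<nu> h)\<^sup>2 * of_nat (card (weight_basis \<nu>))"
    proof (rule trace_on_generalized_eigenvalue[where n = n])
      show "lie_linear (bracket h \<circ> bracket h)"
        by unfold_locales (simp_all add: bracket_add_right bracket_scaleC_right)
      show "((\<lambda>x. (bracket h \<circ> bracket h) x - (\<nu> h)\<^sup>2 *\<^sub>C x) ^^ n) x = 0" if "x \<in> lie_span (weight_basis \<nu>)" for x
        unfolding * using n that by simp
    qed (use weight_basis stable in auto)
    moreover have "card (weight_basis \<nu>) = lie.dim (W \<nu>)"
      using weight_basis[of \<nu>] by (intro lie.basis_card_eq_dim) auto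
    ultimately show "trace_on (weight_basis \<nu>) (bracket h \<circ> bracket h) = (\<nu> h)\<^sup>2 * of_nat (lie.dim (W \<nu>))"
      by simp
  qed
  finally show ?thesis .
qed

lemma finite_base: "finite \<pi>"
  by (rule finite_subset[OF _ finite_roots]) (auto intro: simple_root_is_root)

lemma base_independent: "\<not> fn_dependent \<pi>" and span_base: "fn_span \<pi> = dual H"
  and base_sign: "\<alpha> \<in> roots H \<Longrightarrow> \<alpha> \<in> nat_span \<pi> \<or> - \<alpha> \<in> nat_span \<pi>"
  using simple_roots by (auto simp: simple_roots_def)

text \<open>\<open>H\<close> is its own double dual; the element found here is the functional with value \<open>1\<close> on all simple roots.\<close>

lemma exists_height_element:
  "\<exists>h\<in>H. \<forall>\<alpha>\<in>dual H. \<alpha> h = (\<Sum>a\<in>\<pi>. coefficient \<pi> \<alpha> a)"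
proof -
  let ?scale = "\<lambda>(a::complex) (f :: 'g \<Rightarrow> complex) x. a * f x"
  interpret p: vector_space_pair ?scale "(*) :: complex \<Rightarrow> complex \<Rightarrow> complex"
    by unfold_locales (auto simp: fun_eq_iff algebra_simps)
  obtain \<phi> where phi: "Vector_Spaces.linear ?scale (*) \<phi>" "\<forall>a\<in>\<pi>. \<phi> a = 1"
    using p.linear_independent_extend[of \<pi> "\<lambda>_. 1"] base_independent by (auto simp: fn_dependent_def)
  interpret \<phi>: Vector_Spaces.linear ?scale "(*)" \<phi> by (rule phi(1))
  have height: "\<phi> \<alpha> = (\<Sum>a\<in>\<pi>. coefficient \<pi> \<alpha> a)" if "\<alpha> \<in> dual H" for \<alpha>
  proof -
    have "\<alpha> = (\<Sum>a\<in>\<pi>. ?scale (coefficient \<pi> \<alpha> a) a)"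
      using fn.sum_representation_eq[OF base_independent _ finite_base, of \<alpha>] that span_base by simp
    then have "\<phi> \<alpha> = (\<Sum>a\<in>\<pi>. \<phi> (?scale (coefficient \<pi> \<alpha> a) a))" by (metis \<phi>.sum)
    then show ?thesis unfolding \<phi>.scale using phi(2) by simp
  qed
  obtain B where B: "finite B" "B \<subseteq> H" "lie.independent B" "lie_span B = H"
    using exists_finite_basis[OF subspace_H] by blast
  define e where "e b = (\<lambda>x. if x \<in> H then lie.representation B x b else 0)" for b
  have e: "e b \<in> dual H" for b
    using B lie.subspace_add[OF subspace_H] lie.subspace_scale[OF subspace_H] lie.representation_add[OF B(3)] lie.representation_scale[OF B(3)]
    by (auto simp: dual_def e_def)
  have BH: "c *\<^sub>C b \<in> H" if "b \<in> B" for b c using lie.subspace_scale[OF subspace_H] B(2) that by blast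
  \<comment> \<open>In the basis \<open>B\<close> with coordinate functionals \<open>e b\<close>,
    the functional \<phi> on the dual is evaluation at this vector.\<close>
  define h where "h = (\<Sum>b\<in>B. \<phi> (e b) *\<^sub>C b)"
  have hH: "h \<in> H" unfolding h_def by (intro lie.subspace_sum[OF subspace_H] BH)
  have "\<alpha> h = \<phi> \<alpha>" if a: "\<alpha> \<in> dual H" for \<alpha>
  proof -
    have lin: "\<alpha> (\<Sum>b\<in>B. c b *\<^sub>C b) = (\<Sum>b\<in>B. c b * \<alpha> b)" for c
      using dual_sum[OF subspace_H a, of B "\<lambda>b. c b *\<^sub>C b"] BH a B(2) by (auto simp: dual_def subset_iff intro!: sum.cong)
    have "\<alpha> = (\<Sum>b\<in>B. ?scale (\<alpha> b) (e b))"
    proof (rule dual_eqI[OF a])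
      show "(\<Sum>b\<in>B. ?scale (\<alpha> b) (e b)) \<in> dual H"
        using e by (intro fn.subspace_sum[OF dual_subspace] fn.subspace_scale[OF dual_subspace])
      fix x assume x: "x \<in> H"
      then have "\<alpha> x = \<alpha> (\<Sum>b\<in>B. lie.representation B x b *\<^sub>C b)"
        using B by (simp add: lie.sum_representation_eq)
      then show "\<alpha> x = (\<Sum>b\<in>B. ?scale (\<alpha> b) (e b)) x"
        unfolding lin sum_apply using x by (simp add: e_def mult.commute)
    qed
    then have "\<phi> \<alpha> = (\<Sum>b\<in>B. \<phi> (?scale (\<alpha> b) (e b)))" by (metis \<phi>.sum)
    then show ?thesis unfolding h_def lin \<phi>.scale by (simp add: mult.commute)
  qed
  then show ?thesis using hH height by metis
qed

lemma root_height_ne_0: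
  assumes "\<alpha> \<in> roots H"
  shows "\<exists>k::int. k \<noteq> 0 \<and> (\<Sum>a\<in>\<pi>. coefficient \<pi> \<alpha> a) = of_int k"
proof -
  have ne: "\<alpha> \<noteq> 0" using assms by (simp add: roots_def)
  note height = nat_span_height[OF base_independent finite_base]
  consider "\<alpha> \<in> nat_span \<pi>" | "- \<alpha> \<in> nat_span \<pi>" using base_sign[OF assms] by blast
  then show ?thesis
  proof cases
    case 1
    then obtain n where "n > 0" "(\<Sum>a\<in>\<pi>. coefficient \<pi> \<alpha> a) = of_nat n" using height ne by blast
    then show ?thesis by (intro exI[of _ "int n"]) simp
  next
    case 2
    then obtain n where n: "n > 0" "(\<Sum>a\<in>\<pi>. coefficient \<pi> (- \<alpha>) a) = of_nat n" using height[of "- \<alpha>"] ne by auto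
    have "\<alpha> \<in> fn_span \<pi>" using root_in_dual[OF assms] span_base by simp
    then have "(\<Sum>a\<in>\<pi>. coefficient \<pi> \<alpha> a) = of_int (- int n)"
      using n(2)[symmetric] fn.representation_neg[OF base_independent, of \<alpha>] by (simp add: sum_negf)
    then show ?thesis using n(1) by (intro exI[of _ "- int n"]) auto
  qed
qed

lemma dim_weight_space_pos:
  assumes "W \<nu> \<noteq> {0}"
  shows "lie.dim (W \<nu>) > 0"
proof -
  have "{0} \<subset> W \<nu>" using assms zero_in_weight_space by blast
  from dim_psubset[OF finite_dimensional _ subspace_weight_space this] show ?thesis by simp
qed

text \<open>The height element has nonzero integral eigenvalues on the root spaces, so it is not isotropic;
  simplicity then rules out a nonzero radical, without an appeal to Cartan's criterion.\<close>

lemma killing_nondegenerate: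
  assumes "\<pi> \<noteq> {}" "\<And>y. killing x y = 0"
  shows "x = 0"
proof -
  define I where "I = {x. \<forall>y. killing x y = 0}"
  have "lie_ideal I"
    unfolding lie_ideal_def
  proof (intro conjI allI ballI)
    show "lie_subspace I" by (rule lie.subspaceI) (auto simp: I_def killing_add_left killing_scale_left)
    fix z y assume y: "y \<in> I"
    have "killing (bracket z y) w = 0" for w
    proof -
      have "killing (bracket z y) w = - killing (bracket y z) w"
        using killing_minus_left[of "bracket y z" w] bracket_swap[of z y] by simp
      also have "\<dots> = 0" using y killing_invariant by (simp add: I_def)
      finally show ?thesis .
    qed
    then show "bracket z y \<in> I" by (simp add: I_def)
  qed
  then have "I = {0} \<or> I = UNIV" using simple by (auto simp: simple_lie_algebra_def)
  moreover have "I \<noteq> UNIV"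
  proof
    assume "I = UNIV"
    obtain h where h: "h \<in> H" "\<forall>\<alpha>\<in>dual H. \<alpha> h = (\<Sum>a\<in>\<pi>. coefficient \<pi> \<alpha> a)" using exists_height_element by blast
    obtain a where a: "a \<in> \<pi>" using assms(1) by blast
    have aw: "a \<in> weights" using a simple_root_is_root root_is_weight by blast
    have real: "\<exists>k::int. \<nu> h = of_int k \<and> (\<nu> \<in> roots H \<longrightarrow> k \<noteq> 0)" if "\<nu> \<in> weights" for \<nu>
    proof (cases "\<nu> \<in> roots H")
      case True
      then show ?thesis using root_height_ne_0[OF True] h(2) root_in_dual[OF True] by auto
    next
      case False
      then have "\<nu> = 0" using that weights_eq by (auto split: if_splits)
      then show ?thesis using False by (intro exI[of _ 0]) auto
    qed
    then obtain k :: "('g \<Rightarrow> complex) \<Rightarrow> int" where k: "\<And>\<nu>. \<nu> \<in> weights \<Longrightarrow> \<nu> h = of_int (k \<nu>)"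
        "\<And>\<nu>. \<nu> \<in> roots H \<Longrightarrow> k \<nu> \<noteq> 0" using root_is_weight by metis
    \<comment> \<open>Integrality turns the trace into a sum of nonnegative integers, to which a
      simple root contributes a positive term.\<close>
    have "killing h h = of_int (\<Sum>\<nu>\<in>weights. (k \<nu>)\<^sup>2 * int (lie.dim (W \<nu>)))"
      unfolding killing_H[OF h(1)] by (simp add: k)
    moreover have "killing h h = 0" using \<open>I = UNIV\<close> by (auto simp: I_def)
    ultimately have "(\<Sum>\<nu>\<in>weights. (k \<nu>)\<^sup>2 * int (lie.dim (W \<nu>))) = 0" by (metis of_int_eq_0_iff)
    then have "(k a)\<^sup>2 * int (lie.dim (W a)) = 0"
      using aw finite_weights by (subst (asm) sum_nonneg_eq_0_iff) auto
    moreover have "k a \<noteq> 0" using k(2) simple_root_is_root a by blast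
    moreover have "lie.dim (W a) > 0" using aw by (intro dim_weight_space_pos) (auto simp: weights_def)
    ultimately show False by simp
  qed
  ultimately show ?thesis using assms(2) by (auto simp: I_def)
qed

end


section \<open>Root strings\<close>

text \<open>The extra condition supplies a root on which the height element is nonzero; in the
  theorem it comes from \<open>\<alpha>s\<close>.\<close>

locale cartan_nonempty = cartan H \<pi>
  for H :: "'g::complex_lie_algebra set" and \<pi> :: "('g \<Rightarrow> complex) set" +
  assumes nonempty: "\<pi> \<noteq> {}"
begin

lemma weight_shift:
  assumes "x \<in> W \<alpha>" "u \<in> W \<nu>" "\<alpha> \<in> dual H" "\<nu> \<in> dual H"
  shows "bracket x u = 0 \<or> \<alpha> + \<nu> \<in> weights \<and> bracket x u \<in> W (\<alpha> + \<nu>)"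
  using bracket_weight_space[OF assms(1,2)] fn.subspace_add[OF dual_subspace assms(3,4)]
  by (auto simp: weights_def simp del: plus_fun_apply)

lemma bracket_H_weight_space: "t \<in> H \<Longrightarrow> u \<in> W \<nu> \<Longrightarrow> bracket t u \<in> W \<nu>"
  using ad_shift_weight_space[of u \<nu> t 0] by (simp add: ad_shift_def)

lemma uminus_dual: "\<alpha> \<in> dual H \<Longrightarrow> - \<alpha> \<in> dual H"
  by (rule fn.subspace_neg[OF dual_subspace])

lemma exists_root_vector:
  assumes "\<alpha> \<in> roots H"
  shows "\<exists>e. e \<noteq> 0 \<and> e \<in> root_space H \<alpha>"
  using assms by (auto simp: roots_def root_space_def)

text \<open>Nondegeneracy gives a partner of e, and orthogonality places its relevant component g in
  \<open>W (- \<alpha>)\<close>. For h with \<alpha>(h) nonzero, invariance makes the Killing form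
  of [g, e] and h equal to -\<alpha>(h) times that of e and g, which is nonzero.\<close>

lemma exists_opposite:
  assumes \<alpha>: "\<alpha> \<in> roots H" and e: "e \<in> root_space H \<alpha>" "e \<noteq> 0"
  shows "\<exists>f\<in>W (- \<alpha>). bracket e f \<noteq> 0"
proof -
  obtain y where y: "killing e y \<noteq> 0" using killing_nondegenerate[OF nonempty, of e] e(2) by blast
  obtain g where g: "\<forall>\<nu>\<in>weights. g \<nu> \<in> W \<nu>" "y = sum g weights"
    using span_UN_sum[of y "W" weights] finite_weights subspace_weight_space span_weights by auto
  have "\<exists>\<nu>\<in>weights. killing e (g \<nu>) \<noteq> 0"
  proof (rule ccontr)
    assume "\<not> ?thesis"
    then have "killing e y = 0" unfolding g(2) killing_sum_right by simp
    then show False using y by simp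
  qed
  then obtain \<nu> where \<nu>: "\<nu> \<in> weights" "killing e (g \<nu>) \<noteq> 0" by blast
  have ew: "e \<in> W \<alpha>" using e root_space_subset_weight_space by blast
  have "\<alpha> + \<nu> = 0"
    using killing_orthogonal[OF ew, of "g \<nu>" \<nu>] g(1) \<nu> root_in_dual[OF \<alpha>] weights_subset by blast
  then have "\<nu> = - \<alpha>" by (simp add: add_eq_0_iff)
  then have f: "g \<nu> \<in> W (- \<alpha>)" using g(1) \<nu>(1) by blast
  obtain h where h: "h \<in> H" "\<alpha> h \<noteq> 0"
    using dual_eqI[OF root_in_dual[OF \<alpha>] fn.subspace_0[OF dual_subspace]] \<alpha> by (auto simp: roots_def)
  have "killing (bracket (g \<nu>) e) h = killing (g \<nu>) (bracket e h)" by (rule killing_invariant)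
  also have "bracket e h = (- \<alpha> h) *\<^sub>C e" using e(1) h(1) bracket_swap[of e h] by (simp add: root_space_def)
  also have "killing (g \<nu>) ((- \<alpha> h) *\<^sub>C e) = - \<alpha> h * killing e (g \<nu>)"
    by (simp only: killing_sym[of "g \<nu>"] killing_scale_left)
  finally have "killing (bracket (g \<nu>) e) h \<noteq> 0" using h(2) \<nu>(2) by simp
  then have "bracket (g \<nu>) e \<noteq> 0" by auto
  then have "bracket e (g \<nu>) \<noteq> 0" using bracket_swap[of "g \<nu>" e] by simp
  then show ?thesis using f by blast
qed

lemma uminus_root: "\<alpha> \<in> roots H \<Longrightarrow> - \<alpha> \<in> roots H"
proof -
  assume \<alpha>: "\<alpha> \<in> roots H"
  obtain e where e: "e \<noteq> 0" "e \<in> root_space H \<alpha>" using exists_root_vector[OF \<alpha>] by blast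
  obtain f where f: "f \<in> W (- \<alpha>)" "bracket e f \<noteq> 0" using exists_opposite[OF \<alpha> e(2,1)] by blast
  have "f \<noteq> 0" using f(2) by auto
  then have "- \<alpha> \<in> weights" using f(1) uminus_dual[OF root_in_dual[OF \<alpha>]] by (auto simp: weights_def)
  moreover have "- \<alpha> \<noteq> 0" using \<alpha> by (auto simp: roots_def)
  ultimately show ?thesis using weights_eq by (auto split: if_splits)
qed

lemma bracket_opposite_in_H:
  assumes "e \<in> W \<alpha>" "f \<in> W (- \<alpha>)"
  shows "bracket e f \<in> H"
  using bracket_weight_space[OF assms] weight_space_0 by simp

text \<open>If \<alpha>([e, f]) = 0, then [e, f] has the constant generalized eigenvalue
  \<beta>([e, f]) along the whole \<alpha>-line through a simple root \<beta>. The total trace is 0,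
  so \<beta>([e, f]) = 0 for every \<beta>, and [e, f] = 0.\<close>

lemma root_bracket_ne_0:
  assumes \<alpha>: "\<alpha> \<in> roots H" and e: "e \<in> W \<alpha>" and f: "f \<in> W (- \<alpha>)"
    and t: "bracket e f \<noteq> 0"
  shows "\<alpha> (bracket e f) \<noteq> 0"
proof
  assume 0: "\<alpha> (bracket e f) = 0"
  have tH: "bracket e f \<in> H" by (rule bracket_opposite_in_H[OF e f])
  have ad: "\<alpha> \<in> dual H" "- \<alpha> \<in> dual H" using root_in_dual[OF \<alpha>] uminus_dual by auto
  have "\<beta> (bracket e f) = 0" if \<beta>: "\<beta> \<in> \<pi>" for \<beta>
  proof -
    define L where "L = {\<nu> \<in> weights. \<exists>k::int. \<nu> = \<beta> + (\<lambda>x. of_int k * \<alpha> x)}"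
    have L: "finite L" "L \<subseteq> dual H" using finite_weights weights_subset by (auto simp: L_def)
    have shift: "bracket z u \<in> lie_span (\<Union>\<nu>\<in>L. W \<nu>)"
      if z: "z \<in> W (\<lambda>x. of_int s * \<alpha> x)" and \<nu>: "\<nu> \<in> L" "u \<in> W \<nu>" for z s \<nu> u
    proof -
      have sd: "(\<lambda>x. of_int s * \<alpha> x) \<in> dual H" using fn.subspace_scale[OF dual_subspace ad(1)] .
      obtain k :: int where k: "\<nu> = \<beta> + (\<lambda>x. of_int k * \<alpha> x)" using \<nu>(1) by (auto simp: L_def)
      have "(\<lambda>x. of_int s * \<alpha> x) + \<nu> = \<beta> + (\<lambda>x. of_int (s + k) * \<alpha> x)" unfolding k by (auto simp: fun_eq_iff algebra_simps)
      then have "(\<lambda>x. of_int s * \<alpha> x) + \<nu> \<in> weights \<Longrightarrow> (\<lambda>x. of_int s * \<alpha> x) + \<nu> \<in> L" unfolding L_def by blast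
      then show ?thesis using weight_shift[OF z \<nu>(2) sd] L(2) \<nu>(1) lie.span_zero lie.span_base by (metis UN_I subsetD)
    qed
    have "(\<lambda>x. of_int 1 * \<alpha> x) = \<alpha>" "(\<lambda>x. of_int (- 1) * \<alpha> x) = - \<alpha>" by (auto simp: fun_eq_iff)
    then have "(\<Sum>\<nu>\<in>L. \<nu> (bracket e f) * of_nat (lie.dim (W \<nu>))) = 0"
      using shift[of e 1] shift[of f "-1"] e f
      by (intro trace_commutator_weights L subspace_weight_space order.refl bracket_H_weight_space tH) simp_all
    moreover have "\<nu> (bracket e f) = \<beta> (bracket e f)" if "\<nu> \<in> L" for \<nu> using that 0 by (auto simp: L_def)
    ultimately have "\<beta> (bracket e f) * of_nat (\<Sum>\<nu>\<in>L. lie.dim (W \<nu>)) = 0"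
      by (simp add: sum_distrib_left)
    moreover have "(\<Sum>\<nu>\<in>L. lie.dim (W \<nu>)) > 0"
    proof -
      have bw: "\<beta> \<in> weights" using \<beta> simple_root_is_root root_is_weight by blast
      then have "\<beta> \<in> L" unfolding L_def by (auto intro!: exI[of _ 0])
      moreover have "lie.dim (W \<beta>) > 0" using bw by (intro dim_weight_space_pos) (auto simp: weights_def)
      ultimately show ?thesis using L(1) by (auto simp: sum_pos2)
    qed
    ultimately show ?thesis by (metis mult_eq_0_iff of_nat_eq_0_iff less_irrefl)
  qed
  then show False using separating[OF tH] t by blast
qed

text \<open>The trace of \<open>ad [e, f]\<close> is taken on \<open>\<complex>e \<oplus> H \<oplus> \<Oplus>\<^sub>k g\<^bsub>-k\<alpha>\<^esub>\<close>.\<close>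

lemma dim_opposite:
  assumes \<alpha>: "\<alpha> \<in> roots H"
  shows "lie.dim (W (- \<alpha>)) = 1" and "2 \<le> n \<Longrightarrow> (\<lambda>x. - of_nat n * \<alpha> x) \<notin> weights"
proof -
  obtain e where e0: "e \<noteq> 0" "e \<in> root_space H \<alpha>" using exists_root_vector[OF \<alpha>] by blast
  obtain f where f: "f \<in> W (- \<alpha>)" "bracket e f \<noteq> 0" using exists_opposite[OF \<alpha> e0(2,1)] by blast
  have e: "e \<in> W \<alpha>" using e0 root_space_subset_weight_space by blast
  define t where "t = bracket e f"
  have tH: "t \<in> H" unfolding t_def by (rule bracket_opposite_in_H[OF e f(1)])
  have at: "\<alpha> t \<noteq> 0" unfolding t_def by (rule root_bracket_ne_0[OF \<alpha> e f])
  have ad: "\<alpha> \<in> dual H" "- \<alpha> \<in> dual H" using root_in_dual[OF \<alpha>] uminus_dual by auto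
  have a0: "\<alpha> \<noteq> 0" using \<alpha> by (simp add: roots_def)
  define m where "m k = (\<lambda>x. - of_nat k * \<alpha> x)" for k :: nat
  have m0: "m 0 = 0" and m1: "m 1 = - \<alpha>" by (auto simp: m_def fun_eq_iff)
  have m_inj: "m k = m l \<Longrightarrow> k = l" for k l
  proof -
    assume "m k = m l"
    then have "m k t = m l t" by simp
    then show ?thesis using at by (simp add: m_def)
  qed
  have m_ne: "m k \<noteq> \<alpha>" for k
  proof
    assume "m k = \<alpha>"
    then have "m k t = \<alpha> t" by simp
    then have "- (of_nat k * \<alpha> t) = \<alpha> t" by (simp add: m_def)
    then have "\<alpha> t + of_nat k * \<alpha> t = 0" by (metis left_minus)
    then have "(1 + of_nat k) * \<alpha> t = 0" by (simp add: algebra_simps)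
    then have "of_nat (Suc k) = (0 :: complex)" using at by simp
    then show False by (simp only: of_nat_eq_0_iff)
  qed
  have m_dual: "m k \<in> dual H" for k unfolding m_def by (rule fn.subspace_scale[OF dual_subspace ad(1)])
  define K where "K = {k. k \<ge> 1 \<and> m k \<in> weights}"
  have finK: "finite K"
    by (rule inj_on_finite[of m K weights]) (auto simp: K_def finite_weights inj_on_def dest: m_inj)
  define L where "L = insert \<alpha> (insert 0 (m ` K))"
  \<comment> \<open>For \<alpha> only the line of \<open>e\<close> is taken, as
    \<open>W \<alpha>\<close> is not yet known to be a line. The bracket of \<open>e\<close> with
    \<open>H\<close> stays in it because \<open>e\<close> is a true root vector.\<close>
  define U where "U \<nu> = (if \<nu> = \<alpha> then lie_span {e} else W \<nu>)" for \<nu>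
  have Ua: "U \<alpha> = lie_span {e}" and U0: "U 0 = H" and Um: "U (m k) = W (m k)" for k
    using a0 m_ne weight_space_0 by (auto simp: U_def)
  let ?V = "\<Union>\<nu>\<in>L. U \<nu>"
  have L: "finite L" "L \<subseteq> dual H" using finK ad m_dual fn.subspace_0[OF dual_subspace] by (auto simp: L_def)
  have subU: "lie_subspace (U \<nu>)" for \<nu> by (simp add: U_def subspace_weight_space)
  have Uw: "U \<nu> \<subseteq> W \<nu>" for \<nu>
    unfolding U_def using lie.span_minimal[of "{e}" "W \<alpha>"] e subspace_weight_space by auto
  have in_V: "u \<in> lie_span ?V" if "\<nu> \<in> L" "u \<in> U \<nu>" for \<nu> u using that by (intro lie.span_base) blast
  have e_in: "c *\<^sub>C e \<in> lie_span ?V" for c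
    by (rule in_V[of \<alpha>]) (auto simp: L_def Ua intro: lie.span_scale lie.span_base)
  have H_in: "h \<in> lie_span ?V" if "h \<in> H" for h using that by (intro in_V[of 0]) (auto simp: L_def U0)
  have m_in: "u \<in> lie_span ?V" if "u \<in> W (m k)" for u k
  proof (cases "k = 0")
    case True
    then show ?thesis using that m0 weight_space_0 H_in by simp
  next
    case False
    show ?thesis
    proof (cases "m k \<in> weights")
      case True
      then show ?thesis using False that by (intro in_V[of "m k"]) (auto simp: L_def K_def Um)
    next
      case F: False
      then have "u = 0" using that m_dual by (auto simp: weights_def)
      then show ?thesis by (simp add: lie.span_zero)
    qed
  qed
  have L_cases: "(\<nu> = \<alpha> \<and> (\<exists>c. u = c *\<^sub>C e)) \<or> (\<exists>k. \<nu> = m k \<and> u \<in> W (m k))" if "\<nu> \<in> L" "u \<in> U \<nu>" for \<nu> u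
    using that m0 weight_space_0 U0 Ua Um by (auto simp: L_def lie.span_singleton)
  have tr: "(\<Sum>\<nu>\<in>L. \<nu> (bracket e f) * of_nat (lie.dim (U \<nu>))) = 0"
  proof (rule trace_commutator_weights[OF L subU Uw])
    fix \<nu> u assume u: "\<nu> \<in> L" "u \<in> U \<nu>"
    show "bracket e u \<in> lie_span ?V"
      using L_cases[OF u]
    proof (elim disjE exE conjE)
      fix c assume "u = c *\<^sub>C e"
      then show ?thesis by (simp add: bracket_scaleC_right bracket_self lie.span_zero)
    next
      fix k assume k: "\<nu> = m k" "u \<in> W (m k)"
      show ?thesis
      proof (cases k)
        case 0
        then have "u \<in> H" using k m0 weight_space_0 by simp
        then have "bracket e u = (- \<alpha> u) *\<^sub>C e" using e0(2) bracket_swap[of e u] by (simp add: root_space_def)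
        then show ?thesis using e_in[of "- \<alpha> u"] by simp
      next
        case (Suc l)
        then have "\<alpha> + m k = m l" by (auto simp: m_def fun_eq_iff algebra_simps)
        then show ?thesis using bracket_weight_space[OF e k(2)] m_in by simp
      qed
    qed
    show "bracket f u \<in> lie_span ?V"
      using L_cases[OF u]
    proof (elim disjE exE conjE)
      fix c assume "u = c *\<^sub>C e"
      then have "bracket f u = (- c) *\<^sub>C t" using bracket_swap[of f e] by (simp add: bracket_scaleC_right t_def)
      then show ?thesis using H_in[OF lie.subspace_scale[OF subspace_H tH, of "- c"]] by simp
    next
      fix k assume k: "\<nu> = m k" "u \<in> W (m k)"
      have "- \<alpha> + m k = m (Suc k)" by (auto simp: m_def fun_eq_iff algebra_simps)
      then show ?thesis using bracket_weight_space[OF f(1) k(2)] m_in[of _ "Suc k"] by metis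
    qed
    show "bracket (bracket e f) u \<in> U \<nu>"
      using L_cases[OF u]
    proof (elim disjE exE conjE)
      fix c assume c: "\<nu> = \<alpha>" "u = c *\<^sub>C e"
      have "bracket (bracket e f) e = \<alpha> t *\<^sub>C e" using tH e0(2) by (simp add: root_space_def t_def)
      then have "bracket (bracket e f) u = (c * \<alpha> t) *\<^sub>C e" by (simp add: c bracket_scaleC_right)
      then show ?thesis by (simp add: c Ua lie.span_scale lie.span_base)
    next
      fix k assume k: "\<nu> = m k" "u \<in> W (m k)"
      then show ?thesis using bracket_H_weight_space[OF tH k(2)] Um by (simp add: t_def)
    qed
  qed (use tH t_def in simp)
  have "0 \<notin> m ` K"
  proof
    assume "0 \<in> m ` K"
    then obtain k where k: "k \<in> K" "m k = m 0" using m0 by auto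
    then show False using m_inj[OF k(2)] by (simp add: K_def)
  qed
  moreover have "\<alpha> \<notin> insert 0 (m ` K)" using a0 m_ne by auto
  ultimately have "\<alpha> t * of_nat (lie.dim (U \<alpha>)) + (\<Sum>\<nu>\<in>m ` K. \<nu> t * of_nat (lie.dim (U \<nu>))) = 0"
    using tr finK unfolding L_def t_def[symmetric] by simp
  moreover have "lie.dim (U \<alpha>) = 1"
  proof -
    have "lie.independent {e}" using e0 by simp
    then show ?thesis unfolding Ua by (simp add: lie.dim_eq_card_independent)
  qed
  moreover have "(\<Sum>\<nu>\<in>m ` K. \<nu> t * of_nat (lie.dim (U \<nu>))) = - \<alpha> t * of_nat (\<Sum>k\<in>K. k * lie.dim (W (m k)))"
  proof -
    have inj: "inj_on m K" by (rule inj_onI) (rule m_inj)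
    have mt: "m k t = - \<alpha> t * of_nat k" for k by (simp add: m_def)
    show ?thesis
      unfolding sum.reindex[OF inj] comp_apply Um mt of_nat_sum sum_distrib_left of_nat_mult mult.assoc ..
  qed
  ultimately have "\<alpha> t * of_nat 1 + - \<alpha> t * of_nat (\<Sum>k\<in>K. k * lie.dim (W (m k))) = 0"
    by (simp only:)
  then have "\<alpha> t * (1 - of_nat (\<Sum>k\<in>K. k * lie.dim (W (m k)))) = 0"
    by (simp only: right_diff_distrib mult_1_right of_nat_1) (simp only: mult_minus_left diff_conv_add_uminus)
  then have "of_nat (\<Sum>k\<in>K. k * lie.dim (W (m k))) = (of_nat 1 :: complex)" using at by simp
  \<comment> \<open>The weight 0 contributes nothing, \<open>e\<close> contributes \<alpha>(t), and
    the space for -k\<alpha> contributes -k \<alpha>(t) times its dimension. As k = 1 occurs, its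
    space has dimension 1 and every k \<ge> 2 is excluded.\<close>
  then have sum1: "(\<Sum>k\<in>K. k * lie.dim (W (m k))) = 1" by (simp only: of_nat_eq_iff)
  have "- \<alpha> \<in> weights" using uminus_root[OF \<alpha>] root_is_weight by blast
  then have 1: "1 \<in> K" using m1 by (simp add: K_def)
  have dpos: "lie.dim (W (m k)) > 0" if "k \<in> K" for k
    using that by (intro dim_weight_space_pos) (auto simp: K_def weights_def)
  have split: "lie.dim (W (m 1)) + (\<Sum>k\<in>K - {1}. k * lie.dim (W (m k))) = 1"
    using sum1 sum.remove[OF finK 1, of "\<lambda>k. k * lie.dim (W (m k))"] by simp
  then have "lie.dim (W (m 1)) = 1" and rest: "(\<Sum>k\<in>K - {1}. k * lie.dim (W (m k))) = 0"
    using dpos[OF 1] by linarith+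
  then show "lie.dim (W (- \<alpha>)) = 1" using m1 by simp
  show "(\<lambda>x. - of_nat n * \<alpha> x) \<notin> weights" if "2 \<le> n"
  proof
    assume "(\<lambda>x. - of_nat n * \<alpha> x) \<in> weights"
    then have "n \<in> K - {1}" using that by (simp add: K_def m_def)
    then have "n * lie.dim (W (m n)) = 0" using rest finK by simp
    then show False using dpos[of n] \<open>n \<in> K - {1}\<close> that by simp
  qed
qed

lemma dim_root_space: "\<alpha> \<in> roots H \<Longrightarrow> lie.dim (W \<alpha>) = 1"
  using dim_opposite(1)[OF uminus_root] by simp

lemma multiple_not_weight: "\<alpha> \<in> roots H \<Longrightarrow> 2 \<le> n \<Longrightarrow> (\<lambda>x. of_nat n * \<alpha> x) \<notin> weights"
  using dim_opposite(2)[OF uminus_root, of \<alpha> n] by simp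

lemma weight_space_eq_span:
  assumes "\<alpha> \<in> roots H" "e \<in> W \<alpha>" "e \<noteq> 0"
  shows "W \<alpha> = lie_span {e}"
proof (rule ccontr)
  assume "W \<alpha> \<noteq> lie_span {e}"
  moreover have "lie_span {e} \<subseteq> W \<alpha>"
    using assms(2) subspace_weight_space by (intro lie.span_minimal) auto
  ultimately have "lie_span {e} \<subset> W \<alpha>" by blast
  from dim_psubset[OF finite_dimensional lie.subspace_span subspace_weight_space this]
  show False using dim_root_space[OF assms(1)] assms(3) lie.dim_eq_card_independent[of "{e}"] by simp
qed

text \<open>The weight space is a line and contains a true root vector; from here on generalized and
  genuine root spaces coincide.\<close>

lemma root_space_eq_weight_space:
  assumes "\<alpha> \<in> roots H"
  shows "root_space H \<alpha> = W \<alpha>"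
proof
  obtain e where e: "e \<noteq> 0" "e \<in> root_space H \<alpha>" using exists_root_vector[OF assms] by blast
  then have "W \<alpha> = lie_span {e}"
    using weight_space_eq_span[OF assms] root_space_subset_weight_space by blast
  then show "W \<alpha> \<subseteq> root_space H \<alpha>"
    using e(2) by (auto simp: lie.span_singleton root_space_def bracket_scaleC_right mult.commute)
qed (rule root_space_subset_weight_space)

text \<open>Both root spaces are lines, so the span in the definition of \<open>coroot\<close> is
  the line of [e, f]; \<alpha> is nonzero there, and the normalization to 2 selects exactly one
  element.\<close>

lemma coroot:
  assumes \<alpha>: "\<alpha> \<in> roots H"
  shows "\<exists>e\<in>W \<alpha>. \<exists>f\<in>W (- \<alpha>). coroot H \<alpha> = bracket e f"
    and "\<alpha> (coroot H \<alpha>) = 2"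
proof -
  obtain e where e0: "e \<noteq> 0" "e \<in> root_space H \<alpha>" using exists_root_vector[OF \<alpha>] by blast
  obtain f where f: "f \<in> W (- \<alpha>)" "bracket e f \<noteq> 0" using exists_opposite[OF \<alpha> e0(2,1)] by blast
  have f0: "f \<noteq> 0" using f(2) by auto
  have e: "e \<in> W \<alpha>" using e0 root_space_subset_weight_space by blast
  define t where "t = bracket e f"
  have tH: "t \<in> H" unfolding t_def by (rule bracket_opposite_in_H[OF e f(1)])
  have at: "\<alpha> t \<noteq> 0" unfolding t_def by (rule root_bracket_ne_0[OF \<alpha> e f])
  have scale: "\<alpha> (c *\<^sub>C t) = c * \<alpha> t" for c using root_in_dual[OF \<alpha>] tH by (simp add: dual_def)
  have spans: "root_space H \<alpha> = lie_span {e}" "root_space H (- \<alpha>) = lie_span {f}"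
    using root_space_eq_weight_space weight_space_eq_span uminus_root \<alpha> e f(1) e0(1) f0 by auto
  have S: "lie_span {bracket x y | x y. x \<in> root_space H \<alpha> \<and> y \<in> root_space H (- \<alpha>)} = lie_span {t}"
  proof (rule lie.span_eq[THEN iffD2], intro conjI subsetI)
    fix z assume "z \<in> {bracket x y | x y. x \<in> root_space H \<alpha> \<and> y \<in> root_space H (- \<alpha>)}"
    then obtain c d where "z = bracket (c *\<^sub>C e) (d *\<^sub>C f)" unfolding spans lie.span_singleton by blast
    then have "z = (c * d) *\<^sub>C t" by (simp add: bracket_scaleC_left bracket_scaleC_right t_def)
    then show "z \<in> lie_span {t}" by (auto simp: lie.span_singleton)
  next
    fix z assume "z \<in> {t}"
    then show "z \<in> lie_span {bracket x y | x y. x \<in> root_space H \<alpha> \<and> y \<in> root_space H (- \<alpha>)}"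
      using spans lie.span_base[of e "{e}"] lie.span_base[of f "{f}"] unfolding t_def by (intro lie.span_base) blast
  qed
  have eq: "coroot H \<alpha> = (2 / \<alpha> t) *\<^sub>C t"
    unfolding coroot_def S
  proof (rule the_equality)
    show "(2 / \<alpha> t) *\<^sub>C t \<in> lie_span {t} \<and> \<alpha> ((2 / \<alpha> t) *\<^sub>C t) = 2"
      using at scale by (auto simp: lie.span_singleton)
    fix s assume s: "s \<in> lie_span {t} \<and> \<alpha> s = 2"
    then obtain c where c: "s = c *\<^sub>C t" unfolding lie.span_singleton by blast
    then have "c * \<alpha> t = 2" using s scale[of c] by simp
    then have "c = 2 / \<alpha> t" using at by (simp add: field_simps)
    then show "s = (2 / \<alpha> t) *\<^sub>C t" using c by simp
  qed
  show "\<alpha> (coroot H \<alpha>) = 2" unfolding eq scale using at by simp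
  have "coroot H \<alpha> = bracket ((2 / \<alpha> t) *\<^sub>C e) f" unfolding eq by (simp add: t_def bracket_scaleC_left)
  then show "\<exists>e\<in>W \<alpha>. \<exists>f\<in>W (- \<alpha>). coroot H \<alpha> = bracket e f"
    using f(1) lie.subspace_scale[OF subspace_weight_space e] by blast
qed

lemma last_of_string:
  assumes \<alpha>: "\<alpha> \<in> roots H" and \<beta>: "\<beta> \<in> roots H"
  shows "\<exists>q::nat. (\<forall>n\<le>q. \<beta> + (\<lambda>x. of_nat n * \<alpha> x) \<in> roots H) \<and> \<beta> + (\<lambda>x. of_nat (Suc q) * \<alpha> x) \<notin> roots H"
proof -
  let ?g = "\<lambda>n::nat. \<beta> + (\<lambda>x. of_nat n * \<alpha> x)"
  have "inj ?g"
  proof (rule injI)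
    fix m n assume "?g m = ?g n"
    then have "?g m (coroot H \<alpha>) = ?g n (coroot H \<alpha>)" by (rule fun_cong)
    then show "m = n" using coroot(2)[OF \<alpha>] by simp
  qed
  then have "\<not> range ?g \<subseteq> roots H" using finite_roots finite_subset finite_imageD by blast
  then have ex: "\<exists>n. ?g n \<notin> roots H" by blast
  define n where "n = (LEAST n. ?g n \<notin> roots H)"
  have n: "?g n \<notin> roots H" unfolding n_def by (rule LeastI_ex[OF ex])
  have "?g 0 = \<beta>" by (auto simp: fun_eq_iff)
  then have "n \<noteq> 0" using n \<beta> by metis
  then obtain q where q: "n = Suc q" using not0_implies_Suc by blast
  have "?g k \<in> roots H" if "k \<le> q" for k
    using not_less_Least[of k "\<lambda>n. ?g n \<notin> roots H"] that q unfolding n_def[symmetric] by simp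
  then show ?thesis using n q by blast
qed

lemma sum_arith: "(\<Sum>i\<le>n. c + 2 * of_nat i) = (of_nat n + 1) * (c + of_nat n :: complex)"
  by (induction n) (auto simp: algebra_simps)

text \<open>On the unbroken string from \<beta> - r\<alpha> to \<beta> + q\<alpha> all spaces are
  lines, and the trace of the coroot is an arithmetic sum with step 2. Its vanishing gives the value
  r - q for \<beta> at the coroot, and the reflected root \<beta> + (q - r)\<alpha> lies in the
  string.\<close>

lemma root_string:
  assumes \<alpha>: "\<alpha> \<in> roots H" and \<beta>: "\<beta> \<in> roots H" and ne: "\<beta> \<noteq> \<alpha>" "\<beta> \<noteq> - \<alpha>"
  shows "\<beta> (coroot H \<alpha>) \<in> \<int>" and "(\<lambda>x. \<beta> x - \<beta> (coroot H \<alpha>) * \<alpha> x) \<in> roots H"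
proof -
  obtain q where q: "\<forall>n\<le>q. \<beta> + (\<lambda>x. of_nat n * \<alpha> x) \<in> roots H" "\<beta> + (\<lambda>x. of_nat (Suc q) * \<alpha> x) \<notin> roots H"
    using last_of_string[OF \<alpha> \<beta>] by blast
  obtain r where r: "\<forall>n\<le>r. \<beta> + (\<lambda>x. of_nat n * (- \<alpha>) x) \<in> roots H" "\<beta> + (\<lambda>x. of_nat (Suc r) * (- \<alpha>) x) \<notin> roots H"
    using last_of_string[OF uminus_root[OF \<alpha>] \<beta>] by blast
  define g where "g k = \<beta> + (\<lambda>x. of_int k * \<alpha> x)" for k :: int
  have g_root: "g k \<in> roots H" if "- int r \<le> k" "k \<le> int q" for k
  proof (cases "k \<ge> 0")
    case True
    then have "g k = \<beta> + (\<lambda>x. of_nat (nat k) * \<alpha> x)" by (auto simp: g_def fun_eq_iff)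
    then show ?thesis using q(1) that True by (metis nat_le_iff)
  next
    case False
    then have "g k = \<beta> + (\<lambda>x. of_nat (nat (- k)) * (- \<alpha>) x)" by (auto simp: g_def fun_eq_iff)
    moreover have "nat (- k) \<le> r" using that by simp
    ultimately show ?thesis using r(1) by metis
  qed
  have "\<beta> + (\<lambda>x. of_nat (Suc q) * \<alpha> x) = g (int q + 1)" "\<beta> + (\<lambda>x. of_nat (Suc r) * (- \<alpha>) x) = g (- int r - 1)"
    by (auto simp: g_def fun_eq_iff algebra_simps)
  then have g_end: "g (int q + 1) \<notin> roots H" "g (- int r - 1) \<notin> roots H" using q(2) r(2) by metis+
  \<comment> \<open>The space \<open>W 0\<close> is \<open>H\<close>, which may have dimension above
    1. With 0 off the line through \<beta>, a member of the line that is not a root is not a weight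
    either.\<close>
  have g_ne_0: "g k \<noteq> 0" for k
  proof
    assume "g k = 0"
    then have b: "\<beta> = (\<lambda>x. - of_int k * \<alpha> x)" by (auto simp: g_def fun_eq_iff add_eq_0_iff)
    have "k \<noteq> 1" "k \<noteq> -1" "k \<noteq> 0" using ne b \<beta> by (auto simp: roots_def fun_eq_iff)
    then consider "k \<ge> 2" | "k \<le> -2" by linarith
    then show False
    proof cases
      case 1
      then have "\<beta> = (\<lambda>x. - of_nat (nat k) * \<alpha> x)" using b by (auto simp: fun_eq_iff)
      then show False using dim_opposite(2)[OF \<alpha>, of "nat k"] 1 root_is_weight[OF \<beta>] by simp
    next
      case 2
      then have "\<beta> = (\<lambda>x. of_nat (nat (- k)) * \<alpha> x)" using b by (auto simp: fun_eq_iff)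
      then show False using multiple_not_weight[OF \<alpha>, of "nat (- k)"] 2 root_is_weight[OF \<beta>] by simp
    qed
  qed
  obtain e f where e: "e \<in> W \<alpha>" and f: "f \<in> W (- \<alpha>)" and t: "coroot H \<alpha> = bracket e f"
    using coroot(1)[OF \<alpha>] by blast
  have ad: "\<alpha> \<in> dual H" "- \<alpha> \<in> dual H" using root_in_dual[OF \<alpha>] uminus_dual by auto
  define G where "G i = g (int i - int r)" for i
  define L where "L = G ` {..q + r}"
  have injG: "inj_on G {..q + r}"
  proof (rule inj_onI)
    fix i j assume "G i = G j"
    then have "G i (coroot H \<alpha>) = G j (coroot H \<alpha>)" by simp
    then have "of_int (int i) = (of_int (int j) :: complex)" using coroot(2)[OF \<alpha>] by (simp add: G_def g_def)
    then show "i = j" by (simp only: of_int_eq_iff of_nat_eq_iff)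
  qed
  have G_root: "G i \<in> roots H" if "i \<le> q + r" for i using that unfolding G_def by (intro g_root) auto
  have L: "finite L" "L \<subseteq> dual H" using G_root root_in_dual by (auto simp: L_def)
  have shift: "bracket z u \<in> lie_span (\<Union>\<nu>\<in>L. W \<nu>)"
    if z: "z \<in> W \<gamma>" "\<gamma> \<in> dual H" and \<gamma>: "\<And>k. \<gamma> + g k = g (k + s)" and s: "s = 1 \<or> s = -1"
      and \<nu>: "\<nu> \<in> L" "u \<in> W \<nu>" for z \<gamma> s \<nu> u
  proof -
    obtain i where i: "i \<le> q + r" "\<nu> = G i" using \<nu>(1) by (auto simp: L_def)
    have eq: "\<gamma> + \<nu> = g (int i - int r + s)" unfolding i(2) G_def by (rule \<gamma>)
    show ?thesis
    proof (cases "- int r \<le> int i - int r + s \<and> int i - int r + s \<le> int q")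
      case True
      then have "\<gamma> + \<nu> = G (nat (int i + s))" unfolding eq G_def by (simp add: algebra_simps)
      moreover have "nat (int i + s) \<le> q + r" unfolding nat_le_iff using True by linarith
      ultimately have "\<gamma> + \<nu> \<in> L" by (simp only: L_def) (rule imageI, simp)
      then show ?thesis using bracket_weight_space[OF z(1) \<nu>(2)] by (intro lie.span_base) blast
    next
      case False
      \<comment> \<open>One step beyond an end of the string there is no weight, so the bracket is 0
        and the segment is stable.\<close>
      then have "int i - int r + s = int q + 1 \<or> int i - int r + s = - int r - 1" using i(1) s by auto
      then have "\<gamma> + \<nu> \<notin> roots H" unfolding eq using g_end by metis
      then have "\<gamma> + \<nu> \<notin> weights" unfolding weights_eq using g_ne_0 eq by (auto split: if_splits)
      then have "bracket z u = 0" using weight_shift[OF z(1) \<nu>(2) z(2)] L(2) \<nu>(1) by blast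
      then show ?thesis by (simp add: lie.span_zero)
    qed
  qed
  have "(\<Sum>\<nu>\<in>L. \<nu> (bracket e f) * of_nat (lie.dim (W \<nu>))) = 0"
  proof (intro trace_commutator_weights L subspace_weight_space order.refl bracket_H_weight_space bracket_opposite_in_H[OF e f])
    fix \<nu> u assume u: "\<nu> \<in> L" "u \<in> W \<nu>"
    show "bracket e u \<in> lie_span (\<Union>\<nu>\<in>L. W \<nu>)"
      by (rule shift[OF e ad(1), of 1]) (use u in \<open>auto simp: g_def fun_eq_iff algebra_simps\<close>)
    show "bracket f u \<in> lie_span (\<Union>\<nu>\<in>L. W \<nu>)"
      by (rule shift[OF f ad(2), of "-1"]) (use u in \<open>auto simp: g_def fun_eq_iff algebra_simps\<close>)
  qed
  then have "(\<Sum>i\<le>q + r. G i (coroot H \<alpha>)) = 0"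
    unfolding L_def using G_root dim_root_space by (simp add: sum.reindex[OF injG] t)
  moreover have "G i (coroot H \<alpha>) = (\<beta> (coroot H \<alpha>) - 2 * of_nat r) + 2 * of_nat i" for i
    using coroot(2)[OF \<alpha>] by (simp add: G_def g_def algebra_simps)
  ultimately have "(of_nat (q + r) + 1) * (\<beta> (coroot H \<alpha>) - 2 * of_nat r + of_nat (q + r)) = 0"
    by (simp only: sum_arith)
  moreover have "of_nat (q + r) + 1 \<noteq> (0 :: complex)"
    by (metis Suc_eq_plus1 nat.distinct(1) of_nat_Suc of_nat_eq_0_iff add.commute)
  ultimately have "\<beta> (coroot H \<alpha>) - 2 * of_nat r + of_nat (q + r) = 0"
    by (metis mult_eq_0_iff)
  then have "\<beta> (coroot H \<alpha>) = of_int (int r - int q)"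
    by (simp add: algebra_simps)
  then show "\<beta> (coroot H \<alpha>) \<in> \<int>" "(\<lambda>x. \<beta> x - \<beta> (coroot H \<alpha>) * \<alpha> x) \<in> roots H"
  proof -
    assume b: "\<beta> (coroot H \<alpha>) = of_int (int r - int q)"
    then show "\<beta> (coroot H \<alpha>) \<in> \<int>" by simp
    have "(\<lambda>x. \<beta> x - \<beta> (coroot H \<alpha>) * \<alpha> x) = g (int q - int r)"
      unfolding b by (auto simp: g_def fun_eq_iff algebra_simps)
    then show "(\<lambda>x. \<beta> x - \<beta> (coroot H \<alpha>) * \<alpha> x) \<in> roots H" using g_root[of "int q - int r"] by simp
  qed
qed

sublocale root_base "roots H" \<pi> "coroot H"
proof
  show "finite (roots H)" by (rule finite_roots)
  show "\<alpha> (coroot H \<alpha>) = 2" if "\<alpha> \<in> roots H" for \<alpha> by (rule coroot(2)[OF that])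
  show "\<pi> \<subseteq> roots H" using simple_root_is_root by blast
  show "\<not> fn_dependent \<pi>" by (rule base_independent)
  show "\<beta> \<in> nat_span \<pi> \<or> - \<beta> \<in> nat_span \<pi>" if "\<beta> \<in> roots H" for \<beta> by (rule base_sign[OF that])
  show "n = 1" if "\<alpha> \<in> \<pi>" "(\<lambda>x. of_nat n * \<alpha> x) \<in> roots H" for n \<alpha>
  proof -
    have "n \<noteq> 0" using that(2) by (intro notI) (auto simp: roots_def fun_eq_iff)
    moreover have "\<not> 2 \<le> n" using multiple_not_weight[OF simple_root_is_root[OF that(1)]] root_is_weight[OF that(2)] by blast
    ultimately show ?thesis by linarith
  qed
  fix \<alpha> \<beta> assume ab: "\<alpha> \<in> roots H" "\<beta> \<in> roots H"
  \<comment> \<open>The cases \<beta> = \<alpha> and \<beta> = -\<alpha>, excluded from the string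
    argument, are computed directly.\<close>
  have "(\<lambda>x. \<alpha> x - 2 * \<alpha> x) = - \<alpha>" "(\<lambda>x. - \<alpha> x + 2 * \<alpha> x) = \<alpha>" by (auto simp: fun_eq_iff)
  then show "\<beta> (coroot H \<alpha>) \<in> \<int>" "(\<lambda>x. \<beta> x - \<beta> (coroot H \<alpha>) * \<alpha> x) \<in> roots H"
    using root_string[OF ab] coroot(2)[OF ab(1)] uminus_root[OF ab(1)] ab
    by (cases "\<beta> = \<alpha>"; cases "\<beta> = - \<alpha>"; simp)+
qed

end


section \<open>Parabolic subalgebras and the Weyl group\<close>

context cartan_nonempty
begin

lemma V_eq_dual: "V = dual H"
  by (rule span_base)

lemma pos_eq: "pos = pos_roots H \<pi>"
  by (simp add: pos_def pos_roots_def)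

lemma coefficient_add: "\<mu> \<in> dual H \<Longrightarrow> \<nu> \<in> dual H \<Longrightarrow> coefficient \<pi> (\<mu> + \<nu>) a = coefficient \<pi> \<mu> a + coefficient \<pi> \<nu> a"
  unfolding V_eq_dual[symmetric] by (simp add: fn.representation_add[OF base_independent])

lemma coefficient_diff: "\<mu> \<in> dual H \<Longrightarrow> \<nu> \<in> dual H \<Longrightarrow> coefficient \<pi> (\<mu> - \<nu>) a = coefficient \<pi> \<mu> a - coefficient \<pi> \<nu> a"
  unfolding V_eq_dual[symmetric] by (simp add: fn.representation_diff[OF base_independent])

lemma coefficient_levi:
  assumes "\<nu> \<in> group_closure (\<pi> - {s})"
  shows "coefficient \<pi> \<nu> s = 0"
proof -
  have "coefficient \<pi> \<nu> = coefficient (\<pi> - {s}) \<nu>"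
    using assms group_closure_subset_span[of "\<pi> - {s}"] by (intro fn.representation_extend[OF base_independent]) auto
  then show ?thesis using fn.representation_ne_zero[of "\<pi> - {s}" \<nu> s] by auto
qed

section \<open>The filtration attached to a simple root\<close>

text \<open>Coefficients are complex numbers, so a lower bound on the degree is expressed through an
  integer value.\<close>

definition graded :: "('g \<Rightarrow> complex) \<Rightarrow> int \<Rightarrow> ('g \<Rightarrow> complex) set" where
  "graded s m = {\<nu> \<in> weights. \<exists>k\<ge>m. coefficient \<pi> \<nu> s = of_int k}"

text \<open>A decreasing filtration F with [F_m, F_n] inside F_{m+n}; F_0 contains the parabolic
  subalgebra for \<pi> - {s}.\<close>

definition filtration :: "('g \<Rightarrow> complex) \<Rightarrow> int \<Rightarrow> 'g set" where
  "filtration s m = lie_span (\<Union>\<nu>\<in>graded s m. W \<nu>)"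

lemma subspace_filtration: "lie_subspace (filtration s m)"
  by (simp add: filtration_def)

lemma filtration_mono: "m \<le> n \<Longrightarrow> filtration s n \<subseteq> filtration s m"
  unfolding filtration_def by (rule lie.span_mono) (force simp: graded_def)

lemma weight_space_subset_filtration: "\<nu> \<in> graded s m \<Longrightarrow> W \<nu> \<subseteq> filtration s m"
  unfolding filtration_def using lie.span_superset by fast

lemma weight_vector_notin_filtration:
  assumes "\<nu> \<in> weights" "\<nu> \<notin> graded s m"
  shows "\<exists>x\<in>W \<nu>. x \<notin> filtration s m"
proof -
  obtain x where x: "x \<in> W \<nu>" "x \<noteq> 0" using assms(1) zero_in_weight_space unfolding weights_def by blast
  have "graded s m \<subseteq> weights" by (auto simp: graded_def)
  then have "finite (graded s m)" "graded s m \<subseteq> dual H" using finite_weights weights_subset finite_subset by auto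
  moreover have "\<nu> \<in> dual H" using assms(1) weights_subset by blast
  ultimately have "x \<notin> filtration s m"
    using weight_space_disjoint_span[of "graded s m" \<nu> x] assms(2) x unfolding filtration_def by blast
  then show ?thesis using x(1) by blast
qed

lemma bracket_filtration:
  assumes "x \<in> filtration s m" "y \<in> filtration s n"
  shows "bracket x y \<in> filtration s (m + n)"
proof -
  have gen: "bracket x y \<in> filtration s (m + n)"
    if x: "\<mu> \<in> graded s m" "x \<in> W \<mu>" and y: "\<nu> \<in> graded s n" "y \<in> W \<nu>" for x y \<mu> \<nu>
  proof -
    have d: "\<mu> \<in> dual H" "\<nu> \<in> dual H" using x(1) y(1) weights_subset by (auto simp: graded_def)
    obtain k l where kl: "k \<ge> m" "l \<ge> n" "coefficient \<pi> \<mu> s = of_int k" "coefficient \<pi> \<nu> s = of_int l"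
      using x(1) y(1) by (auto simp: graded_def)
    have "\<mu> + \<nu> \<in> weights \<Longrightarrow> \<mu> + \<nu> \<in> graded s (m + n)"
      unfolding graded_def mem_Collect_eq coefficient_add[OF d] kl(3,4) using kl(1,2) by (intro conjI exI[of _ "k + l"]) auto
    then show ?thesis
      using weight_shift[OF x(2) y(2) d] weight_space_subset_filtration[of "\<mu> + \<nu>" s "m + n"]
        lie.subspace_0[OF subspace_filtration[of s "m + n"]] by auto
  qed
  have "filtration s n \<subseteq> {y. bracket x y \<in> filtration s (m + n)}"
    if x: "\<mu> \<in> graded s m" "x \<in> W \<mu>" for x \<mu>
    unfolding filtration_def[of s n]
  proof (rule lie.span_minimal)
    show "(\<Union>\<nu>\<in>graded s n. W \<nu>) \<subseteq> {y. bracket x y \<in> filtration s (m + n)}" using gen[OF x] by blast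
    show "lie_subspace {y. bracket x y \<in> filtration s (m + n)}"
      using subspace_filtration by (intro lie.subspaceI)
        (auto simp: bracket_add_right bracket_scaleC_right lie.subspace_0 lie.subspace_add lie.subspace_scale)
  qed
  then have *: "(\<Union>\<nu>\<in>graded s m. W \<nu>) \<subseteq> {x. bracket x y \<in> filtration s (m + n)}" using assms(2) by blast
  have "filtration s m \<subseteq> {x. bracket x y \<in> filtration s (m + n)}"
    unfolding filtration_def[of s m]
  proof (rule lie.span_minimal[OF *])
    show "lie_subspace {x. bracket x y \<in> filtration s (m + n)}"
      using subspace_filtration by (intro lie.subspaceI)
        (auto simp: bracket_add_left bracket_scaleC_left lie.subspace_0 lie.subspace_add lie.subspace_scale)
  qed
  then show ?thesis using assms(1) by blast
qed

lemma parabolic_subset_filtration: "parabolic H \<pi> (\<pi> - {s}) \<subseteq> filtration s 0"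
  unfolding parabolic_def
proof (rule lie.span_minimal[OF _ subspace_filtration], rule Un_least)
  show "H \<subseteq> filtration s 0"
  proof (cases "H = {0}")
    case True
    then show ?thesis using lie.subspace_0[OF subspace_filtration] by auto
  next
    case False
    have "coefficient \<pi> 0 s = of_int 0" by (simp only: fn.representation_zero of_int_0)
    then have "0 \<in> graded s 0" using False weights_eq unfolding graded_def by auto
    then show ?thesis using weight_space_subset_filtration weight_space_0 by metis
  qed
  show "(\<Union>\<alpha>\<in>pos_roots H \<pi> \<union> neg_levi_roots H \<pi> (\<pi> - {s}). root_space H \<alpha>) \<subseteq> filtration s 0"
  proof (rule UN_least)
    fix \<alpha> assume a: "\<alpha> \<in> pos_roots H \<pi> \<union> neg_levi_roots H \<pi> (\<pi> - {s})"
    then have "\<exists>n. coefficient \<pi> \<alpha> s = of_nat n"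
      using pos_coefficient pos_eq coefficient_levi by (auto simp: neg_levi_roots_def levi_lattice_def intro: exI[of _ 0])
    then obtain n where "coefficient \<pi> \<alpha> s = of_int (int n)" by auto
    moreover have "\<alpha> \<in> weights"
      using a by (auto simp: pos_roots_def neg_levi_roots_def neg_roots_def intro: root_is_weight)
    ultimately have "\<alpha> \<in> graded s 0" unfolding graded_def by (auto intro!: exI[of _ "int n"])
    then show "root_space H \<alpha> \<subseteq> filtration s 0"
      using weight_space_subset_filtration root_space_subset_weight_space by blast
  qed
qed

text \<open>Otherwise the vectors of degree at least \<open>-1\<close> with respect to \<open>s\<close> give a proper subrepresentation.\<close>

lemma coefficient_le_1_if_irreducible:
  assumes irr: "irreducible_quotient (parabolic H \<pi> (\<pi> - {s}))" and s: "s \<in> \<pi>" and \<beta>: "\<beta> \<in> pos"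
  shows "coefficient \<pi> \<beta> s = 0 \<or> coefficient \<pi> \<beta> s = 1"
proof (rule ccontr)
  assume neg: "\<not> ?thesis"
  define P where "P = parabolic H \<pi> (\<pi> - {s})"
  define M where "M = filtration s (- 1)"
  have subP: "lie_subspace P" and subM: "lie_subspace M"
    by (simp_all add: P_def M_def parabolic_def subspace_filtration)
  have P0: "P \<subseteq> filtration s 0" unfolding P_def by (rule parabolic_subset_filtration)
  then have PM: "P \<subseteq> M" using filtration_mono[of "-1" 0 s] by (auto simp: M_def)
  have mem: "x - y \<in> P" if "quotient_class P x = quotient_class P y" for x y
  proof -
    have "x + 0 \<in> quotient_class P y" using that lie.subspace_0[OF subP] unfolding quotient_class_def by blast
    then show ?thesis by (auto simp: quotient_class_def)
  qed
  \<comment> \<open>Since P lies in M, a coset that meets M is contained in it, so conditions on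
    cosets become conditions on M.\<close>
  have iff: "quotient_class P x \<in> quotient_class P ` M \<longleftrightarrow> x \<in> M" for x
  proof
    assume "quotient_class P x \<in> quotient_class P ` M"
    then obtain y where "y \<in> M" "x - y \<in> P" using mem by blast
    then have "y + (x - y) \<in> M" using PM by (intro lie.subspace_add[OF subM]) auto
    then show "x \<in> M" by simp
  qed simp
  have "quotient_subrep P (quotient_class P ` M)"
    unfolding quotient_subrep_def iff
  proof (intro conjI allI impI ballI)
    fix y x assume "y \<in> P" "x \<in> M"
    then show "bracket y x \<in> M" using bracket_filtration[of y s 0 x "- 1"] P0 by (auto simp: M_def)
  qed (auto intro: lie.subspace_0 lie.subspace_add lie.subspace_scale subM)
  then consider "quotient_class P ` M = {quotient_class P 0}" | "quotient_class P ` M = range (quotient_class P)"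
    using irr unfolding irreducible_quotient_def P_def by blast
  then show False
  proof cases
    case 1
    \<comment> \<open>A root vector for -s has degree -1 and lies outside P, so the
      subrepresentation is nonzero.\<close>
    have sR: "- s \<in> weights" using uminus_root simple_root_is_root[OF s] root_is_weight by blast
    have c: "coefficient \<pi> (- s) s = of_int (- 1)"
      using coefficient_minus[OF fn.span_base[OF s]] fn.representation_basis[OF base_independent s] by simp
    have "- s \<in> graded s (- 1)" "- s \<notin> graded s 0"
      using sR unfolding graded_def mem_Collect_eq c of_int_eq_iff by auto
    then obtain x where x: "x \<in> W (- s)" "x \<notin> filtration s 0"
      using weight_vector_notin_filtration[OF sR] by blast
    then have "x \<in> M" unfolding M_def using weight_space_subset_filtration[OF \<open>- s \<in> graded s (- 1)\<close>] by blast
    then have "quotient_class P x \<in> {quotient_class P 0}" unfolding 1[symmetric] by (rule imageI)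
    then have "x - 0 \<in> P" by (intro mem) simp
    then show False using P0 x(2) by auto
  next
    case 2
    have all: "x \<in> M" for x unfolding iff[symmetric] 2 by (rule rangeI)
    \<comment> \<open>A coefficient other than 0 and 1 is at least 2, so root vectors for -\<beta>
      have degree at most -2 and lie outside M; the subrepresentation is proper.\<close>
    have bR: "- \<beta> \<in> weights" using uminus_root \<beta> pos_subset root_is_weight by blast
    obtain n where n: "coefficient \<pi> \<beta> s = of_nat n" using pos_coefficient[OF \<beta>] by blast
    then have "n \<noteq> 0" "n \<noteq> 1" using neg by auto
    moreover have c: "coefficient \<pi> (- \<beta>) s = of_int (- int n)" using coefficient_minus[OF pos_in_V[OF \<beta>]] n by simp
    ultimately have "- \<beta> \<notin> graded s (- 1)" unfolding graded_def mem_Collect_eq c of_int_eq_iff by auto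
    then show False using weight_vector_notin_filtration[OF bR] all unfolding M_def by blast
  qed
qed

section \<open>Elements of the Weyl group as words\<close>

text \<open>The restriction makes the map extensional, as membership in
  \<open>BijGroup (dual H)\<close> and comparison with \<open>reflection\<close> require.\<close>

definition weyl_element :: "('g \<Rightarrow> complex) list \<Rightarrow> ('g \<Rightarrow> complex) \<Rightarrow> 'g \<Rightarrow> complex" where
  "weyl_element as = restrict (act as) (dual H)"

lemma act_dual: "set as \<subseteq> roots H \<Longrightarrow> \<mu> \<in> dual H \<Longrightarrow> act as \<mu> \<in> dual H"
  using act_in_V V_eq_dual by simp

lemma reflection_eq: "reflection H \<alpha> = weyl_element [\<alpha>]"
  by (simp add: reflection_def weyl_element_def refl_def)

lemma weyl_element_Bij:
  assumes "set as \<subseteq> roots H"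
  shows "weyl_element as \<in> Bij (dual H)"
proof -
  have "set (rev as) \<subseteq> roots H" using assms by simp
  then have "bij_betw (weyl_element as) (dual H) (dual H)"
    using assms act_rev[OF assms]
    by (intro bij_betw_byWitness[of _ "act (rev as)"]) (auto simp: weyl_element_def act_dual simp del: set_rev)
  then show ?thesis by (simp add: Bij_def weyl_element_def)
qed

lemma weyl_element_mult:
  assumes "set as \<subseteq> roots H" "set bs \<subseteq> roots H"
  shows "weyl_element as \<otimes>\<^bsub>BijGroup (dual H)\<^esub> weyl_element bs = weyl_element (as @ bs)"
  using weyl_element_Bij[OF assms(1)] weyl_element_Bij[OF assms(2)] act_dual[OF assms(2)]
  by (auto simp: BijGroup_def compose_def weyl_element_def fun_eq_iff)

lemma weyl_element_Nil: "weyl_element [] = \<one>\<^bsub>BijGroup (dual H)\<^esub>"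
  by (simp add: BijGroup_def weyl_element_def)

lemma foldr_reflection:
  "set as \<subseteq> roots H \<Longrightarrow>
    foldr (\<lambda>\<alpha> v. reflection H \<alpha> \<otimes>\<^bsub>BijGroup (dual H)\<^esub> v) as \<one>\<^bsub>BijGroup (dual H)\<^esub> = weyl_element as"
proof (induction as)
  case (Cons a as)
  then show ?case using weyl_element_mult[of "[a]" as] by (simp add: reflection_eq)
qed (simp add: weyl_element_Nil)

lemma weyl_element_eq_iff: "weyl_element as = weyl_element bs \<longleftrightarrow> (\<forall>\<mu>\<in>V. act as \<mu> = act bs \<mu>)"
proof
  assume eq: "weyl_element as = weyl_element bs"
  show "\<forall>\<mu>\<in>V. act as \<mu> = act bs \<mu>"
  proof
    fix \<mu> assume "\<mu> \<in> V"
    then show "act as \<mu> = act bs \<mu>" using fun_cong[OF eq, of \<mu>] by (simp add: weyl_element_def V_eq_dual)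
  qed
next
  assume "\<forall>\<mu>\<in>V. act as \<mu> = act bs \<mu>"
  then show "weyl_element as = weyl_element bs"
    unfolding weyl_element_def V_eq_dual by (intro restrict_ext) blast
qed

text \<open>The generators are the reflections in all roots; they are involutions, so inverses are
  again words. \<open>refl_eq_act\<close> then rewrites every letter by simple reflections.\<close>

lemma weyl_group_elements:
  assumes "w \<in> weyl_group H"
  shows "\<exists>as. set as \<subseteq> \<pi> \<and> w = weyl_element as"
proof -
  have "\<exists>as. set as \<subseteq> roots H \<and> w = weyl_element as"
    using assms unfolding weyl_group_def
  proof (induction rule: generate.induct)
    case one
    then show ?case using weyl_element_Nil by (intro exI[of _ "[]"]) auto
  next
    case (incl h)
    then obtain \<alpha> where "\<alpha> \<in> roots H" "h = weyl_element [\<alpha>]" using reflection_eq by auto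
    then show ?case by (intro exI[of _ "[\<alpha>]"]) auto
  next
    case (inv h)
    then obtain \<alpha> where a: "\<alpha> \<in> roots H" "h = weyl_element [\<alpha>]" using reflection_eq by auto
    interpret G: group "BijGroup (dual H)" by (rule group_BijGroup)
    have "weyl_element [\<alpha>] \<otimes>\<^bsub>BijGroup (dual H)\<^esub> weyl_element [\<alpha>] = weyl_element [\<alpha>, \<alpha>]"
      using weyl_element_mult[of "[\<alpha>]" "[\<alpha>]"] a by simp
    also have "\<dots> = \<one>\<^bsub>BijGroup (dual H)\<^esub>"
      unfolding weyl_element_Nil[symmetric] using refl_refl[OF a(1)] by (simp add: weyl_element_def)
    finally have "inv\<^bsub>BijGroup (dual H)\<^esub> h = weyl_element [\<alpha>]"
      using a weyl_element_Bij[of "[\<alpha>]"] by (intro G.inv_equality) (auto simp: BijGroup_def)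
    then show ?case using a(1) by (intro exI[of _ "[\<alpha>]"]) auto
  next
    case (eng h1 h2)
    then obtain as bs where "set as \<subseteq> roots H" "h1 = weyl_element as" "set bs \<subseteq> roots H" "h2 = weyl_element bs" by blast
    then show ?case using weyl_element_mult by (intro exI[of _ "as @ bs"]) auto
  qed
  then obtain as where as: "set as \<subseteq> roots H" "w = weyl_element as" by blast
  have "\<exists>bs. set bs \<subseteq> \<pi> \<and> (\<forall>\<mu>\<in>V. act bs \<mu> = act as \<mu>)"
    using as(1)
  proof (induction as)
    case (Cons a as)
    then obtain bs where bs: "set bs \<subseteq> \<pi>" "\<forall>\<mu>\<in>V. act bs \<mu> = act as \<mu>" by auto
    obtain cs where cs: "set cs \<subseteq> \<pi>" "\<forall>\<mu>\<in>V. refl a \<mu> = act cs \<mu>" using refl_eq_act[of a] Cons.prems by auto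
    have "act (cs @ bs) \<mu> = act (a # as) \<mu>" if "\<mu> \<in> V" for \<mu>
    proof -
      have "act as \<mu> \<in> V" using act_in_V that Cons.prems by simp
      then show ?thesis using bs(2) cs(2) that by simp
    qed
    then show ?case using bs(1) cs(1) by (intro exI[of _ "cs @ bs"]) auto
  qed (auto intro: exI[of _ "[]"])
  then show ?thesis using as(2) weyl_element_eq_iff by metis
qed

text \<open>A shortest word is a reduced word, and its length is the number of inversions, which
  depends only on the action.\<close>

lemma weyl_length_eq:
  assumes "set as \<subseteq> \<pi>"
  shows "weyl_length H \<pi> (weyl_element as) = card (inversions as)"
proof -
  have R: "set cs \<subseteq> roots H" if "set cs \<subseteq> \<pi>" for cs using that simple_root_is_root by blast
  obtain bs where bs: "reduced_word bs" "\<forall>\<mu>\<in>V. act bs \<mu> = act as \<mu>" using exists_reduced_word[OF assms] by blast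
  then have bs': "set bs \<subseteq> \<pi>" by (simp add: reduced_word_def)
  have "weyl_length H \<pi> (weyl_element as) = length bs"
    unfolding weyl_length_def
  proof (rule Least_equality)
    show "\<exists>\<alpha>s. length \<alpha>s = length bs \<and> set \<alpha>s \<subseteq> \<pi> \<and> weyl_element as =
        foldr (\<lambda>\<alpha> v. reflection H \<alpha> \<otimes>\<^bsub>BijGroup (dual H)\<^esub> v) \<alpha>s \<one>\<^bsub>BijGroup (dual H)\<^esub>"
      using bs bs' foldr_reflection[OF R[OF bs']] weyl_element_eq_iff by (intro exI[of _ bs]) auto
    fix n assume "\<exists>\<alpha>s. length \<alpha>s = n \<and> set \<alpha>s \<subseteq> \<pi> \<and> weyl_element as =
        foldr (\<lambda>\<alpha> v. reflection H \<alpha> \<otimes>\<^bsub>BijGroup (dual H)\<^esub> v) \<alpha>s \<one>\<^bsub>BijGroup (dual H)\<^esub>"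
    then obtain cs where cs: "length cs = n" "set cs \<subseteq> \<pi>" "weyl_element as = weyl_element cs"
      using foldr_reflection[OF R] by metis
    then have "\<forall>\<mu>\<in>V. act cs \<mu> = act bs \<mu>" using weyl_element_eq_iff bs(2) by simp
    then show "length bs \<le> n" using bs(1) cs by (auto simp: reduced_word_def)
  qed
  also have "\<dots> = card (inversions bs)" using card_inversions[OF bs(1)] by simp
  also have "inversions bs = inversions as" using bs(2) by (intro inversions_cong) auto
  finally show ?thesis .
qed

lemma act_scale: "act as (\<lambda>x. c * \<mu> x) = (\<lambda>x. c * act as \<mu> x)"
  by (induction as) (auto simp: refl_scale)

lemma shifted_action_0:
  assumes "set as \<subseteq> \<pi>"
  shows "shifted_action H \<pi> (weyl_element as) 0 = - \<Sum>(inversions as)"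
proof -
  have half: "half_sum H \<pi> = (\<lambda>x. 1 / 2 * two_rho x)"
    by (auto simp: half_sum_def two_rho_def pos_eq sum_apply)
  have "half_sum H \<pi> \<in> dual H"
    unfolding half using fn.span_scale[OF two_rho_in_V] V_eq_dual by blast
  then have "shifted_action H \<pi> (weyl_element as) 0 = act as (half_sum H \<pi>) - half_sum H \<pi>"
    by (simp only: shifted_action_def add_0_left weyl_element_def restrict_apply')
  also have "\<dots> = (\<lambda>x. 1 / 2 * (two_rho - (\<Sum>(inversions as) + \<Sum>(inversions as))) x) - (\<lambda>x. 1 / 2 * two_rho x)"
    unfolding half act_scale act_two_rho[OF assms] ..
  also have "\<dots> = - \<Sum>(inversions as)"
    by (auto simp: fun_eq_iff algebra_simps)
  finally show ?thesis .
qed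

lemma inversions_in_dual: "\<Sum>(inversions as) \<in> dual H"
  unfolding V_eq_dual[symmetric] using inversions_subset pos_in_V by (intro fn.span_sum) blast

lemma pos_in_group_closure: "\<beta> \<in> pos \<Longrightarrow> \<beta> \<in> group_closure \<pi>"
  using nat_span_subset_group_closure by (auto simp: pos_def)

lemma coefficient_sum_list_pos:
  assumes "set \<gamma>s \<subseteq> pos"
  shows "\<exists>n. coefficient \<pi> (sum_list \<gamma>s) s = of_nat n \<and> (n = 0 \<longrightarrow> (\<forall>\<gamma>\<in>set \<gamma>s. coefficient \<pi> \<gamma> s = 0))"
  using assms
proof (induction \<gamma>s)
  case Nil
  have "coefficient \<pi> (sum_list []) s = of_nat 0" by (simp only: sum_list.Nil fn.representation_zero of_nat_0)
  then show ?case by (intro exI[of _ 0] conjI) (assumption, simp)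
next
  case (Cons \<gamma> \<gamma>s)
  then obtain n where n: "coefficient \<pi> (sum_list \<gamma>s) s = of_nat n" "n = 0 \<Longrightarrow> \<forall>\<gamma>\<in>set \<gamma>s. coefficient \<pi> \<gamma> s = 0"
    by auto
  have gp: "\<gamma> \<in> pos" and sub: "set \<gamma>s \<subseteq> pos" using Cons.prems by auto
  obtain m where m: "coefficient \<pi> \<gamma> s = of_nat m" using pos_coefficient gp by blast
  have "coefficient \<pi> (sum_list (\<gamma> # \<gamma>s)) s = of_nat (m + n)"
    unfolding sum_list.Cons of_nat_add m[symmetric] n(1)[symmetric]
    by (rule coefficient_add[OF pos_in_V[OF gp, unfolded V_eq_dual] sum_list_pos_in_V[OF sub, unfolded V_eq_dual]])
  moreover have "m + n = 0 \<longrightarrow> (\<forall>\<delta>\<in>set (\<gamma> # \<gamma>s). coefficient \<pi> \<delta> s = 0)" using m n(2) by auto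
  ultimately show ?case by blast
qed

text \<open>Coefficients of positive roots are natural numbers, so there is no cancellation.\<close>

lemma coefficient_sum_list_pos_eq_0:
  "set \<gamma>s \<subseteq> pos \<Longrightarrow> coefficient \<pi> (sum_list \<gamma>s) s = 0 \<Longrightarrow> \<forall>\<gamma>\<in>set \<gamma>s. coefficient \<pi> \<gamma> s = 0"
  using coefficient_sum_list_pos[of \<gamma>s s] by auto

section \<open>Minimal coset representatives and the three assertions\<close>

context
  fixes s S
  assumes s: "s \<in> \<pi>" and S: "S = \<pi> - {s}" and irr: "irreducible_quotient (parabolic H \<pi> S)"
begin

lemma levi_iff: "x \<in> group_closure \<pi> \<Longrightarrow> x \<in> levi_lattice S \<longleftrightarrow> coefficient \<pi> x s = 0"
  using group_closure_remove[OF base_independent s] coefficient_levi by (auto simp: levi_lattice_def S)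

text \<open>An inversion \<beta> with coefficient 0 at s would be a positive Levi root and hence the
  image of a positive root under w, but -\<beta> is such an image as well. Irreducibility leaves
  only the coefficient 1, so the coefficient of the sum counts the inversions.\<close>

lemma min_coset_rep:
  assumes "w \<in> min_coset_reps H \<pi> S"
  shows "\<exists>as. set as \<subseteq> \<pi> \<and> w = weyl_element as \<and> pos_levi_roots H \<pi> S \<subseteq> act as ` pos \<and>
    coefficient \<pi> (\<Sum>(inversions as)) s = of_nat (weyl_length H \<pi> w)"
proof -
  obtain as where as: "set as \<subseteq> \<pi>" "w = weyl_element as"
    using weyl_group_elements assms by (auto simp: min_coset_reps_def)
  have R: "set as \<subseteq> roots H" using as(1) simple_root_is_root by blast
  have "w ` pos = act as ` pos"
    using pos_in_V V_eq_dual by (intro image_cong) (auto simp: as weyl_element_def)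
  then have levi: "pos_levi_roots H \<pi> S \<subseteq> act as ` pos"
    using assms pos_eq by (simp add: min_coset_reps_def)
  have "coefficient \<pi> \<beta> s = 1" if b: "\<beta> \<in> inversions as" for \<beta>
  proof (rule ccontr)
    assume "coefficient \<pi> \<beta> s \<noteq> 1"
    have bp: "\<beta> \<in> pos" using b inversions_subset by blast
    then have "coefficient \<pi> \<beta> s = 0"
      using coefficient_le_1_if_irreducible[OF irr[unfolded S] s bp] \<open>coefficient \<pi> \<beta> s \<noteq> 1\<close> by blast
    then have "\<beta> \<in> levi_lattice S" using levi_iff pos_in_group_closure[OF bp] by blast
    then have "\<beta> \<in> pos_levi_roots H \<pi> S" using bp pos_eq by (simp add: pos_levi_roots_def)
    then obtain \<gamma> where g: "\<gamma> \<in> pos" "\<beta> = act as \<gamma>" using levi by blast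
    obtain \<delta> where d: "\<delta> \<in> pos" "- \<beta> = act as \<delta>" using b by (auto simp: inversions_def)
    have "act (rev as) (act as \<delta>) = - act (rev as) (act as \<gamma>)" unfolding d(2)[symmetric] g(2)[symmetric] by (rule act_minus)
    then have "\<delta> = - \<gamma>" using act_rev(1)[OF R] by simp
    then show False using g(1) d(1) pos_not_neg by blast
  qed
  moreover have "coefficient \<pi> (\<Sum>(inversions as)) s = (\<Sum>\<beta>\<in>inversions as. coefficient \<pi> \<beta> s)"
    using inversions_subset pos_in_V by (subst fn.representation_sum[OF base_independent]) auto
  ultimately have "coefficient \<pi> (\<Sum>(inversions as)) s = of_nat (weyl_length H \<pi> w)"
    using weyl_length_eq[OF as(1)] as(2) by simp
  then show ?thesis using as levi by blast
qed

lemma inversions_in_group_closure: "\<Sum>(inversions as) \<in> group_closure \<pi>"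
  using inversions_subset pos_in_group_closure by (intro group_closure_sum_mem) blast

lemma difference_in_levi_lattice:
  assumes "w1 \<in> min_coset_reps H \<pi> S" "w2 \<in> min_coset_reps H \<pi> S" "weyl_length H \<pi> w1 = weyl_length H \<pi> w2"
  shows "shifted_action H \<pi> w1 0 - shifted_action H \<pi> w2 0 \<in> levi_lattice S"
    and "w1 \<noteq> w2 \<Longrightarrow> shifted_action H \<pi> w1 0 - shifted_action H \<pi> w2 0 \<notin> pos_levi_lattice H \<pi> S"
proof -
  obtain as where as: "set as \<subseteq> \<pi>" "w1 = weyl_element as" "coefficient \<pi> (\<Sum>(inversions as)) s = of_nat (weyl_length H \<pi> w1)"
    using min_coset_rep[OF assms(1)] by blast
  obtain bs where bs: "set bs \<subseteq> \<pi>" "w2 = weyl_element bs" "pos_levi_roots H \<pi> S \<subseteq> act bs ` pos"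
      "coefficient \<pi> (\<Sum>(inversions bs)) s = of_nat (weyl_length H \<pi> w2)"
    using min_coset_rep[OF assms(2)] by blast
  \<comment> \<open>The order is reversed because w.0 is minus the sum of the inversions.\<close>
  define \<gamma> where "\<gamma> = \<Sum>(inversions bs) - \<Sum>(inversions as)"
  have diff: "shifted_action H \<pi> w1 0 - shifted_action H \<pi> w2 0 = \<gamma>"
    unfolding as(2) bs(2) shifted_action_0[OF as(1)] shifted_action_0[OF bs(1)] \<gamma>_def by simp
  have c0: "coefficient \<pi> \<gamma> s = 0"
    unfolding \<gamma>_def coefficient_diff[OF inversions_in_dual inversions_in_dual] as(3) bs(4) assms(3) by simp
  have "\<gamma> \<in> group_closure \<pi>" unfolding \<gamma>_def by (intro group_closure.diff inversions_in_group_closure)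
  then show "shifted_action H \<pi> w1 0 - shifted_action H \<pi> w2 0 \<in> levi_lattice S"
    unfolding diff using levi_iff c0 by blast
  assume ne: "w1 \<noteq> w2"
  show "shifted_action H \<pi> w1 0 - shifted_action H \<pi> w2 0 \<notin> pos_levi_lattice H \<pi> S"
    unfolding diff
  proof
    assume "\<gamma> \<in> pos_levi_lattice H \<pi> S"
    then obtain \<gamma>s where gs: "\<gamma> = sum_list \<gamma>s" "set \<gamma>s \<subseteq> pos"
      unfolding pos_levi_lattice_def pos_lattice_def nat_span_def pos_eq by blast
    \<comment> \<open>Membership in the positive cone gives only some list of positive roots; lack
      of cancellation puts each entry among the Levi roots, which w_2 obtains from positive
      roots.\<close>
    have "set \<gamma>s \<subseteq> pos_levi_roots H \<pi> S"
    proof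
      fix \<delta> assume d: "\<delta> \<in> set \<gamma>s"
      then have "coefficient \<pi> \<delta> s = 0" using coefficient_sum_list_pos_eq_0[OF gs(2)] c0 gs(1) by blast
      then have "\<delta> \<in> levi_lattice S" using levi_iff pos_in_group_closure d gs(2) by blast
      then show "\<delta> \<in> pos_levi_roots H \<pi> S" using d gs(2) pos_eq by (auto simp: pos_levi_roots_def)
    qed
    then have sub: "set \<gamma>s \<subseteq> act bs ` pos" using bs(3) by blast
    have "act as two_rho = act bs two_rho + (sum_list \<gamma>s + sum_list \<gamma>s)"
      unfolding act_two_rho[OF as(1)] act_two_rho[OF bs(1)] gs(1)[symmetric] \<gamma>_def
      by (auto simp: fun_eq_iff algebra_simps)
    then have "\<forall>\<mu>\<in>V. act as \<mu> = act bs \<mu>"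
      using act_eq_if_difference_dominated[OF as(1) bs(1) _ gs(2) sub] by blast
    then show False using ne as(2) bs(2) weyl_element_eq_iff by blast
  qed
qed

lemma coefficient_of_difference:
  assumes "w \<in> min_coset_reps H \<pi> S" "w' \<in> min_coset_reps H \<pi> S" "weyl_length H \<pi> w = weyl_length H \<pi> w' + 1"
  shows "shifted_action H \<pi> w' 0 - shifted_action H \<pi> w 0 \<in> root_lattice H"
    and "coefficient \<pi> (shifted_action H \<pi> w' 0 - shifted_action H \<pi> w 0) s = 1"
proof -
  obtain as where as: "set as \<subseteq> \<pi>" "w = weyl_element as" "coefficient \<pi> (\<Sum>(inversions as)) s = of_nat (weyl_length H \<pi> w)"
    using min_coset_rep[OF assms(1)] by blast
  obtain bs where bs: "set bs \<subseteq> \<pi>" "w' = weyl_element bs" "coefficient \<pi> (\<Sum>(inversions bs)) s = of_nat (weyl_length H \<pi> w')"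
    using min_coset_rep[OF assms(2)] by blast
  have diff: "shifted_action H \<pi> w' 0 - shifted_action H \<pi> w 0 = \<Sum>(inversions as) - \<Sum>(inversions bs)"
    unfolding as(2) bs(2) shifted_action_0[OF as(1)] shifted_action_0[OF bs(1)] by simp
  show "coefficient \<pi> (shifted_action H \<pi> w' 0 - shifted_action H \<pi> w 0) s = 1"
    unfolding diff coefficient_diff[OF inversions_in_dual inversions_in_dual] as(3) bs(3) assms(3) by simp
  show "shifted_action H \<pi> w' 0 - shifted_action H \<pi> w 0 \<in> root_lattice H"
    unfolding diff root_lattice_def using inversions_subset pos_subset
    by (intro group_closure.diff group_closure_sum_mem) (blast intro: group_closure.base)+
qed

end

end

theorem corollary2p3:
  fixes H :: "'g::complex_lie_algebra set"
    and \<pi> S :: "('g \<Rightarrow> complex) set"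
    and \<alpha>s :: "'g \<Rightarrow> complex"
  assumes "finite_dimensional_lie_algebra TYPE('g)" and "simple_lie_algebra TYPE('g)"
    and "cartan_subalgebra H"
    and "simple_roots H \<pi>"
    and "\<alpha>s \<in> \<pi>" and "S = \<pi> - {\<alpha>s}"
    and "irreducible_quotient (parabolic H \<pi> S)"
  shows "(\<forall>w1 \<in> min_coset_reps H \<pi> S. \<forall>w2 \<in> min_coset_reps H \<pi> S.
            weyl_length H \<pi> w1 = weyl_length H \<pi> w2 \<longrightarrow>
              shifted_action H \<pi> w1 0 - shifted_action H \<pi> w2 0 \<in> levi_lattice S \<and>
              (w1 \<noteq> w2 \<longrightarrow>
                 shifted_action H \<pi> w1 0 - shifted_action H \<pi> w2 0 \<notin> pos_levi_lattice H \<pi> S)) \<and>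
         (\<forall>w \<in> min_coset_reps H \<pi> S. \<forall>w' \<in> min_coset_reps H \<pi> S.
            weyl_length H \<pi> w = weyl_length H \<pi> w' + 1 \<longrightarrow>
              shifted_action H \<pi> w' 0 - shifted_action H \<pi> w 0 \<in> root_lattice H \<and>
              coefficient \<pi> (shifted_action H \<pi> w' 0 - shifted_action H \<pi> w 0) \<alpha>s = 1)"
proof -
  interpret cartan_nonempty H \<pi>
    using assms(1-5) by unfold_locales auto
  show ?thesis
    using difference_in_levi_lattice[OF assms(5-7)] coefficient_of_difference[OF assms(5-7)] by blast
qed

end
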